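(* Let $\mathcal M={\bf H}^n_{\mathbb H}/G$ be a quaternionic hyperbolic $n$-manifold. Then the canonical collars around distinct short, simple, closed geodesics in $\mathcal M$ are disjoint. Explicitly: let $g,h\in G$ be loxodromic elements with axes $\gamma_1,\gamma_2$ and with $M_g<\sqrt3-1$ and $M_h<\sqrt3-1$, such that $\gamma_1'=\gamma_1/\langle g\rangle$ and $\gamma_2'=\gamma_2/\langle h\rangle$ are distinct simple closed geodesics in $\mathcal M$, and let $r_1,r_2>0$ be given by $$\cosh(2r_1)=\frac{2(1-M_g)}{M_g^2},\qquad \cosh(2r_2)=\frac{2(1-M_h)}{M_h^2}.$$ Then the canonical collars $C_{r_1}(\gamma_1')$ and $C_{r_2}(\gamma_2')$ in $\mathcal M$ are disjoint.
   Context: Let $\mathbb H$ be the quaternions, $n$ a positive integer, and $\mathbb H^{n,1}$ the right quaternionic vector space of column vectors with $n+1$ quaternionic entries, with the Hermitian form $\langle {\bf z},{\bf w}\rangle=\overline{w}_1z_1+\cdots+\overline{w}_{n-1}z_{n-1}-(\overline{w}_nz_{n+1}+\overline{w}_{n+1}z_n)$. ${\rm Sp}(n,1)$ is the group of linear automorphisms (matrices acting on the left) preserving this form. Let $V_0=\{{\bf z}\ne 0:\langle {\bf z},{\bf z}\rangle=0\}$, $V_-=\{{\bf z}:\langle {\bf z},{\bf z}\rangle<0\}$, and let $\mathbb P$ be the right projection ${\bf z}\mapsto[{\bf z}]$, where ${\bf z}\sim{\bf z}\lambda$ for $\lambda\in\mathbb H\setminus\{0\}$. Quaternionic hyperbolic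 space is ${\bf H}^n_{\mathbb H}=\mathbb P(V_-)$, with boundary $\partial{\bf H}^n_{\mathbb H}=\mathbb P(V_0)$ and Bergman metric $\rho$ given by $\cosh^2\frac{\rho(z,w)}{2}=\frac{\langle{\bf z},{\bf w}\rangle\langle{\bf w},{\bf z}\rangle}{\langle{\bf z},{\bf z}\rangle\langle{\bf w},{\bf w}\rangle}$ for any lifts ${\bf z},{\bf w}$ of $z,w$; ${\rm Sp}(n,1)$ acts by isometries. A quaternionic hyperbolic $n$-manifold is a quotient ${\bf H}^n_{\mathbb H}/G$ with $G$ a discrete, non-elementary, torsion-free subgroup of ${\rm Sp}(n,1)$. A subgroup of ${\rm Sp}(n,1)$ is elementary if it has a finite orbit in ${\bf H}^n_{\mathbb H}\cup\partial{\bf H}^n_{\mathbb H}$. An element $g\in{\rm Sp}(n,1)$ is loxodromic if it has exactly two fixed points in ${\bf H}^n_{\mathbb H}\cup\partial{\bf H}^n_{\mathbb H}$, and both lie in $\partial{\bf H}^n_{\mathbb H}$; its axis is the geodesic joining them. Such $g$ is conjugate in ${\rm Sp}(n,1)$ to ${\rm diag}(\lambda_1,\ldots,\lambda_{n-1},\lambda_n,\overline{\lambda}_n^{-1})$ with $\lambda_i\in\mathbb H$, $|\lambda_i|=1$ for $1\le i\le n-1$, and $|\lambda_n|>1$. Define the conjugacy invariants $$\delta(g)=\max_{1\le i\le n-1}|\lambda_i-1|,\qquad M_g=2\delta(g)+|\lambda_n-1|+|\overline{\lambda}_n^{-1}-1|$$ (a maximum over an empty index set is $0$). For a geodesic $\gamma$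 and $r>0$, the tube $T_r(\gamma)$ is the set of points of ${\bf H}^n_{\mathbb H}$ at distance less than $r$ from $\gamma$. If $\gamma$ is the axis of a loxodromic $g\in G$ and $\gamma'=\gamma/\langle g\rangle$ is the corresponding closed geodesic in $\mathcal M$, the collar of width $r$ about $\gamma'$ is $C_r(\gamma')=T_r(\gamma)/\langle g\rangle$, viewed as a subset of $\mathcal M$ (the image of $T_r(\gamma)$). When $M_g<\sqrt3-1$ the closed geodesic is called short, and the collar with $\cosh(2r)=2(1-M_g)/M_g^2$ is called canonical. Closed geodesics $\gamma_1',\gamma_2'$ are distinct when they are different subsets of $\mathcal M$, equivalently no element of $G$ maps $\gamma_1$ to $\gamma_2$. *)

theory Defs
  imports Complex_Main "HOL-Analysis.Product_Vector" "HOL-Algebra.Group" "Jordan_Normal_Form.Matrix"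
begin

section \<open>The quaternions\<close>

text \<open>\<open>Quat a b c d\<close> is $a + bi + cj + dk$.\<close>

datatype quat = Quat (qRe: real) (qI: real) (qJ: real) (qK: real)

lemma quat_eq_iff: "p = q \<longleftrightarrow> qRe p = qRe q \<and> qI p = qI q \<and> qJ p = qJ q \<and> qK p = qK q"
  by (cases p; cases q) simp

definition qcnj :: "quat \<Rightarrow> quat" where
  "qcnj q = Quat (qRe q) (- qI q) (- qJ q) (- qK q)"

lemma qcnj_sel [simp]:
  "qRe (qcnj q) = qRe q" "qI (qcnj q) = - qI q" "qJ (qcnj q) = - qJ q" "qK (qcnj q) = - qK q"
  by (simp_all add: qcnj_def)

instantiation quat :: ring_1
begin

definition "0 = Quat 0 0 0 0"
definition "1 = Quat 1 0 0 0"
definition "p + q = Quat (qRe p + qRe q) (qI p + qI q) (qJ p + qJ q) (qK p + qK q)"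
definition "- q = Quat (- qRe q) (- qI q) (- qJ q) (- qK q)"
definition "p - q = Quat (qRe p - qRe q) (qI p - qI q) (qJ p - qJ q) (qK p - qK q)"
definition "p * q = Quat
  (qRe p * qRe q - qI p * qI q - qJ p * qJ q - qK p * qK q)
  (qRe p * qI q + qI p * qRe q + qJ p * qK q - qK p * qJ q)
  (qRe p * qJ q - qI p * qK q + qJ p * qRe q + qK p * qI q)
  (qRe p * qK q + qI p * qJ q - qJ p * qI q + qK p * qRe q)"

instance
  by standard
    (simp_all add: zero_quat_def one_quat_def plus_quat_def uminus_quat_def minus_quat_def
      times_quat_def algebra_simps quat_eq_iff)

end

lemma quat_zero_sel [simp]: "qRe 0 = 0" "qI 0 = 0" "qJ 0 = 0" "qK 0 = 0"
  by (simp_all add: zero_quat_def)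

lemma quat_one_sel [simp]: "qRe 1 = 1" "qI 1 = 0" "qJ 1 = 0" "qK 1 = 0"
  by (simp_all add: one_quat_def)

lemma quat_plus_sel [simp]:
  "qRe (p + q) = qRe p + qRe q" "qI (p + q) = qI p + qI q"
  "qJ (p + q) = qJ p + qJ q" "qK (p + q) = qK p + qK q"
  by (simp_all add: plus_quat_def)

lemma quat_uminus_sel [simp]:
  "qRe (- q) = - qRe q" "qI (- q) = - qI q" "qJ (- q) = - qJ q" "qK (- q) = - qK q"
  by (simp_all add: uminus_quat_def)

lemma quat_minus_sel [simp]:
  "qRe (p - q) = qRe p - qRe q" "qI (p - q) = qI p - qI q"
  "qJ (p - q) = qJ p - qJ q" "qK (p - q) = qK p - qK q"
  by (simp_all add: minus_quat_def)

lemma quat_times_sel: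
  "qRe (p * q) = qRe p * qRe q - qI p * qI q - qJ p * qJ q - qK p * qK q"
  "qI (p * q) = qRe p * qI q + qI p * qRe q + qJ p * qK q - qK p * qJ q"
  "qJ (p * q) = qRe p * qJ q - qI p * qK q + qJ p * qRe q + qK p * qI q"
  "qK (p * q) = qRe p * qK q + qI p * qJ q - qJ p * qI q + qK p * qRe q"
  by (simp_all add: times_quat_def)

instantiation quat :: real_algebra_1
begin

definition "scaleR r q = Quat (r * qRe q) (r * qI q) (r * qJ q) (r * qK q)"

lemma scaleR_quat_sel [simp]:
  "qRe (scaleR r q) = r * qRe q" "qI (scaleR r q) = r * qI q"
  "qJ (scaleR r q) = r * qJ q" "qK (scaleR r q) = r * qK q"
  by (simp_all add: scaleR_quat_def)

instance
  by standard (simp_all add: quat_eq_iff quat_times_sel algebra_simps)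

end

instantiation quat :: real_normed_div_algebra
begin

definition "norm q = sqrt ((qRe q)\<^sup>2 + (qI q)\<^sup>2 + (qJ q)\<^sup>2 + (qK q)\<^sup>2)"
definition "sgn (q :: quat) = q /\<^sub>R norm q"
definition "dist (p :: quat) q = norm (p - q)"
definition "inverse (q :: quat) = qcnj q /\<^sub>R (norm q)\<^sup>2"
definition "(p :: quat) div q = p * inverse q"
definition [code del]:
  "(uniformity :: (quat \<times> quat) filter) = (INF e\<in>{0<..}. principal {(x, y). dist x y < e})"
definition [code del]:
  "open (U :: quat set) \<longleftrightarrow> (\<forall>x\<in>U. \<forall>\<^sub>F (x', y) in uniformity. x' = x \<longrightarrow> y \<in> U)"

lemma norm_quat_sq: "(norm (q::quat))\<^sup>2 = (qRe q)\<^sup>2 + (qI q)\<^sup>2 + (qJ q)\<^sup>2 + (qK q)\<^sup>2"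
  by (simp add: norm_quat_def)

lemma norm_quat_tuple: "norm (q::quat) = norm (qRe q, qI q, qJ q, qK q)"
  by (simp add: norm_quat_def norm_Pair add_ac)

lemma norm_quat_eq_0: "norm (q::quat) = 0 \<longleftrightarrow> q = 0"
  unfolding norm_quat_tuple norm_eq_zero by (simp add: quat_eq_iff zero_prod_def)

lemma quat_inverse_aux:
  assumes "(q::quat) \<noteq> 0"
  shows "inverse q * q = 1" "q * inverse q = 1"
proof -
  have nz: "(norm q)\<^sup>2 \<noteq> 0" using assms norm_quat_eq_0 by auto
  have *: "inverse ((norm q)\<^sup>2) * ((qRe q)\<^sup>2 + (qI q)\<^sup>2 + (qJ q)\<^sup>2 + (qK q)\<^sup>2) = 1"
    unfolding norm_quat_sq [symmetric] using nz by simp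
  show "inverse q * q = 1" "q * inverse q = 1"
    unfolding inverse_quat_def quat_eq_iff quat_times_sel
    using * by (simp_all add: algebra_simps power2_eq_square)
qed

instance
proof
  fix p q r :: quat and a :: real
  show "sgn p = p /\<^sub>R norm p" by (rule sgn_quat_def)
  show "dist p q = norm (p - q)" by (rule dist_quat_def)
  show "p div q = p * inverse q" by (rule divide_quat_def)
  show "p \<noteq> 0 \<Longrightarrow> inverse p * p = 1" "p \<noteq> 0 \<Longrightarrow> p * inverse p = 1"
    by (rule quat_inverse_aux, assumption)+
  show "inverse (0::quat) = 0" by (simp add: inverse_quat_def quat_eq_iff)
  show "(uniformity :: (quat \<times> quat) filter) = (INF e\<in>{0<..}. principal {(x, y). dist x y < e})"
    by (rule uniformity_quat_def)
  show "open U \<longleftrightarrow> (\<forall>x\<in>U. \<forall>\<^sub>F (x', y) in uniformity. x' = x \<longrightarrow> y \<in> U)" for U :: "quat set"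
    by (rule open_quat_def)
  show "norm p = 0 \<longleftrightarrow> p = 0" by (rule norm_quat_eq_0)
  show "norm (p + q) \<le> norm p + norm q"
    using norm_triangle_ineq [of "(qRe p, qI p, qJ p, qK p)" "(qRe q, qI q, qJ q, qK q)"]
    by (simp add: norm_quat_tuple)
  show "norm (a *\<^sub>R p) = \<bar>a\<bar> * norm p"
  proof -
    have "(qRe (a *\<^sub>R p), qI (a *\<^sub>R p), qJ (a *\<^sub>R p), qK (a *\<^sub>R p)) = a *\<^sub>R (qRe p, qI p, qJ p, qK p)"
      by simp
    then show ?thesis by (simp only: norm_quat_tuple norm_scaleR)
  qed
  have "(norm (p * q))\<^sup>2 = (norm p * norm q)\<^sup>2"
    unfolding power_mult_distrib norm_quat_sq quat_times_sel
    by (simp add: power2_eq_square algebra_simps)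
  then show "norm (p * q) = norm p * norm q"
    by (simp add: norm_quat_def)
qed

end


section \<open>The Hermitian form and Sp(n,1)\<close>

text \<open>
  Vectors in $\mathbb H^{n,1}$ and their matrices are those of the library, with dimension
  \<open>n + 1\<close> and indices shifted down by one: coordinate \<open>z\<^sub>i\<close> is \<open>z $ (i - 1)\<close>.
\<close>

definition herm :: "nat \<Rightarrow> quat vec \<Rightarrow> quat vec \<Rightarrow> quat" where
  "herm n z w = (\<Sum>i<n - 1. qcnj (w $ i) * z $ i)
     - (qcnj (w $ (n - 1)) * z $ n + qcnj (w $ n) * z $ (n - 1))"

definition Sp :: "nat \<Rightarrow> quat mat monoid" where
  "Sp n = \<lparr>carrier = {A \<in> carrier_mat (n + 1) (n + 1). invertible_mat A \<and>
              (\<forall>z\<in>carrier_vec (n + 1). \<forall>w\<in>carrier_vec (n + 1).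
                 herm n (A *\<^sub>v z) (A *\<^sub>v w) = herm n z w)},
           mult = (*), one = 1\<^sub>m (n + 1)\<rparr>"

definition V_zero :: "nat \<Rightarrow> quat vec set" where
  "V_zero n = {z \<in> carrier_vec (n + 1). z \<noteq> 0\<^sub>v (n + 1) \<and> herm n z z = 0}"

text \<open>\<open>herm n z z\<close> is always real, so its sign is that of its real part.\<close>

definition V_minus :: "nat \<Rightarrow> quat vec set" where
  "V_minus n = {z \<in> carrier_vec (n + 1). qRe (herm n z z) < 0}"


section \<open>Quaternionic hyperbolic space\<close>

text \<open>A projective point is the set of all its lifts.\<close>

type_synonym point = "quat vec set"

definition proj :: "quat vec \<Rightarrow> point" where
  "proj z = {map_vec (\<lambda>x. x * l) z | l. l \<noteq> 0}"

definition hyp :: "nat \<Rightarrow> point set" where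
  "hyp n = proj ` V_minus n"

definition bdry :: "nat \<Rightarrow> point set" where
  "bdry n = proj ` V_zero n"

definition act :: "quat mat \<Rightarrow> point \<Rightarrow> point" where
  "act g p = (\<lambda>z. g *\<^sub>v z) ` p"

definition rho :: "nat \<Rightarrow> point \<Rightarrow> point \<Rightarrow> real" where
  "rho n p q = (THE d. d \<ge> 0 \<and> (\<forall>z\<in>p. \<forall>w\<in>q.
     of_real ((cosh (d / 2))\<^sup>2) = (herm n z w * herm n w z) / (herm n z z * herm n w w)))"

text \<open>
  Convergence in the quotient topology of projective space: since the projection is open and
  has local sections, it amounts to the convergence of suitable lifts.
\<close>

definition proj_tendsto :: "nat \<Rightarrow> (real \<Rightarrow> point) \<Rightarrow> point \<Rightarrow> real filter \<Rightarrow> bool" where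
  "proj_tendsto n c p F \<longleftrightarrow> (\<exists>v\<in>p. \<exists>\<zeta>. (\<forall>t. \<zeta> t \<in> c t) \<and>
     (\<forall>i<n + 1. ((\<lambda>t. \<zeta> t $ i) \<longlongrightarrow> v $ i) F))"

definition geodesic_joining :: "nat \<Rightarrow> point \<Rightarrow> point \<Rightarrow> point set \<Rightarrow> bool" where
  "geodesic_joining n p q \<gamma> \<longleftrightarrow> (\<exists>c :: real \<Rightarrow> point.
     (\<forall>t. c t \<in> hyp n) \<and> (\<forall>s t. rho n (c s) (c t) = \<bar>s - t\<bar>) \<and>
     proj_tendsto n c p at_bot \<and> proj_tendsto n c q at_top \<and> \<gamma> = range c)"


section \<open>Loxodromic elements\<close>

definition fixed_points :: "nat \<Rightarrow> quat mat \<Rightarrow> point set" where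
  "fixed_points n g = {p \<in> hyp n \<union> bdry n. act g p = p}"

definition loxodromic :: "nat \<Rightarrow> quat mat \<Rightarrow> bool" where
  "loxodromic n g \<longleftrightarrow> g \<in> carrier (Sp n) \<and> card (fixed_points n g) = 2 \<and>
     fixed_points n g \<subseteq> bdry n"

definition is_axis :: "nat \<Rightarrow> quat mat \<Rightarrow> point set \<Rightarrow> bool" where
  "is_axis n g \<gamma> \<longleftrightarrow> (\<exists>p q. p \<noteq> q \<and> fixed_points n g = {p, q} \<and> geodesic_joining n p q \<gamma>)"

text \<open>
  \<open>lox_normal_form n g l\<close>: \<open>g\<close> is conjugate to the diagonal matrix with entries
  \<open>\<lambda>\<^sub>1, \<dots>, \<lambda>\<^sub>n\<close> and \<open>\<lambda>\<^sub>n\<close> conjugate-inverted, where \<open>\<lambda>\<^sub>i\<close> is \<open>l (i - 1)\<close>.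
\<close>

definition lox_normal_form :: "nat \<Rightarrow> quat mat \<Rightarrow> (nat \<Rightarrow> quat) \<Rightarrow> bool" where
  "lox_normal_form n g l \<longleftrightarrow> (\<forall>i<n - 1. norm (l i) = 1) \<and> norm (l (n - 1)) > 1 \<and>
     (\<exists>A\<in>carrier (Sp n).
        g = A \<otimes>\<^bsub>Sp n\<^esub> mat_diag (n + 1) (\<lambda>i. if i < n then l i else inverse (qcnj (l (n - 1))))
              \<otimes>\<^bsub>Sp n\<^esub> inv\<^bsub>Sp n\<^esub> A)"

text \<open>
  The \<open>l i\<close> are determined by \<open>g\<close> only up to order and similarity of quaternions, which do not
  affect the values below.
\<close>

definition lox_eigenvalues :: "nat \<Rightarrow> quat mat \<Rightarrow> nat \<Rightarrow> quat" where
  "lox_eigenvalues n g = (SOME l. lox_normal_form n g l)"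

text \<open>The norms are nonnegative, so inserting \<open>0\<close> matters only when the index set is empty.\<close>

definition lox_delta :: "nat \<Rightarrow> quat mat \<Rightarrow> real" where
  "lox_delta n g = Max (insert 0 ((\<lambda>i. norm (lox_eigenvalues n g i - 1)) ` {..<n - 1}))"

definition lox_M :: "nat \<Rightarrow> quat mat \<Rightarrow> real" where
  "lox_M n g = 2 * lox_delta n g + norm (lox_eigenvalues n g (n - 1) - 1)
     + norm (inverse (qcnj (lox_eigenvalues n g (n - 1))) - 1)"


section \<open>Quaternionic hyperbolic manifolds and collars\<close>

text \<open>Isolation of every element, in the topology of entrywise convergence of matrices.\<close>

definition discrete_mats :: "nat \<Rightarrow> quat mat set \<Rightarrow> bool" where
  "discrete_mats n G \<longleftrightarrow> (\<forall>g\<in>G. \<exists>\<epsilon>>0. \<forall>h\<in>G.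
     (\<forall>i<n + 1. \<forall>j<n + 1. norm (h $$ (i, j) - g $$ (i, j)) < \<epsilon>) \<longrightarrow> h = g)"

definition G_orbit :: "quat mat set \<Rightarrow> point \<Rightarrow> point set" where
  "G_orbit G p = (\<lambda>g. act g p) ` G"

definition elementary :: "nat \<Rightarrow> quat mat set \<Rightarrow> bool" where
  "elementary n G \<longleftrightarrow> (\<exists>p\<in>hyp n \<union> bdry n. finite (G_orbit G p))"

definition torsion_free :: "nat \<Rightarrow> quat mat set \<Rightarrow> bool" where
  "torsion_free n G \<longleftrightarrow> (\<forall>g\<in>G. \<forall>k::nat. k > 0 \<and> g [^]\<^bsub>Sp n\<^esub> k = \<one>\<^bsub>Sp n\<^esub> \<longrightarrow> g = \<one>\<^bsub>Sp n\<^esub>)"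

definition manifold_group :: "nat \<Rightarrow> quat mat set \<Rightarrow> bool" where
  "manifold_group n G \<longleftrightarrow> subgroup G (Sp n) \<and> discrete_mats n G \<and> \<not> elementary n G \<and>
     torsion_free n G"

text \<open>
  The points of the manifold are the \<open>G\<close>-orbits of points of \<open>hyp n\<close>. The closed geodesic below
  a geodesic and the collar around it are sets of such points.
\<close>

definition closed_geodesic :: "quat mat set \<Rightarrow> point set \<Rightarrow> point set set" where
  "closed_geodesic G \<gamma> = G_orbit G ` \<gamma>"

text \<open>
  The closed geodesic below \<open>\<gamma>\<close> has no self-intersections: two points of \<open>\<gamma>\<close> are identified
  in the manifold only by elements of \<open>G\<close> that map \<open>\<gamma>\<close> to itself.
\<close>

definition simple_below :: "quat mat set \<Rightarrow> point set \<Rightarrow> bool" where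
  "simple_below G \<gamma> \<longleftrightarrow> (\<forall>f\<in>G. act f ` \<gamma> = \<gamma> \<or> act f ` \<gamma> \<inter> \<gamma> = {})"

definition tube :: "nat \<Rightarrow> real \<Rightarrow> point set \<Rightarrow> point set" where
  "tube n r \<gamma> = {z \<in> hyp n. (INF p\<in>\<gamma>. rho n z p) < r}"

definition collar :: "nat \<Rightarrow> quat mat set \<Rightarrow> real \<Rightarrow> point set \<Rightarrow> point set set" where
  "collar n G r \<gamma> = G_orbit G ` tube n r \<gamma>"

end

theory Submission
  imports Defs "HOL-Analysis.L2_Norm" "HOL-Computational_Algebra.Fundamental_Theorem_Algebra"
begin

text \<open>
  Let \<open>u\<close>, \<open>v\<close> be null lifts of the fixed points of \<open>g\<close> and \<open>p\<close>, \<open>q\<close> null lifts of those of (a conjugate of)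
  \<open>h\<close>, with $\langle u, v\rangle = \langle p, q\rangle = -1$. If points of the two axes are at distance less than
  $r_1 + r_2$, then $s + t < \cosh(r_1 + r_2)$ for
  $s = |\langle p, v\rangle \langle q, u\rangle|$ and $t = |\langle p, u\rangle \langle q, v\rangle|$, and
  $\cosh^2(r_1 + r_2) \le \cosh 2r_1 \cosh 2r_2$. A loxodromic \<open>h\<close> moves null vectors little:
  $|\langle h x, x\rangle| \le M_h |\langle x, p\rangle \langle x, q\rangle|$, whence
  $\beta^2 = |\langle h u, u\rangle \langle h v, v\rangle| \le M_h^2\, s t$. If $M_g \le M_h$ (as one may assume by
  symmetry), these estimates give $M_g (1 + \beta) < 1$. This contradicts a form of Jorgensen's inequality
  unless \<open>g\<close> and \<open>h\<close> have the same fixed points, in which case the axes coincide.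
\<close>

section \<open>Quaternions and vectors\<close>

text \<open>The collar width is tuned to the estimate: \<open>4 s t \<le> (s + t)^2\<close> turns
  the product of the two hyperbolic cosines into
  \<open>\<beta>^2 < (1 - M_g) (1 - M_h) / M_g^2\<close>, and \<open>M_g \<le> M_h\<close> bounds
  this by \<open>((1 - M_g) / M_g)^2\<close>, which is the condition on
  \<open>M_g (1 + \<beta>)\<close>. Of the two squares in the denominator, that of
  \<open>M_h\<close> is consumed by the displacement bound and that of \<open>M_g\<close> by
  Jorgensen's inequality. Noncommutativity of the scalars rules out determinants and characteristic
  polynomials, so linear algebra is reduced to elimination, and eigenvectors come from real
  polynomials, whose coefficients are central. In Jorgensen's inequality the successive conjugates
  may be unbounded, because \<open>g\<close> translates along its axis; multiplying by powers of
  \<open>g\<close> on both sides keeps the cross ratios and brings everything into a bounded set. A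
  discrete group meets such a set in finitely many elements, so \<open>\<beta>\<close> cannot
  decrease strictly for ever. The value \<open>\<beta> = 0\<close> means a shared end, and
  discreteness then forces both ends to be fixed.\<close>

lemma qcnj_simps [simp]:
  "qcnj (qcnj p) = p" "qcnj (p + q) = qcnj p + qcnj q" "qcnj (p - q) = qcnj p - qcnj q"
  "qcnj (- p) = - qcnj p" "qcnj 0 = 0" "qcnj 1 = 1"
  by (simp_all add: quat_eq_iff)

lemma qcnj_mult [simp]: "qcnj (p * q) = qcnj q * qcnj p"
  by (simp add: quat_eq_iff quat_times_sel)

lemma of_real_quat_sel [simp]:
  "qRe (of_real r) = r" "qI (of_real r) = 0" "qJ (of_real r) = 0" "qK (of_real r) = 0"
  by (simp_all add: of_real_def)

lemma quat_numeral_sel [simp]: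
  "qRe (numeral k) = numeral k" "qI (numeral k) = 0" "qJ (numeral k) = 0" "qK (numeral k) = 0"
  by (metis of_real_numeral of_real_quat_sel)+

lemma qcnj_of_real [simp]: "qcnj (of_real r) = of_real r"
  by (simp add: quat_eq_iff)

lemma qcnj_sum: "qcnj (sum f A) = (\<Sum>x\<in>A. qcnj (f x))"
  by (induction A rule: infinite_finite_induct) simp_all

lemma qRe_sum: "qRe (sum f A) = (\<Sum>x\<in>A. qRe (f x))"
  by (induction A rule: infinite_finite_induct) simp_all

lemma norm_qcnj [simp]: "norm (qcnj q) = norm q"
  by (simp add: norm_quat_def)

lemma qcnj_eq_0_iff [simp]: "qcnj q = 0 \<longleftrightarrow> q = 0"
  by (simp add: quat_eq_iff)

lemma qcnj_mult_self: "qcnj q * q = of_real ((norm q)\<^sup>2)" "q * qcnj q = of_real ((norm q)\<^sup>2)"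
  by (simp_all add: quat_eq_iff quat_times_sel norm_quat_sq[unfolded power2_eq_square] power2_eq_square)

lemma qcnj_eq_self_iff: "qcnj q = q \<longleftrightarrow> q = of_real (qRe q)"
  by (auto simp: quat_eq_iff)

lemma qRe_le_norm: "\<bar>qRe q\<bar> \<le> norm q"
  unfolding norm_quat_def by (rule real_le_rsqrt) simp

text \<open>Equality in \<open>|Re q| \<le> |q|\<close> leaves no room for the imaginary parts. It
  provides the rigidity in \<open>axis_of_I\<close>.\<close>

lemma qRe_eq_normD:
  assumes "norm q = qRe q" shows "q = of_real (norm q)"
proof -
  have "(qI q)\<^sup>2 + (qJ q)\<^sup>2 + (qK q)\<^sup>2 = 0" using norm_quat_sq[of q] assms by simp
  moreover have "0 \<le> (qI q)\<^sup>2" "0 \<le> (qJ q)\<^sup>2" "0 \<le> (qK q)\<^sup>2" by auto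
  ultimately have "(qI q)\<^sup>2 = 0" "(qJ q)\<^sup>2 = 0" "(qK q)\<^sup>2 = 0" by linarith+
  then show ?thesis using assms by (simp add: quat_eq_iff)
qed

lemma of_real_quat_commute: "(of_real r :: quat) * q = q * of_real r"
  by (simp add: quat_eq_iff quat_times_sel)

lemma qcnj_inverse: "qcnj (inverse q) = inverse (qcnj q)"
proof (cases "q = 0")
  case False
  then have "qcnj (inverse q) * qcnj q = 1"
    by (metis qcnj_mult qcnj_simps(6) right_inverse)
  then show ?thesis using False
    by (metis inverse_unique nonzero_imp_inverse_nonzero qcnj_eq_0_iff inverse_inverse_eq)
qed simp

section \<open>Right scalar multiplication and lifts of projective points\<close>

definition rsmult :: "quat vec \<Rightarrow> quat \<Rightarrow> quat vec" (infixl \<open>\<cdot>\<^sub>r\<close> 70) where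
  "z \<cdot>\<^sub>r l = map_vec (\<lambda>x. x * l) z"

lemma rsmult_dim [simp]: "dim_vec (z \<cdot>\<^sub>r l) = dim_vec z"
  by (simp add: rsmult_def)

lemma rsmult_carrier [simp, intro]: "z \<in> carrier_vec k \<Longrightarrow> z \<cdot>\<^sub>r l \<in> carrier_vec k"
  by (simp add: rsmult_def)

lemma rsmult_index [simp]: "i < dim_vec z \<Longrightarrow> (z \<cdot>\<^sub>r l) $ i = z $ i * l"
  by (simp add: rsmult_def)

lemma rsmult_rsmult [simp]: "z \<cdot>\<^sub>r a \<cdot>\<^sub>r b = z \<cdot>\<^sub>r (a * b)"
  by (rule eq_vecI) (simp_all add: mult.assoc)

lemma rsmult_one [simp]: "z \<cdot>\<^sub>r 1 = z"
  by (rule eq_vecI) simp_all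

lemma rsmult_zero: "z \<in> carrier_vec k \<Longrightarrow> z \<cdot>\<^sub>r 0 = 0\<^sub>v k"
  by (rule eq_vecI) simp_all

lemma rsmult_add_vec:
  "x \<in> carrier_vec k \<Longrightarrow> y \<in> carrier_vec k \<Longrightarrow> (x + y) \<cdot>\<^sub>r l = x \<cdot>\<^sub>r l + y \<cdot>\<^sub>r l"
  by (rule eq_vecI) (simp_all add: distrib_right)

lemma mult_mat_vec_rsmult:
  assumes "A \<in> carrier_mat r k" "z \<in> carrier_vec k"
  shows "A *\<^sub>v (z \<cdot>\<^sub>r l) = (A *\<^sub>v z) \<cdot>\<^sub>r l"
  using assms by (intro eq_vecI) (auto simp: scalar_prod_def sum_distrib_right mult.assoc)

lemma proj_eq: "proj z = {z \<cdot>\<^sub>r l | l. l \<noteq> 0}"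
  by (simp add: proj_def rsmult_def)

lemma self_in_proj: "z \<in> proj z"
  unfolding proj_eq by (rule CollectI, rule exI[of _ 1]) simp

lemma proj_rsmult: assumes "l \<noteq> 0" shows "proj (z \<cdot>\<^sub>r l) = proj z"
proof (rule equalityI; rule subsetI)
  fix x assume "x \<in> proj (z \<cdot>\<^sub>r l)"
  then obtain m where "m \<noteq> 0" "x = z \<cdot>\<^sub>r (l * m)" unfolding proj_eq by auto
  then show "x \<in> proj z" using assms unfolding proj_eq by (intro CollectI exI[of _ "l * m"]) simp
next
  fix x assume "x \<in> proj z"
  then obtain m where "m \<noteq> 0" "x = z \<cdot>\<^sub>r m" unfolding proj_eq by auto
  moreover have "l * (inverse l * m) = m" using assms by (simp flip: mult.assoc)
  ultimately show "x \<in> proj (z \<cdot>\<^sub>r l)" using assms unfolding proj_eq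
    by (intro CollectI exI[of _ "inverse l * m"]) simp
qed

lemma proj_eq_iff: "proj z = proj w \<longleftrightarrow> (\<exists>l. l \<noteq> 0 \<and> w = z \<cdot>\<^sub>r l)"
proof
  assume "proj z = proj w"
  then have "w \<in> proj z" using self_in_proj by simp
  then show "\<exists>l. l \<noteq> 0 \<and> w = z \<cdot>\<^sub>r l" unfolding proj_eq by auto
qed (use proj_rsmult in auto)

section \<open>The Hermitian form\<close>

text \<open>The bound on \<open>n\<close> keeps the two null coordinates \<open>n - 1\<close> and
  \<open>n\<close> apart.\<close>

locale herm_space =
  fixes n :: nat
  assumes n_pos: "n \<ge> 1"
begin

abbreviation H :: "quat vec \<Rightarrow> quat vec \<Rightarrow> quat" where "H \<equiv> herm n"
abbreviation V :: "quat vec set" where "V \<equiv> carrier_vec (Suc n)"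
definition Q :: "quat vec \<Rightarrow> real" where "Q z = qRe (herm n z z)"

lemma herm_add_left: "x \<in> V \<Longrightarrow> y \<in> V \<Longrightarrow> H (x + y) w = H x w + H y w"
  by (simp add: herm_def algebra_simps sum.distrib)

lemma herm_rsmult_left: "x \<in> V \<Longrightarrow> H (x \<cdot>\<^sub>r l) w = H x w * l"
  by (simp add: herm_def algebra_simps sum_distrib_right)

lemma qcnj_herm: "qcnj (H z w) = H w z"
  by (simp add: herm_def qcnj_sum)

lemma herm_add_right: "x \<in> V \<Longrightarrow> y \<in> V \<Longrightarrow> H w (x + y) = H w x + H w y"
  by (metis herm_add_left qcnj_herm qcnj_simps(2))

lemma herm_rsmult_right: "x \<in> V \<Longrightarrow> H w (x \<cdot>\<^sub>r l) = qcnj l * H w x"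
  by (metis herm_rsmult_left qcnj_herm qcnj_mult)

lemmas herm_lin = herm_add_left herm_add_right herm_rsmult_left herm_rsmult_right

lemma herm_self: "H z z = of_real (Q z)"
  unfolding Q_def by (metis qcnj_eq_self_iff qcnj_herm)

lemma norm_herm_sym: "norm (H z w) = norm (H w z)"
  by (metis norm_qcnj qcnj_herm)

lemma herm_eq_0_sym: "H z w = 0 \<longleftrightarrow> H w z = 0"
  by (metis norm_eq_zero norm_herm_sym)

lemma herm_zero [simp]: "H (0\<^sub>v (Suc n)) w = 0" "H w (0\<^sub>v (Suc n)) = 0"
  by (simp_all add: herm_def)

lemma Q_rsmult: "z \<in> V \<Longrightarrow> Q (z \<cdot>\<^sub>r l) = Q z * (norm l)\<^sup>2"
proof -
  assume z: "z \<in> V"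
  have "H (z \<cdot>\<^sub>r l) (z \<cdot>\<^sub>r l) = qcnj l * (of_real (Q z) * l)"
    using z by (simp add: herm_lin mult.assoc del: of_real_mult) (simp add: herm_self)
  also have "\<dots> = qcnj l * l * of_real (Q z)"
    by (simp only: of_real_quat_commute mult.assoc)
  finally have "H (z \<cdot>\<^sub>r l) (z \<cdot>\<^sub>r l) = qcnj l * l * of_real (Q z)" .
  then have "Q (z \<cdot>\<^sub>r l) = qRe (of_real ((norm l)\<^sup>2 * Q z) :: quat)"
    unfolding Q_def[of "z \<cdot>\<^sub>r l"] by (simp add: qcnj_mult_self)
  then show ?thesis by (simp only: of_real_quat_sel mult.commute)
qed

lemma Q_add: "x \<in> V \<Longrightarrow> y \<in> V \<Longrightarrow> Q (x + y) = Q x + Q y + 2 * qRe (H x y)"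
  unfolding Q_def using qcnj_herm[of x y] by (simp add: herm_lin quat_eq_iff)

text \<open>Polarization: in the hyperbolic plane of the last two coordinates, their difference and
  their sum diagonalise the form, with signs plus and minus.\<close>

lemma herm_lorentz:
  "H z w = (\<Sum>i<n - 1. qcnj (w $ i) * z $ i)
     + (1/2) *\<^sub>R (qcnj (w $ (n-1) - w $ n) * (z $ (n-1) - z $ n))
     - (1/2) *\<^sub>R (qcnj (w $ (n-1) + w $ n) * (z $ (n-1) + z $ n))"
  by (simp add: herm_def quat_eq_iff quat_times_sel algebra_simps)

text \<open>The Lorentzian splitting into \<open>n\<close> positive directions and one negative one: \<open>spat\<close> holds the
  norms of the positive components.\<close>

definition spat :: "quat vec \<Rightarrow> nat \<Rightarrow> real" where
  "spat z i = (if i < n - 1 then norm (z $ i) else norm (z $ (n-1) - z $ n) / sqrt 2)"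

lemma sum_lessThan_n: "(\<Sum>i<n. f i) = (\<Sum>i<n-1. f i) + (f (n-1) :: 'b :: comm_monoid_add)"
  using n_pos by (metis Suc_pred' less_eq_Suc_le One_nat_def sum.lessThan_Suc)

lemma Q_spat: "Q z = (L2_set (spat z) {..<n})\<^sup>2 - (norm (z $ (n-1) + z $ n))\<^sup>2 / 2"
proof -
  have "(L2_set (spat z) {..<n})\<^sup>2 = (\<Sum>i<n. (spat z i)\<^sup>2)"
    unfolding L2_set_def by (simp add: sum_nonneg)
  also have "\<dots> = (\<Sum>i<n-1. (norm (z $ i))\<^sup>2) + (norm (z $ (n-1) - z $ n))\<^sup>2 / 2"
    unfolding sum_lessThan_n by (simp add: spat_def power_divide)
  finally show ?thesis
    unfolding Q_def herm_lorentz qcnj_mult_self by (simp add: qRe_sum flip: of_real_power)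
qed

text \<open>The splitting is solved for its single negative term; the positive terms are bounded by
  the triangle inequality and the real Cauchy-Schwarz inequality for their norms.\<close>

lemma norm_herm_spat:
  "norm (z $ (n-1) + z $ n) * norm (w $ (n-1) + w $ n) / 2 - norm (H z w)
     \<le> L2_set (spat z) {..<n} * L2_set (spat w) {..<n}"
proof -
  let ?S = "(\<Sum>i<n - 1. qcnj (w $ i) * z $ i)"
  let ?D = "qcnj (w $ (n-1) - w $ n) * (z $ (n-1) - z $ n)"
  let ?T = "qcnj (w $ (n-1) + w $ n) * (z $ (n-1) + z $ n)"
  have "norm ((1/2) *\<^sub>R ?T) \<le> norm ?S + norm ((1/2) *\<^sub>R ?D) + norm (H z w)"
  proof -
    have e: "(1/2) *\<^sub>R ?T = ?S + (1/2) *\<^sub>R ?D - H z w" unfolding herm_lorentz by simp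
    show ?thesis unfolding e by (rule order_trans[OF norm_triangle_ineq4 add_right_mono[OF norm_triangle_ineq]])
  qed
  moreover have "norm ?S \<le> (\<Sum>i<n-1. norm (z $ i) * norm (w $ i))"
    by (rule order_trans[OF norm_sum]) (simp add: norm_mult mult.commute)
  moreover have "(\<Sum>i<n-1. norm (z $ i) * norm (w $ i)) + norm ((1/2) *\<^sub>R ?D)
      = (\<Sum>i<n. \<bar>spat z i\<bar> * \<bar>spat w i\<bar>)"
    unfolding sum_lessThan_n
    by (simp add: spat_def norm_mult del: qcnj_simps)
  moreover have "norm ((1/2) *\<^sub>R ?T) = norm (z $ (n-1) + z $ n) * norm (w $ (n-1) + w $ n) / 2"
    by (simp add: norm_mult del: qcnj_simps)
  ultimately show ?thesis using L2_set_mult_ineq[of "spat z" "spat w" "{..<n}"] by linarith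
qed

text \<open>The signature has one negative direction, so the complement of a negative vector is
  positive definite. With \<open>a\<close>, \<open>b\<close> the positive parts and
  \<open>s\<close>, \<open>t\<close> the negative parts of \<open>w\<close>, \<open>z\<close>,
  orthogonality gives \<open>s t / 2 \<le> a b\<close>, while the signs of \<open>Q\<close> give the
  opposite strict inequality unless \<open>s = 0\<close>; then \<open>a = 0\<close> as well.\<close>

lemma orth_neg_imp_zero:
  assumes V: "w \<in> V" and z: "Q z < 0" and orth: "H w z = 0" and w: "Q w \<le> 0"
  shows "w = 0\<^sub>v (Suc n)"
proof -
  define a b s t where "a = L2_set (spat w) {..<n}" and "b = L2_set (spat z) {..<n}"
    and "s = norm (w $ (n-1) + w $ n)" and "t = norm (z $ (n-1) + z $ n)"
  have nn: "a \<ge> 0" "b \<ge> 0" "s \<ge> 0" "t \<ge> 0" by (simp_all add: a_def b_def s_def t_def)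
  have 1: "s * t / 2 \<le> a * b"
    using norm_herm_spat[of w z] orth by (simp add: a_def b_def s_def t_def)
  have 2: "b\<^sup>2 < t\<^sup>2 / 2" using z Q_spat[of z] by (simp add: b_def t_def)
  have 3: "a\<^sup>2 \<le> s\<^sup>2 / 2" using w Q_spat[of w] by (simp add: a_def s_def)
  have "s = 0"
  proof (rule ccontr)
    assume "s \<noteq> 0"
    then have "s\<^sup>2 > 0" by simp
    have "(s * t / 2)\<^sup>2 \<le> (a * b)\<^sup>2" using 1 nn by (intro power_mono) auto
    also have "\<dots> \<le> s\<^sup>2 / 2 * b\<^sup>2"
      unfolding power_mult_distrib using 3 by (rule mult_right_mono) simp
    also have "\<dots> < s\<^sup>2 / 2 * (t\<^sup>2 / 2)" using 2 \<open>s\<^sup>2 > 0\<close> by (intro mult_strict_left_mono) auto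
    finally show False by (simp add: power_mult_distrib power_divide)
  qed
  with 3 have "a = 0" by simp
  then have sp: "spat w i = 0" if "i < n" for i
    using that unfolding a_def by (subst (asm) L2_set_eq_0_iff) auto
  from \<open>s = 0\<close> have A: "w $ (n-1) = - w $ n" unfolding s_def norm_eq_zero by (rule eq_neg_iff_add_eq_0[THEN iffD2])
  from sp[of "n-1"] n_pos have "w $ (n-1) = w $ n" by (simp add: spat_def)
  with A have B: "w $ (n-1) = 0" "w $ n = 0" by (simp_all add: quat_eq_iff)
  have C: "w $ i = 0" if "i < n - 1" for i using sp[of i] that n_pos by (simp add: spat_def)
  show ?thesis
  proof (rule eq_vecI)
    fix i assume "i < dim_vec (0\<^sub>v (Suc n) :: quat vec)"
    then consider "i < n - 1" | "i = n - 1" | "i = n" by fastforce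
    then show "w $ i = 0\<^sub>v (Suc n) $ i" using B C n_pos by cases simp_all
  qed (use V in simp)
qed

lemma orth_neg_nonneg: "w \<in> V \<Longrightarrow> Q z < 0 \<Longrightarrow> H w z = 0 \<Longrightarrow> Q w \<ge> 0"
  using orth_neg_imp_zero[of w z] by (cases "Q w \<le> 0") (auto simp: Q_def)

text \<open>The usual argument by minimising \<open>Q\<close> along \<open>y\<close>, valid because
  everything happens in the positive definite complement of \<open>z\<close>.\<close>

lemma cauchy_schwarz_orth_neg:
  assumes V: "x \<in> V" "y \<in> V" and z: "Q z < 0" and o: "H x z = 0" "H y z = 0"
  shows "(norm (H x y))\<^sup>2 \<le> Q x * Q y"
proof (cases "y = 0\<^sub>v (Suc n)")
  case True
  then show ?thesis by (simp add: Q_def)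
next
  case False
  then have qy: "Q y > 0" using orth_neg_imp_zero[OF V(2) z o(2)] by force
  \<comment> \<open>The minimising coefficient: it makes \<open>x + y t\<close> orthogonal to
    \<open>y\<close>.\<close>
  define t where "t = - (1 / Q y) *\<^sub>R H x y"
  have "Q (x + y \<cdot>\<^sub>r t) \<ge> 0"
    using V z o by (intro orth_neg_nonneg[of _ z]) (simp_all add: herm_lin)
  also have "Q (x + y \<cdot>\<^sub>r t) = Q x + (norm (H x y))\<^sup>2 / Q y + 2 * qRe (qcnj t * H x y)"
    using V qy by (simp add: Q_add Q_rsmult herm_lin t_def power_mult_distrib power2_eq_square)
  also have "qRe (qcnj t * H x y) = - ((norm (H x y))\<^sup>2 / Q y)"
  proof -
    have "qcnj t = - (1 / Q y) *\<^sub>R qcnj (H x y)" by (simp add: t_def quat_eq_iff)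
    then show ?thesis by (simp add: qcnj_mult_self(1) flip: of_real_power)
  qed
  finally show ?thesis using qy by (simp add: field_simps)
qed

text \<open>There is no totally isotropic plane: after subtracting a multiple of \<open>x\<close>,
  the vector \<open>y\<close> becomes orthogonal to a negative vector while staying null, hence
  vanishes.\<close>

lemma null_orth_proportional:
  assumes V: "x \<in> V" "y \<in> V" and q: "Q x = 0" "Q y = 0" and o: "H x y = 0" and x: "x \<noteq> 0\<^sub>v (Suc n)"
  obtains l where "y = x \<cdot>\<^sub>r l"
proof -
  define z :: "quat vec" where "z = unit_vec (Suc n) (n - 1) + unit_vec (Suc n) n"
  have zV: "z \<in> V" by (simp add: z_def)
  have zz: "z $ (n-1) = 1" "z $ n = 1" "\<And>i. i < n - 1 \<Longrightarrow> z $ i = 0"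
    using n_pos by (auto simp: z_def)
  have "Q z = -2" unfolding Q_def herm_def zz using zz(3) by simp
  then have z: "Q z < 0" by simp
  have hx: "H x z \<noteq> 0" using orth_neg_imp_zero[OF V(1) z] q x by auto
  define l where "l = inverse (H x z) * H y z"
  have xl: "H x z * l = H y z" using hx unfolding l_def by (simp flip: mult.assoc)
  have "y + x \<cdot>\<^sub>r (- l) = 0\<^sub>v (Suc n)"
  proof (rule orth_neg_imp_zero[OF _ z])
    show "H (y + x \<cdot>\<^sub>r (- l)) z = 0" using V xl by (simp add: herm_lin)
    have "H y x = 0" using o herm_eq_0_sym by simp
    then show "Q (y + x \<cdot>\<^sub>r (- l)) \<le> 0" using V q by (simp add: Q_add Q_rsmult herm_lin)
  qed (use V in simp)
  then have "y = x \<cdot>\<^sub>r l" using V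
    by (auto simp: vec_eq_iff)
  then show ?thesis by (rule that)
qed

end

section \<open>Linear systems over a division ring\<close>

text \<open>Gaussian elimination by induction on the equations, which works over a division ring
  once sides are respected: coefficients act from the left, so the multiplier \<open>?t\<close>
  carries the inverse pivot on its right.\<close>

lemma underdetermined_system:
  fixes A :: "'i \<Rightarrow> 'j \<Rightarrow> 'a :: division_ring"
  assumes "finite I" "finite J" "card I < card J"
  obtains x where "\<exists>j\<in>J. x j \<noteq> 0" "\<And>i. i \<in> I \<Longrightarrow> (\<Sum>j\<in>J. A i j * x j) = 0"
proof -
  have "\<exists>x. (\<exists>j\<in>J. x j \<noteq> 0) \<and> (\<forall>i\<in>I. (\<Sum>j\<in>J. A i j * x j) = 0)"
    using assms
  proof (induction I arbitrary: J A rule: finite_induct)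
    case empty
    then have "J \<noteq> {}" by auto
    then show ?case by (intro exI[of _ "\<lambda>_. 1"]) auto
  next
    case (insert m I)
    show ?case
    proof (cases "\<exists>k\<in>J. A m k \<noteq> 0")
      case False
      obtain x where "\<exists>j\<in>J. x j \<noteq> 0" "\<forall>i\<in>I. (\<Sum>j\<in>J. A i j * x j) = 0"
        using insert.IH[of J A] insert.prems insert.hyps by auto
      with False show ?thesis by (intro exI[of _ x]) auto
    next
      case True
      then obtain k where k: "k \<in> J" "A m k \<noteq> 0" by blast
      let ?J = "J - {k}" and ?t = "\<lambda>i. A i k * inverse (A m k)"
      have "finite ?J" "card I < card ?J" using insert k by auto
      then obtain x where x: "\<exists>j\<in>?J. x j \<noteq> 0"
        "\<forall>i\<in>I. (\<Sum>j\<in>?J. (A i j - ?t i * A m j) * x j) = 0"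
        using insert.IH[of ?J "\<lambda>i j. A i j - ?t i * A m j"] by auto
      define s where "s = (\<Sum>j\<in>?J. A m j * x j)"
      define y where "y = x(k := - (inverse (A m k) * s))"
      have split: "(\<Sum>j\<in>J. A i j * y j) = (\<Sum>j\<in>?J. A i j * x j) - ?t i * s" for i
        unfolding sum.remove[OF insert.prems(1) k(1)] by (simp add: y_def mult.assoc)
      have "(\<Sum>j\<in>J. A i j * y j) = 0" if "i \<in> insert m I" for i
      proof (cases "i = m")
        case True
        then show ?thesis using k(2) unfolding split by (simp add: s_def)
      next
        case False
        with that x(2) have "(\<Sum>j\<in>?J. (A i j - ?t i * A m j) * x j) = 0" by blast
        then show ?thesis
          unfolding split s_def by (simp add: left_diff_distrib sum_subtractf sum_distrib_left mult.assoc)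
      qed
      moreover have "\<exists>j\<in>J. y j \<noteq> 0" using x(1) by (auto simp: y_def)
      ultimately show ?thesis by blast
    qed
  qed
  then show ?thesis using that by blast
qed

lemma index_mult_mat_vec_sum:
  "A \<in> carrier_mat r k \<Longrightarrow> z \<in> carrier_vec k \<Longrightarrow> i < r \<Longrightarrow> (A *\<^sub>v z) $ i = (\<Sum>j<k. A $$ (i, j) * z $ j)"
  by (auto simp: scalar_prod_def lessThan_atLeast0)

text \<open>Surjectivity by homogenising: \<open>A x = y c\<close> is a system of \<open>k\<close>
  equations in the \<open>k + 1\<close> unknowns \<open>x\<close>, \<open>c\<close>. A nontrivial
  solution has \<open>c \<noteq> 0\<close> by injectivity, and dividing by \<open>c\<close> on the
  right solves \<open>A x = y\<close>. The preimages of the unit vectors are the columns of the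
  inverse.\<close>

lemma injective_mat_right_inverse:
  fixes A :: "'a :: division_ring mat"
  assumes A: "A \<in> carrier_mat k k"
    and inj: "\<And>z. z \<in> carrier_vec k \<Longrightarrow> A *\<^sub>v z = 0\<^sub>v k \<Longrightarrow> z = 0\<^sub>v k"
  obtains B where "B \<in> carrier_mat k k" "A * B = 1\<^sub>m k"
proof -
  have surj: "\<exists>x\<in>carrier_vec k. A *\<^sub>v x = y" if y: "y \<in> carrier_vec k" for y
  proof -
    obtain x where x0: "\<exists>j\<in>{..<Suc k}. x j \<noteq> 0" and x:
      "\<And>i. i \<in> {..<k} \<Longrightarrow> (\<Sum>j\<in>{..<Suc k}. (if j < k then A $$ (i, j) else - y $ i) * x j) = 0"
      using underdetermined_system[of "{..<k}" "{..<Suc k}"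
          "\<lambda>i j. if j < k then A $$ (i, j) else - y $ i"] by auto
    have eq: "(\<Sum>j<k. A $$ (i, j) * x j) = y $ i * x k" if "i < k" for i
      using x[of i] that by simp
    have "x k \<noteq> 0"
    proof
      assume xk: "x k = 0"
      have "A *\<^sub>v vec k x = 0\<^sub>v k"
        using A eq xk by (intro eq_vecI) (auto simp: index_mult_mat_vec_sum simp del: index_mult_mat_vec)
      then have "vec k x = 0\<^sub>v k" by (rule inj[OF vec_carrier])
      then have ind: "vec k x $ j = 0\<^sub>v k $ j" for j by simp
      have "x j = 0" if "j < k" for j
        using ind[of j] unfolding index_vec[OF that] index_zero_vec(1)[OF that] .
      with xk x0 show False by (auto simp: less_Suc_eq)
    qed
    let ?z = "vec k (\<lambda>j. x j * inverse (x k))"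
    have "A *\<^sub>v ?z = y"
    proof (rule eq_vecI)
      fix i assume "i < dim_vec y"
      then have i: "i < k" using y by simp
      have "(A *\<^sub>v ?z) $ i = (\<Sum>j<k. A $$ (i, j) * x j) * inverse (x k)"
        using A i by (simp add: index_mult_mat_vec_sum sum_distrib_right mult.assoc del: index_mult_mat_vec)
      then show "(A *\<^sub>v ?z) $ i = y $ i" using \<open>x k \<noteq> 0\<close> by (simp add: eq[OF i] mult.assoc)
    qed (use A y in auto)
    then show ?thesis by (intro bexI[of _ ?z]) auto
  qed
  obtain b where b: "\<And>j. b j \<in> carrier_vec k" "\<And>j. j < k \<Longrightarrow> A *\<^sub>v b j = unit_vec k j"
  proof -
    have "\<forall>j. \<exists>x. x \<in> carrier_vec k \<and> (j < k \<longrightarrow> A *\<^sub>v x = unit_vec k j)"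
      using surj unit_vec_carrier by meson
    then show ?thesis using that by metis
  qed
  define B where "B = mat k k (\<lambda>(i, j). b j $ i)"
  have B: "B \<in> carrier_mat k k" by (simp add: B_def)
  have col: "col B j = b j" if "j < k" for j
    using that b(1)[of j] by (intro eq_vecI) (auto simp: B_def)
  have "A * B = 1\<^sub>m k"
  proof (rule eq_matI)
    fix i j assume "i < dim_row (1\<^sub>m k :: 'a mat)" "j < dim_col (1\<^sub>m k :: 'a mat)"
    then have ij: "i < k" "j < k" by auto
    then have "(A * B) $$ (i, j) = (A *\<^sub>v b j) $ i" using A B col by simp
    then show "(A * B) $$ (i, j) = (1\<^sub>m k :: 'a mat) $$ (i, j)" using ij b(2)[OF ij(2)] by simp
  qed (use A B in auto)
  with B show ?thesis by (rule that)
qed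

text \<open>A right inverse \<open>B\<close> is itself injective, so it has a right inverse
  \<open>C\<close>, and associativity forces \<open>C = A\<close>.\<close>

lemma injective_mat_inverse:
  fixes A :: "'a :: division_ring mat"
  assumes A: "A \<in> carrier_mat k k"
    and inj: "\<And>z. z \<in> carrier_vec k \<Longrightarrow> A *\<^sub>v z = 0\<^sub>v k \<Longrightarrow> z = 0\<^sub>v k"
  obtains B where "B \<in> carrier_mat k k" "A * B = 1\<^sub>m k" "B * A = 1\<^sub>m k"
proof -
  obtain B where B: "B \<in> carrier_mat k k" "A * B = 1\<^sub>m k"
    using injective_mat_right_inverse[OF A inj] by auto
  have injB: "z = 0\<^sub>v k" if "z \<in> carrier_vec k" "B *\<^sub>v z = 0\<^sub>v k" for z
  proof -
    have "z = (A * B) *\<^sub>v z" using B(2) that by simp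
    also have "\<dots> = A *\<^sub>v 0\<^sub>v k" using assoc_mult_mat_vec[OF A B(1) that(1)] that(2) by simp
    also have "\<dots> = 0\<^sub>v k" using A by (intro eq_vecI) auto
    finally show ?thesis .
  qed
  obtain C where C: "C \<in> carrier_mat k k" "B * C = 1\<^sub>m k"
    using injective_mat_right_inverse[OF B(1) injB] by auto
  have "A = A * (B * C)" using A C by simp
  also have "\<dots> = (A * B) * C" using assoc_mult_mat[OF A B(1) C(1)] by simp
  also have "\<dots> = C" using B C by simp
  finally have "B * A = 1\<^sub>m k" using C(2) by simp
  with B show ?thesis by (rule that)
qed

section \<open>The group Sp(n,1)\<close>

lemma mult_mat_unit_vec:
  fixes A :: "'a :: semiring_1 mat"
  shows "A \<in> carrier_mat r k \<Longrightarrow> i < k \<Longrightarrow> A *\<^sub>v unit_vec k i = col A i"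
  by (rule eq_vecI) (auto simp: scalar_prod_def if_distrib[of "(*) _"] cong: if_cong)

lemma invertible_mat_iff:
  assumes A: "A \<in> carrier_mat k k"
  shows "invertible_mat A \<longleftrightarrow> (\<exists>B\<in>carrier_mat k k. A * B = 1\<^sub>m k \<and> B * A = 1\<^sub>m k)"
proof
  assume "invertible_mat A"
  then obtain B where B: "A * B = 1\<^sub>m (dim_row A)" "B * A = 1\<^sub>m (dim_row B)"
    unfolding invertible_mat_def inverts_mat_def by auto
  have "dim_row B = k" using arg_cong[OF B(2), of dim_col] A by simp
  moreover have "dim_col B = k" using arg_cong[OF B(1), of dim_col] A by simp
  ultimately show "\<exists>B\<in>carrier_mat k k. A * B = 1\<^sub>m k \<and> B * A = 1\<^sub>m k" using A B by auto
next
  assume "\<exists>B\<in>carrier_mat k k. A * B = 1\<^sub>m k \<and> B * A = 1\<^sub>m k"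
  then obtain B where "B \<in> carrier_mat k k" "A * B = 1\<^sub>m k" "B * A = 1\<^sub>m k" by blast
  moreover from this A have "dim_row A = k" "dim_row B = k" "square_mat A" by auto
  ultimately show "invertible_mat A" unfolding invertible_mat_def inverts_mat_def by metis
qed

context herm_space
begin

abbreviation M where "M \<equiv> carrier_mat (Suc n) (Suc n)"
abbreviation S where "S \<equiv> carrier (Sp n)"
abbreviation e where "e i \<equiv> unit_vec (Suc n) i :: quat vec"

lemma herm_unit:
  "i < n - 1 \<Longrightarrow> H z (e i) = z $ i" "H z (e (n - 1)) = - z $ n" "H z (e n) = - z $ (n - 1)"
proof -
  assume i: "i < n - 1"
  have "(\<Sum>j<n - 1. qcnj (e i $ j) * z $ j) = (\<Sum>j<n - 1. if j = i then z $ j else 0)"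
    using i by (intro sum.cong) auto
  then show "H z (e i) = z $ i" using i n_pos by (auto simp: herm_def)
next
  have *: "(\<Sum>i<n - 1. qcnj (e k $ i) * z $ i) = 0" if "n - 1 \<le> k" "k \<le> n" for k
    using that by (intro sum.neutral) auto
  show "H z (e (n - 1)) = - z $ n" "H z (e n) = - z $ (n - 1)"
    unfolding herm_def using *[of "n - 1"] *[of n] n_pos by auto
qed

lemma herm_nondeg: assumes "z \<in> V" "\<And>w. w \<in> V \<Longrightarrow> H z w = 0" shows "z = 0\<^sub>v (Suc n)"
proof (rule eq_vecI)
  fix i assume "i < dim_vec (0\<^sub>v (Suc n) :: quat vec)"
  then consider "i < n - 1" | "i = n - 1" | "i = n" by fastforce
  then show "z $ i = 0\<^sub>v (Suc n) $ i"
    using n_pos herm_unit(1)[of i z] herm_unit(2,3)[of z] assms(2)[of "e (n-1)"] assms(2)[of "e n"] assms(2)[of "e i"]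
    by cases auto
qed (use assms in simp)

lemma S_D:
  assumes "A \<in> S"
  shows "A \<in> M" "z \<in> V \<Longrightarrow> w \<in> V \<Longrightarrow> H (A *\<^sub>v z) (A *\<^sub>v w) = H z w"
  using assms by (auto simp: Sp_def)

text \<open>Invertibility comes for free: a kernel vector would be orthogonal to everything, against
  nondegeneracy.\<close>

lemma S_I:
  assumes A: "A \<in> M" and pres: "\<And>z w. z \<in> V \<Longrightarrow> w \<in> V \<Longrightarrow> H (A *\<^sub>v z) (A *\<^sub>v w) = H z w"
  shows "A \<in> S"
proof -
  have "z = 0\<^sub>v (Suc n)" if z: "z \<in> V" "A *\<^sub>v z = 0\<^sub>v (Suc n)" for z
  proof (rule herm_nondeg[OF z(1)])
    fix w assume "w \<in> V"
    then show "H z w = 0" using pres[OF z(1), of w] z(2) by simp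
  qed
  then obtain B where "B \<in> M" "A * B = 1\<^sub>m (Suc n)" "B * A = 1\<^sub>m (Suc n)"
    using injective_mat_inverse[OF A] by metis
  then have "invertible_mat A" using invertible_mat_iff[OF A] by auto
  with A pres show ?thesis by (simp add: Sp_def)
qed

lemma Sp_simps [simp]: "x \<otimes>\<^bsub>Sp n\<^esub> y = x * y" "\<one>\<^bsub>Sp n\<^esub> = 1\<^sub>m (Suc n)"
  by (simp_all add: Sp_def)

lemma group_Sp: "group (Sp n)"
proof (rule groupI)
  fix x y assume xy: "x \<in> S" "y \<in> S"
  have "x * y \<in> S"
  proof (rule S_I)
    show "x * y \<in> M" using S_D(1)[OF xy(1)] S_D(1)[OF xy(2)] by (rule mult_carrier_mat)
  next
    fix z w assume V: "z \<in> V" "w \<in> V"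
    have "y *\<^sub>v z \<in> V" "y *\<^sub>v w \<in> V"
      using mult_mat_vec_carrier[OF S_D(1)[OF xy(2)]] V by blast+
    then show "H (x * y *\<^sub>v z) (x * y *\<^sub>v w) = H z w"
      using V S_D(2)[OF xy(1)] S_D(2)[OF xy(2)]
      by (simp only: assoc_mult_mat_vec[OF S_D(1)[OF xy(1)] S_D(1)[OF xy(2)]])
  qed
  then show "x \<otimes>\<^bsub>Sp n\<^esub> y \<in> S" by simp
next
  show "\<one>\<^bsub>Sp n\<^esub> \<in> S" using S_I[of "1\<^sub>m (Suc n)"] by simp
next
  fix x y z assume "x \<in> S" "y \<in> S" "z \<in> S"
  then show "x \<otimes>\<^bsub>Sp n\<^esub> y \<otimes>\<^bsub>Sp n\<^esub> z = x \<otimes>\<^bsub>Sp n\<^esub> (y \<otimes>\<^bsub>Sp n\<^esub> z)"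
    using assoc_mult_mat S_D(1) by (metis Sp_simps(1))
next
  fix x assume "x \<in> S"
  then show "\<one>\<^bsub>Sp n\<^esub> \<otimes>\<^bsub>Sp n\<^esub> x = x" using left_mult_one_mat[OF S_D(1)] by simp
next
  fix x assume x: "x \<in> S"
  then have xM: "x \<in> M" and "invertible_mat x" by (auto simp: Sp_def)
  then obtain B where B: "B \<in> M" "x * B = 1\<^sub>m (Suc n)" "B * x = 1\<^sub>m (Suc n)"
    using invertible_mat_iff by metis
  have "B \<in> S"
  proof (rule S_I[OF B(1)])
    fix z w assume V: "z \<in> V" "w \<in> V"
    have V': "B *\<^sub>v z \<in> V" "B *\<^sub>v w \<in> V"
      using mult_mat_vec_carrier[OF B(1)] V by blast+
    have "x *\<^sub>v (B *\<^sub>v y) = y" if "y \<in> V" for y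
      using assoc_mult_mat_vec[OF xM B(1) that] B(2) that by simp
    with S_D(2)[OF x V'] V show "H (B *\<^sub>v z) (B *\<^sub>v w) = H z w" by simp
  qed
  with B(3) show "\<exists>y\<in>S. y \<otimes>\<^bsub>Sp n\<^esub> x = \<one>\<^bsub>Sp n\<^esub>" by auto
qed

sublocale Sp: group "Sp n" by (rule group_Sp)

abbreviation inv_Sp where "inv_Sp g \<equiv> inv\<^bsub>Sp n\<^esub> g"

lemma S_mult [intro, simp]: "f \<in> S \<Longrightarrow> g \<in> S \<Longrightarrow> f * g \<in> S"
  using Sp.m_closed by simp

lemma S_assoc: "f \<in> S \<Longrightarrow> g \<in> S \<Longrightarrow> h \<in> S \<Longrightarrow> f * g * h = f * (g * h)"
  using Sp.m_assoc by simp

lemma S_vec [intro, simp]: "g \<in> S \<Longrightarrow> z \<in> V \<Longrightarrow> g *\<^sub>v z \<in> V"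
  by (rule mult_mat_vec_carrier[OF S_D(1)])

lemma S_mult_vec: "f \<in> S \<Longrightarrow> g \<in> S \<Longrightarrow> z \<in> V \<Longrightarrow> (f * g) *\<^sub>v z = f *\<^sub>v (g *\<^sub>v z)"
  by (rule assoc_mult_mat_vec[OF S_D(1) S_D(1)])

lemma S_one_vec: "z \<in> V \<Longrightarrow> 1\<^sub>m (Suc n) *\<^sub>v z = z"
  by simp

lemma S_inv_vec:
  assumes "g \<in> S" "z \<in> V"
  shows "inv_Sp g *\<^sub>v (g *\<^sub>v z) = z" "g *\<^sub>v (inv_Sp g *\<^sub>v z) = z"
proof -
  have "inv_Sp g \<in> S" using assms by simp
  moreover have "inv_Sp g * g = 1\<^sub>m (Suc n)" "g * inv_Sp g = 1\<^sub>m (Suc n)"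
    using Sp.l_inv[OF assms(1)] Sp.r_inv[OF assms(1)] by simp_all
  ultimately show "inv_Sp g *\<^sub>v (g *\<^sub>v z) = z" "g *\<^sub>v (inv_Sp g *\<^sub>v z) = z"
    using assms S_one_vec by (metis S_mult_vec)+
qed

lemma herm_inv_right: "g \<in> S \<Longrightarrow> z \<in> V \<Longrightarrow> w \<in> V \<Longrightarrow> H (g *\<^sub>v z) w = H z (inv_Sp g *\<^sub>v w)"
  by (metis S_D(2) S_inv_vec(2) S_vec Sp.inv_closed)

lemma Q_S: "g \<in> S \<Longrightarrow> z \<in> V \<Longrightarrow> Q (g *\<^sub>v z) = Q z"
  by (simp add: Q_def S_D(2))

lemma S_rsmult: "g \<in> S \<Longrightarrow> z \<in> V \<Longrightarrow> g *\<^sub>v (z \<cdot>\<^sub>r l) = (g *\<^sub>v z) \<cdot>\<^sub>r l"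
  by (rule mult_mat_vec_rsmult[OF S_D(1)])

lemma S_add: "g \<in> S \<Longrightarrow> z \<in> V \<Longrightarrow> w \<in> V \<Longrightarrow> g *\<^sub>v (z + w) = g *\<^sub>v z + g *\<^sub>v w"
  by (rule mult_add_distrib_mat_vec[OF S_D(1)])

lemma S_zero [simp]: "g \<in> S \<Longrightarrow> g *\<^sub>v 0\<^sub>v (Suc n) = 0\<^sub>v (Suc n)"
  by (metis S_rsmult S_vec rsmult_zero zero_carrier_vec)

lemma S_inj: "g \<in> S \<Longrightarrow> z \<in> V \<Longrightarrow> w \<in> V \<Longrightarrow> g *\<^sub>v z = g *\<^sub>v w \<longleftrightarrow> z = w"
  by (metis S_inv_vec(1))

lemma S_eqI:
  assumes "f \<in> S" "g \<in> S" "\<And>i. i < Suc n \<Longrightarrow> f *\<^sub>v e i = g *\<^sub>v e i"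
  shows "f = g"
proof (rule mat_col_eqI)
  fix i assume "i < dim_col g"
  then have "i < Suc n" using S_D(1)[OF assms(2)] by simp
  then show "col f i = col g i"
    using assms(3)[of i] S_D(1)[OF assms(1)] S_D(1)[OF assms(2)]
    by (simp add: mult_mat_unit_vec)
qed (use S_D(1)[OF assms(1)] S_D(1)[OF assms(2)] in auto)

lemma act_proj: "g \<in> S \<Longrightarrow> z \<in> V \<Longrightarrow> act g (proj z) = proj (g *\<^sub>v z)"
proof -
  assume *: "g \<in> S" "z \<in> V"
  have "(\<lambda>z. g *\<^sub>v z) ` {z \<cdot>\<^sub>r l | l. l \<noteq> 0} = {(g *\<^sub>v z) \<cdot>\<^sub>r l | l. l \<noteq> 0}"
    unfolding S_rsmult[OF *, symmetric] by blast
  then show ?thesis unfolding act_def proj_eq .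
qed

end

section \<open>Loxodromic normal forms\<close>

text \<open>The invariant as a function of an arbitrary normal form. The estimates hold for every
  \<open>l\<close>, so the choice hidden in \<open>lox_eigenvalues\<close> matters only when they
  are translated back to \<open>lox_M\<close>.\<close>

definition lox_value :: "nat \<Rightarrow> (nat \<Rightarrow> quat) \<Rightarrow> real" where
  "lox_value n l = 2 * Max (insert 0 ((\<lambda>i. norm (l i - 1)) ` {..<n - 1})) + norm (l (n - 1) - 1)
     + norm (inverse (qcnj (l (n - 1))) - 1)"

lemma lox_M_eq: "lox_M n g = lox_value n (lox_eigenvalues n g)"
  by (simp add: lox_M_def lox_delta_def lox_value_def)

context herm_space
begin

definition lox_diag :: "(nat \<Rightarrow> quat) \<Rightarrow> nat \<Rightarrow> quat" where
  "lox_diag l i = (if i < n then l i else inverse (qcnj (l (n - 1))))"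

definition D :: "(nat \<Rightarrow> quat) \<Rightarrow> quat mat" where
  "D l = mat_diag (Suc n) (lox_diag l)"

text \<open>The conjugating matrix is kept explicit, since its last two columns are the null lifts
  of the fixed points on which all cross ratios are computed.\<close>

definition NF :: "quat mat \<Rightarrow> quat mat \<Rightarrow> (nat \<Rightarrow> quat) \<Rightarrow> bool" where
  "NF g P l \<longleftrightarrow> P \<in> S \<and> (\<forall>i<n - 1. norm (l i) = 1) \<and> norm (l (n - 1)) > 1 \<and> g = P * D l * inv_Sp P"

lemma lox_normal_form_iff: "lox_normal_form n g l \<longleftrightarrow> (\<exists>P. NF g P l)"
  unfolding lox_normal_form_def NF_def D_def lox_diag_def by auto

text \<open>Lifts of the attracting and of the repelling fixed point, written \<open>u\<close> and \<open>v\<close> in comments.\<close>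

definition att :: "quat mat \<Rightarrow> quat vec" where "att P = P *\<^sub>v e (n - 1)"
definition rpl :: "quat mat \<Rightarrow> quat vec" where "rpl P = P *\<^sub>v e n"

lemma D_index: "z \<in> V \<Longrightarrow> i \<le> n \<Longrightarrow> (D l *\<^sub>v z) $ i = lox_diag l i * z $ i"
proof -
  assume z: "z \<in> V" and i: "i \<le> n"
  have "(D l *\<^sub>v z) $ i = (\<Sum>j<Suc n. D l $$ (i, j) * z $ j)"
    using i z by (intro index_mult_mat_vec_sum[of _ "Suc n"]) (auto simp: D_def)
  also have "\<dots> = (\<Sum>j<Suc n. if j = i then lox_diag l j * z $ j else 0)"
    using i by (intro sum.cong) (auto simp: D_def mat_diag_def)
  also have "\<dots> = lox_diag l i * z $ i" using i by simp
  finally show ?thesis .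
qed

lemma D_carrier: "D l \<in> M"
  by (simp add: D_def)

lemma qcnj_mult_inverse: "l \<noteq> 0 \<Longrightarrow> qcnj l * (inverse (qcnj l) * x) = x" "l \<noteq> 0 \<Longrightarrow> inverse l * (l * x) = x"
  by (simp_all flip: mult.assoc)

text \<open>Unit quaternions preserve the positive coordinates, and on the hyperbolic plane the
  factors \<open>l\<close> and \<open>inverse (qcnj l)\<close> cancel, because the form pairs the
  two null coordinates with each other.\<close>

lemma D_in_S:
  assumes "\<forall>i<n - 1. norm (l i) = 1" "l (n - 1) \<noteq> 0"
  shows "D l \<in> S"
proof (rule S_I[OF D_carrier])
  fix z w assume V: "z \<in> V" "w \<in> V"
  have 1: "qcnj (lox_diag l i * a) * (lox_diag l i * b) = qcnj a * b" if "i < n - 1" for i a b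
  proof -
    have "i < n" using that by linarith
    have "qcnj (lox_diag l i * a) * (lox_diag l i * b) = qcnj a * (qcnj (l i) * l i) * b"
      using \<open>i < n\<close> by (simp add: lox_diag_def mult.assoc)
    then show ?thesis using assms(1) that by (simp add: qcnj_mult_self)
  qed
  have "(\<Sum>i<n - 1. qcnj ((D l *\<^sub>v w) $ i) * (D l *\<^sub>v z) $ i) = (\<Sum>i<n - 1. qcnj (w $ i) * z $ i)"
    using V 1 by (intro sum.cong) (auto simp: D_index simp del: index_mult_mat_vec)
  moreover have "qcnj ((D l *\<^sub>v w) $ (n - 1)) * (D l *\<^sub>v z) $ n = qcnj (w $ (n - 1)) * z $ n"
    using V assms(2) n_pos by (simp add: D_index lox_diag_def mult.assoc qcnj_mult_inverse del: index_mult_mat_vec)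
  moreover have "qcnj ((D l *\<^sub>v w) $ n) * (D l *\<^sub>v z) $ (n - 1) = qcnj (w $ n) * z $ (n - 1)"
    using V assms(2) n_pos
    by (simp add: D_index lox_diag_def mult.assoc qcnj_mult_inverse qcnj_inverse del: index_mult_mat_vec)
  ultimately show "H (D l *\<^sub>v z) (D l *\<^sub>v w) = H z w" unfolding herm_def by (simp only:)
qed

lemma e_in_V: "e i \<in> V"
  by simp

lemma D_unit: "k \<le> n \<Longrightarrow> D l *\<^sub>v e k = e k \<cdot>\<^sub>r lox_diag l k"
  using carrier_vecD[OF mult_mat_vec_carrier[OF D_carrier e_in_V]]
  by (intro eq_vecI) (auto simp: D_index simp del: index_mult_mat_vec)

lemma NF_D:
  assumes "NF g P l"
  shows "P \<in> S" "D l \<in> S" "g \<in> S" "\<And>y. y \<in> V \<Longrightarrow> g *\<^sub>v (P *\<^sub>v y) = P *\<^sub>v (D l *\<^sub>v y)"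
    "l (n - 1) \<noteq> 0" "norm (l (n - 1)) > 1" "\<And>i. i < n - 1 \<Longrightarrow> norm (l i) = 1"
proof -
  from assms show P: "P \<in> S" and l: "norm (l (n - 1)) > 1" and l1: "\<And>i. i < n - 1 \<Longrightarrow> norm (l i) = 1"
    by (auto simp: NF_def)
  from assms have g: "g = P * D l * inv_Sp P" by (simp add: NF_def)
  from l show l0: "l (n - 1) \<noteq> 0" by auto
  show DS: "D l \<in> S" using D_in_S l1 l0 by blast
  have I: "inv_Sp P \<in> S" using P by simp
  show "g \<in> S" unfolding g using P DS I by blast
  show "g *\<^sub>v (P *\<^sub>v y) = P *\<^sub>v (D l *\<^sub>v y)" if y: "y \<in> V" for y
    unfolding g S_mult_vec[OF S_mult[OF P DS] I S_vec[OF P y]] S_inv_vec(1)[OF P y]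
      S_mult_vec[OF P DS y] ..
qed

text \<open>The last two facts read off null coordinates in the frame \<open>P\<close>; they are
  crossed, since the coordinate along \<open>rpl P\<close> is the one seen by
  \<open>att P\<close>.\<close>

lemma att_rpl:
  assumes P: "P \<in> S"
  shows "att P \<in> V" "rpl P \<in> V" "Q (att P) = 0" "Q (rpl P) = 0" "H (att P) (rpl P) = -1"
    "H (rpl P) (att P) = -1"
    "\<And>y. y \<in> V \<Longrightarrow> H (P *\<^sub>v y) (att P) = - y $ n" "\<And>y. y \<in> V \<Longrightarrow> H (P *\<^sub>v y) (rpl P) = - y $ (n - 1)"
  unfolding att_def rpl_def Q_S[OF P e_in_V] S_D(2)[OF P e_in_V e_in_V] Q_def
  using n_pos P by (auto simp: herm_unit[unfolded One_nat_def] S_D(2)[OF P])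

lemma NF_att_rpl:
  assumes nf: "NF g P l"
  shows "g *\<^sub>v att P = att P \<cdot>\<^sub>r l (n - 1)" "g *\<^sub>v rpl P = rpl P \<cdot>\<^sub>r inverse (qcnj (l (n - 1)))"
proof -
  show "g *\<^sub>v att P = att P \<cdot>\<^sub>r l (n - 1)" "g *\<^sub>v rpl P = rpl P \<cdot>\<^sub>r inverse (qcnj (l (n - 1)))"
    unfolding att_def rpl_def NF_D(4)[OF nf e_in_V]
    using n_pos by (simp_all add: D_unit S_rsmult[OF NF_D(1)[OF nf]] lox_diag_def)
qed

text \<open>Conjugation moves the frame and keeps the eigenvalues, so a conjugate has the same
  invariant and its ends are the images of the old ones.\<close>

lemma NF_conj:
  assumes f: "f \<in> S" and nf: "NF g P l"
  shows "NF (f * g * inv_Sp f) (f * P) l" "att (f * P) = f *\<^sub>v att P" "rpl (f * P) = f *\<^sub>v rpl P"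
proof -
  note P = NF_D(1)[OF nf] and DS = NF_D(2)[OF nf]
  have I: "inv_Sp P \<in> S" "inv_Sp f \<in> S" using P f by simp_all
  have g: "g = P * D l * inv_Sp P" using nf by (simp add: NF_def)
  have "f * g * inv_Sp f = (f * P) * D l * (inv_Sp P * inv_Sp f)"
    unfolding g using f P I DS by (simp add: S_assoc)
  also have "inv_Sp P * inv_Sp f = inv_Sp (f * P)" using Sp.inv_mult_group[OF f P] by simp
  finally show "NF (f * g * inv_Sp f) (f * P) l" using nf f by (simp add: NF_def)
  show "att (f * P) = f *\<^sub>v att P" "rpl (f * P) = f *\<^sub>v rpl P"
    unfolding att_def rpl_def by (rule S_mult_vec[OF f P e_in_V])+
qed

lemma S_preimage: assumes "P \<in> S" "x \<in> V" obtains y where "y \<in> V" "x = P *\<^sub>v y"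
  using S_inv_vec(2)[OF assms] S_vec[of "inv_Sp P" x] assms that by (metis Sp.inv_closed)

lemma Q_coords: "Q y = (\<Sum>i<n - 1. (norm (y $ i))\<^sup>2) - 2 * qRe (qcnj (y $ (n - 1)) * y $ n)"
proof -
  have "qRe (qcnj (y $ n) * y $ (n - 1)) = qRe (qcnj (y $ (n - 1)) * y $ n)"
    by (simp add: quat_times_sel)
  then show ?thesis by (simp add: Q_def herm_def qRe_sum qcnj_mult_self flip: of_real_power)
qed

lemma Q_coords_le:
  assumes "Q y = 0" shows "(\<Sum>i<n - 1. (norm (y $ i))\<^sup>2) \<le> 2 * (norm (y $ (n - 1)) * norm (y $ n))"
  using assms qRe_le_norm[of "qcnj (y $ (n - 1)) * y $ n"] unfolding Q_coords by (simp add: norm_mult)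

text \<open>The origin of \<open>M_g\<close>. In frame coordinates each entry contributes its
  eigenvalue minus one. The two null coordinates give the last two summands of \<open>M_g\<close>;
  the positive ones give \<open>2 \<delta>(g)\<close>, because the null condition bounds their sum
  of squares by twice the product of the moduli of the null coordinates.\<close>

lemma NF_displacement:
  assumes nf: "NF g P l" and x: "x \<in> V" "Q x = 0"
  shows "norm (H (g *\<^sub>v x) x) \<le> lox_value n l * (norm (H x (att P)) * norm (H x (rpl P)))"
proof -
  note P = NF_D(1)[OF nf]
  obtain y where y: "y \<in> V" "x = P *\<^sub>v y" using S_preimage[OF P x(1)] .
  define d a b where "d = Max (insert 0 ((\<lambda>i. norm (l i - 1)) ` {..<n - 1}))"
    and "a = norm (y $ (n-1))" and "b = norm (y $ n)"
  define s t where "s = norm (l (n - 1) - 1)" and "t = norm (inverse (qcnj (l (n - 1))) - 1)"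
  have Qy: "Q y = 0" using x y Q_S[OF P y(1)] by simp
  have d0: "d \<ge> 0" unfolding d_def by (intro Max_ge) auto
  have d1: "norm (l i - 1) \<le> d" if "i < n - 1" for i
    using that unfolding d_def by (intro Max_ge) auto
  \<comment> \<open>Subtracting \<open>H y y = 0\<close> replaces every eigenvalue by its difference
    from one.\<close>
  have "H (g *\<^sub>v x) x = H (D l *\<^sub>v y) y - H y y"
    using herm_self[of y] Qy y NF_D(4)[OF nf y(1)] S_D(2)[OF P S_vec[OF NF_D(2)[OF nf] y(1)] y(1)]
    by simp
  also have "\<dots> = (\<Sum>i<n - 1. qcnj (y $ i) * (l i - 1) * y $ i)
     - (qcnj (y $ (n - 1)) * (inverse (qcnj (l (n - 1))) - 1) * y $ n + qcnj (y $ n) * (l (n - 1) - 1) * y $ (n - 1))"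
  proof -
    have "(\<Sum>i<n - 1. qcnj (y $ i) * (D l *\<^sub>v y) $ i)
        = (\<Sum>i<n - 1. qcnj (y $ i) * (l i - 1) * y $ i) + (\<Sum>i<n - 1. qcnj (y $ i) * y $ i)"
      unfolding sum.distrib[symmetric] using y
      by (intro sum.cong) (auto simp: D_index lox_diag_def algebra_simps simp del: index_mult_mat_vec)
    moreover have "(D l *\<^sub>v y) $ (n - 1) = l (n - 1) * y $ (n - 1)"
      "(D l *\<^sub>v y) $ n = inverse (qcnj (l (n - 1))) * y $ n"
      using y n_pos by (auto simp: D_index lox_diag_def simp del: index_mult_mat_vec)
    ultimately show ?thesis unfolding herm_def by (simp add: algebra_simps del: index_mult_mat_vec)
  qed
  also have "norm \<dots> \<le> (\<Sum>i<n - 1. d * (norm (y $ i))\<^sup>2) + (a * t * b + b * s * a)"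
  proof -
    have 1: "norm (\<Sum>i<n - 1. qcnj (y $ i) * (l i - 1) * y $ i) \<le> (\<Sum>i<n - 1. d * (norm (y $ i))\<^sup>2)"
    proof (rule order_trans[OF norm_sum], rule sum_mono)
      fix i assume "i \<in> {..<n - 1}"
      then have "norm (l i - 1) * (norm (y $ i))\<^sup>2 \<le> d * (norm (y $ i))\<^sup>2"
        using d1 by (intro mult_right_mono) auto
      then show "norm (qcnj (y $ i) * (l i - 1) * y $ i) \<le> d * (norm (y $ i))\<^sup>2"
        by (simp add: norm_mult power2_eq_square mult_ac)
    qed
    have 2: "norm (qcnj (y $ (n - 1)) * (inverse (qcnj (l (n - 1))) - 1) * y $ n) = a * t * b"
      "norm (qcnj (y $ n) * (l (n - 1) - 1) * y $ (n - 1)) = b * s * a"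
      by (simp_all only: norm_mult norm_qcnj a_def b_def s_def t_def)
    show ?thesis
      by (rule order_trans[OF norm_triangle_ineq4 add_mono[OF 1 order_trans[OF norm_triangle_ineq]]])
        (simp only: 2 order_refl)
  qed
  also have "(\<Sum>i<n - 1. d * (norm (y $ i))\<^sup>2) \<le> d * (2 * (a * b))"
    using mult_left_mono[OF Q_coords_le[OF Qy] d0] by (simp add: sum_distrib_left a_def b_def)
  also have "d * (2 * (a * b)) + (a * t * b + b * s * a) = (2 * d + s + t) * (b * a)"
    by (simp add: algebra_simps)
  also have "\<dots> = lox_value n l * (norm (H x (att P)) * norm (H x (rpl P)))"
    unfolding y(2) att_rpl(7,8)[OF P y(1)] by (simp add: lox_value_def d_def s_def t_def a_def b_def)
  finally show ?thesis by simp
qed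

lemma lox_value_pos: "NF g P l \<Longrightarrow> lox_value n l > 0"
proof -
  assume nf: "NF g P l"
  have "Max (insert 0 ((\<lambda>i. norm (l i - 1)) ` {..<n - 1})) \<ge> 0" by (intro Max_ge) auto
  moreover have "norm (l (n - 1) - 1) > 0" using NF_D(6)[OF nf] by auto
  ultimately show ?thesis unfolding lox_value_def
    by (smt (verit) norm_ge_zero)
qed

lemma mat_pow_vec:
  assumes "g \<in> S" "z \<in> V"
  shows "(g [^]\<^bsub>Sp n\<^esub> (0::nat)) *\<^sub>v z = z" "(g [^]\<^bsub>Sp n\<^esub> Suc k) *\<^sub>v z = (g [^]\<^bsub>Sp n\<^esub> k) *\<^sub>v (g *\<^sub>v z)"
  using assms S_mult_vec[OF Sp.nat_pow_closed] by auto

text \<open>Comparing moduli in normal form coordinates: the eigenvalue of a nonzero coordinate at \<open>u\<close>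
  exceeds \<open>1\<close>, so that all other coordinates vanish; without it, the positive coordinates vanish.\<close>

lemma NF_fixed_power:
  assumes nf: "NF g P l" and k: "k \<noteq> 0" and x: "x \<in> V" "x \<noteq> 0\<^sub>v (Suc n)" "Q x \<le> 0"
    and fx: "(g [^]\<^bsub>Sp n\<^esub> (k::nat)) *\<^sub>v x = x \<cdot>\<^sub>r c"
  shows "proj x = proj (att P) \<or> proj x = proj (rpl P)"
proof -
  note P = NF_D(1)[OF nf] and DS = NF_D(2)[OF nf] and gS = NF_D(3)[OF nf]
  have pw: "\<exists>z\<in>V. (g [^]\<^bsub>Sp n\<^esub> k) *\<^sub>v (P *\<^sub>v y) = P *\<^sub>v z \<and> (\<forall>i\<le>n. z $ i = lox_diag l i ^ k * y $ i)"
    if "y \<in> V" for y and k :: nat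
    using that
  proof (induction k arbitrary: y)
    case 0
    then show ?case using mat_pow_vec(1)[OF gS] P by (intro bexI[of _ y]) auto
  next
    case (Suc k)
    have Dy: "D l *\<^sub>v y \<in> V" using DS Suc.prems by blast
    have *: "(g [^]\<^bsub>Sp n\<^esub> Suc k) *\<^sub>v (P *\<^sub>v y) = (g [^]\<^bsub>Sp n\<^esub> k) *\<^sub>v (P *\<^sub>v (D l *\<^sub>v y))"
      using mat_pow_vec(2)[OF gS S_vec[OF P Suc.prems]] NF_D(4)[OF nf Suc.prems] by simp
    show ?case unfolding * using Suc.IH[OF Dy] D_index[OF Suc.prems, of _ l]
      by (auto simp: power_Suc2 mult.assoc simp del: index_mult_mat_vec power_Suc)
  qed
  obtain y where y: "y \<in> V" "x = P *\<^sub>v y" using S_preimage[OF P x(1)] .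
  have y0: "y \<noteq> 0\<^sub>v (Suc n)"
    using x(2) y(2) S_zero[OF P] by metis
  obtain z where z: "z \<in> V" "P *\<^sub>v (y \<cdot>\<^sub>r c) = P *\<^sub>v z" "\<forall>i\<le>n. z $ i = lox_diag l i ^ k * y $ i"
    using pw[OF y(1), of k] fx unfolding y(2) S_rsmult[OF P y(1)] by auto
  then have "y \<cdot>\<^sub>r c = z" using S_inj[OF P, of "y \<cdot>\<^sub>r c" z] y(1) by simp
  with z(3) y(1) have eq: "y $ i * c = lox_diag l i ^ k * y $ i" if "i \<le> n" for i
    using that by (metis rsmult_index carrier_vecD less_Suc_eq_le)
  have nrm: "y $ i = 0 \<or> norm c = norm (lox_diag l i) ^ k" if "i \<le> n" for i
    using arg_cong[OF eq[OF that], of norm] by (auto simp: norm_mult norm_power)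
  have n1: "norm (lox_diag l (n - 1)) ^ k > 1" "norm (lox_diag l n) ^ k < 1"
    "i < n - 1 \<Longrightarrow> norm (lox_diag l i) ^ k = 1" for i
    using NF_D[OF nf] n_pos k
    by (auto simp: lox_diag_def norm_inverse power_inverse one_less_power intro!: inverse_less_1_iff[THEN iffD2])
  have conc: "proj x = proj (P *\<^sub>v e j)" if "j \<le> n" "\<And>i. i \<le> n \<Longrightarrow> i \<noteq> j \<Longrightarrow> y $ i = 0" for j
  proof -
    have "y = e j \<cdot>\<^sub>r (y $ j)" using that y(1) by (intro eq_vecI) (auto simp: less_Suc_eq_le)
    moreover from this y0 have "y $ j \<noteq> 0" using rsmult_zero[of "e j" "Suc n"] by auto
    ultimately show ?thesis unfolding y(2) using S_rsmult[OF P e_in_V] proj_rsmult by metis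
  qed
  show ?thesis
  proof (cases "y $ (n - 1) = 0")
    case False
    then have c: "norm c > 1" using nrm[of "n - 1"] n1(1) by auto
    have "y $ i = 0" if i: "i \<le> n" "i \<noteq> n - 1" for i
    proof -
      consider "i = n" | "i < n - 1" using i by linarith
      then show ?thesis using nrm[OF i(1)] n1(2) n1(3)[of i] c by cases auto
    qed
    then show ?thesis using conc[of "n - 1"] by (simp add: att_def)
  next
    case True
    have "Q y \<le> 0" using x(3) Q_S[OF P y(1)] y(2) by simp
    then have "(\<Sum>i<n - 1. (norm (y $ i))\<^sup>2) \<le> 0" unfolding Q_coords True by simp
    then have "(\<Sum>i<n - 1. (norm (y $ i))\<^sup>2) = 0" by (intro order_antisym sum_nonneg) auto
    then have "\<forall>i<n - 1. y $ i = 0" by (subst (asm) sum_nonneg_eq_0_iff) auto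
    moreover have "i = n - 1 \<or> i < n - 1" if "i \<le> n" "i \<noteq> n" for i using that by linarith
    ultimately have "y $ i = 0" if "i \<le> n" "i \<noteq> n" for i using that True by metis
    then show ?thesis using conc[of n] by (simp add: rpl_def)
  qed
qed

end

section \<open>Diagonalisation of loxodromic elements\<close>

text \<open>The complex numbers as the span of 1 and i; right multiplication by them turns a
  quaternionic space into a complex one, where polynomials split.\<close>

definition cquat :: "complex \<Rightarrow> quat" where
  "cquat c = Quat (Re c) (Im c) 0 0"

lemma cquat_simps [simp]:
  "cquat 0 = 0" "cquat (c - d) = cquat c - cquat d" "cquat (c * d) = cquat c * cquat d"
  "cquat (- c) = - cquat c" "cquat (of_real r) = of_real r"
  by (simp_all add: cquat_def quat_eq_iff quat_times_sel)

lemma cquat_eq_0_iff [simp]: "cquat c = 0 \<longleftrightarrow> c = 0"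
  by (simp add: cquat_def quat_eq_iff complex_eq_iff)

lemma cquat_commute: "cquat c * cquat d = cquat d * cquat c"
  by (metis cquat_simps(3) mult.commute)

lemma quat_sel_sum:
  "qI (sum f A) = (\<Sum>x\<in>A. qI (f x))" "qJ (sum f A) = (\<Sum>x\<in>A. qJ (f x))" "qK (sum f A) = (\<Sum>x\<in>A. qK (f x))"
  by (induction A rule: infinite_finite_induct) simp_all

context herm_space
begin

definition iter :: "quat mat \<Rightarrow> nat \<Rightarrow> quat vec \<Rightarrow> quat vec" where
  "iter g j = ((\<lambda>z. g *\<^sub>v z) ^^ j)"

lemma iter_simps: "iter g 0 x = x" "iter g (Suc j) x = g *\<^sub>v iter g j x" "iter g (Suc j) x = iter g j (g *\<^sub>v x)"
  by (simp_all add: iter_def funpow_swap1)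

lemma iter_V: "g \<in> S \<Longrightarrow> x \<in> V \<Longrightarrow> iter g j x \<in> V"
  by (induction j) (simp_all add: iter_simps)

lemma iter_lin:
  assumes "g \<in> S" "x \<in> V" "y \<in> V"
  shows "iter g j (x + y \<cdot>\<^sub>r c) = iter g j x + iter g j y \<cdot>\<^sub>r c"
  using assms by (induction j) (simp_all add: iter_simps(1,2) S_add S_rsmult iter_V)

text \<open>Right multiplication by complex scalars commutes with \<open>g\<close>, so that a complex polynomial
  annihilating \<open>x\<close> can be split into linear factors, one of which yields an eigenvector.\<close>

lemma annihilated_eigenvector:
  fixes p :: "complex poly"
  assumes g: "g \<in> S" and WV: "W \<subseteq> V"
    and W: "\<And>x y. x \<in> W \<Longrightarrow> y \<in> W \<Longrightarrow> x + y \<in> W" "\<And>x l. x \<in> W \<Longrightarrow> x \<cdot>\<^sub>r l \<in> W"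
      "\<And>x. x \<in> W \<Longrightarrow> g *\<^sub>v x \<in> W"
    and p: "p \<noteq> 0" "degree p \<le> N" and x: "x \<in> W" "x \<noteq> 0\<^sub>v (Suc n)"
    and ann: "\<And>i. i \<le> n \<Longrightarrow> (\<Sum>j\<le>N. iter g j x $ i * cquat (coeff p j)) = 0"
  shows "\<exists>w\<in>W. \<exists>c. w \<noteq> 0\<^sub>v (Suc n) \<and> g *\<^sub>v w = w \<cdot>\<^sub>r c"
proof -
  have const: False if "degree p = 0" "p \<noteq> 0" and x: "x \<in> W" "x \<noteq> 0\<^sub>v (Suc n)"
    and ann: "\<And>i. i \<le> n \<Longrightarrow> (\<Sum>j\<le>N. iter g j x $ i * cquat (coeff p j)) = 0" for p :: "complex poly" and x N
  proof -
    from that(1,2) have c0: "coeff p 0 \<noteq> 0" by (metis leading_coeff_0_iff)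
    have "coeff p j = 0" if "j \<noteq> 0" for j using \<open>degree p = 0\<close> that by (simp add: coeff_eq_0)
    then have "(\<Sum>j\<le>N. iter g j x $ i * cquat (coeff p j)) = (\<Sum>j\<in>{0}. iter g j x $ i * cquat (coeff p j))" for i
      by (intro sum.mono_neutral_right) auto
    with ann c0 have "x $ i = 0" if "i \<le> n" for i using that by (simp add: iter_simps)
    with x WV show False by (auto simp: vec_eq_iff)
  qed
  from p x ann show ?thesis
  proof (induction N arbitrary: p x)
    case 0
    then show ?case using const[of p x 0] by simp
  next
    case (Suc N)
    show ?case
    proof (cases "degree p = 0")
      case True
      then show ?thesis using const[of p x "Suc N"] Suc.prems by blast
    next
      case False
      then have "\<not> constant (poly p)" by (simp add: constant_degree)
      then obtain z where "poly p z = 0"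
        using fundamental_theorem_of_algebra by blast
      then obtain q where pq: "p = [:- z, 1:] * q" by (metis dvdE poly_eq_0_iff_dvd)
      with Suc.prems have q0: "q \<noteq> 0" by auto
      have "degree p = Suc (degree q)" unfolding pq using q0 by (subst degree_mult_eq) auto
      with Suc.prems have dq: "degree q \<le> N" by simp
      \<comment> \<open>With \<open>z\<close> a root of \<open>p\<close>, this is the linear factor
        of \<open>g\<close> at \<open>z\<close> applied to \<open>x\<close>. If it vanishes,
        \<open>x\<close> is an eigenvector; otherwise the cofactor \<open>q\<close> annihilates
        \<open>y\<close> and the induction continues.\<close>
      define y where "y = g *\<^sub>v x + x \<cdot>\<^sub>r cquat (- z)"
      have xV: "x \<in> V" using Suc.prems WV by auto
      have yW: "y \<in> W" unfolding y_def using Suc.prems W by simp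
      show ?thesis
      proof (cases "y = 0\<^sub>v (Suc n)")
        case True
        have "g *\<^sub>v x = x \<cdot>\<^sub>r cquat z"
        proof (rule eq_vecI)
          fix i assume "i < dim_vec (x \<cdot>\<^sub>r cquat z)"
          then have i: "i < Suc n" using xV by simp
          have "y $ i = 0" using True i by simp
          then show "(g *\<^sub>v x) $ i = (x \<cdot>\<^sub>r cquat z) $ i"
            unfolding y_def using i xV carrier_vecD[OF S_vec[OF g xV]] by simp
        qed (use xV carrier_vecD[OF S_vec[OF g xV]] in simp)
        then show ?thesis using Suc.prems by blast
      next
        case False
        have "(\<Sum>j\<le>N. iter g j y $ i * cquat (coeff q j)) = 0" if i: "i \<le> n" for i
        proof -
          define a where "a j = iter g j x $ i" for j
          have it: "iter g j y $ i = a (Suc j) - a j * cquat z" for j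
            unfolding y_def iter_lin[OF g S_vec[OF g xV] xV] a_def
            using i carrier_vecD[OF iter_V[OF g xV]] carrier_vecD[OF iter_V[OF g S_vec[OF g xV]]]
            by (simp add: iter_simps(3) less_Suc_eq_le)
          have "0 = (\<Sum>j\<le>Suc N. a j * cquat (coeff p j))"
            using Suc.prems(5)[OF i] by (simp add: a_def)
          also have "\<dots> = (\<Sum>j\<le>Suc N. a j * cquat (case j of 0 \<Rightarrow> 0 | Suc k \<Rightarrow> coeff q k))
              - (\<Sum>j\<le>Suc N. a j * cquat z * cquat (coeff q j))"
            unfolding pq sum_subtractf[symmetric]
            by (intro sum.cong refl) (simp add: coeff_pCons algebra_simps cquat_commute split: nat.split)
          also have "(\<Sum>j\<le>Suc N. a j * cquat (case j of 0 \<Rightarrow> 0 | Suc k \<Rightarrow> coeff q k))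
              = (\<Sum>j\<le>N. a (Suc j) * cquat (coeff q j))"
            by (subst sum.atMost_Suc_shift) simp
          also have "(\<Sum>j\<le>Suc N. a j * cquat z * cquat (coeff q j)) = (\<Sum>j\<le>N. a j * cquat z * cquat (coeff q j))"
            using dq by (simp add: coeff_eq_0)
          finally show ?thesis unfolding it by (simp add: left_diff_distrib sum_subtractf)
        qed
        then show ?thesis using Suc.IH[OF q0 dq yW False] by blast
      qed
    qed
  qed
qed

text \<open>Among sufficiently many iterates of \<open>x\<close> there is a real linear relation,
  that is, a nonzero real polynomial annihilating \<open>x\<close>. Closure of \<open>W\<close>
  under the operations keeps the eigenvector in \<open>W\<close>.\<close>

lemma invariant_eigenvector:
  assumes g: "g \<in> S" and WV: "W \<subseteq> V"
    and W: "\<And>x y. x \<in> W \<Longrightarrow> y \<in> W \<Longrightarrow> x + y \<in> W" "\<And>x l. x \<in> W \<Longrightarrow> x \<cdot>\<^sub>r l \<in> W"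
      "\<And>x. x \<in> W \<Longrightarrow> g *\<^sub>v x \<in> W"
    and x: "x \<in> W" "x \<noteq> 0\<^sub>v (Suc n)"
  obtains w c where "w \<in> W" "w \<noteq> 0\<^sub>v (Suc n)" "g *\<^sub>v w = w \<cdot>\<^sub>r c"
proof -
  \<comment> \<open>The real dimension of the whole space; the iterates \<open>0, ..., N\<close> are
    one more than that.\<close>
  define N where "N = 4 * Suc n"
  define comp :: "nat \<Rightarrow> quat \<Rightarrow> real" where
    "comp k = (if k = 0 then qRe else if k = 1 then qI else if k = 2 then qJ else qK)" for k
  obtain c where c0: "\<exists>j\<in>{..N}. c j \<noteq> 0" and c:
    "\<And>ik. ik \<in> {..n} \<times> {..<4} \<Longrightarrow> (\<Sum>j\<in>{..N}. comp (snd ik) (iter g j x $ fst ik) * c j) = 0"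
    using underdetermined_system[of "{..n} \<times> {..<4::nat}" "{..N}" "\<lambda>ik j. comp (snd ik) (iter g j x $ fst ik)"]
    by (auto simp: N_def)
  define p where "p = (\<Sum>j\<le>N. monom (complex_of_real (c j)) j)"
  have cp: "coeff p j = (if j \<le> N then of_real (c j) else 0)" for j
    by (simp add: p_def coeff_sum)
  have p0: "p \<noteq> 0" using c0 cp by (metis atMost_iff coeff_0 of_real_eq_0_iff)
  have dp: "degree p \<le> N" by (rule degree_le) (simp add: cp)
  have ann: "(\<Sum>j\<le>N. iter g j x $ i * cquat (coeff p j)) = 0" if i: "i \<le> n" for i
  proof -
    have "comp k (\<Sum>j\<le>N. iter g j x $ i * cquat (coeff p j)) = 0" if "k < 4" for k
    proof -
      have "comp k (\<Sum>j\<le>N. iter g j x $ i * cquat (coeff p j)) = (\<Sum>j\<le>N. comp k (iter g j x $ i) * c j)"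
        by (auto simp: comp_def cp qRe_sum quat_sel_sum quat_times_sel intro!: sum.cong)
      then show ?thesis using c[of "(i, k)"] i that by simp
    qed
    from this[of 0] this[of 1] this[of 2] this[of 3] show ?thesis
      by (simp add: comp_def quat_eq_iff)
  qed
  show ?thesis using annihilated_eigenvector[OF g WV W p0 dp x ann] that by blast
qed

section \<open>Orthonormal eigenframes and construction of the normal form\<close>

definition form_coeff :: "quat vec \<Rightarrow> nat \<Rightarrow> quat" where
  "form_coeff w j = (if j < n - 1 then qcnj (w $ j) else if j = n - 1 then - qcnj (w $ n) else - qcnj (w $ (n - 1)))"

lemma herm_sum: "H z w = (\<Sum>j<Suc n. form_coeff w j * z $ j)"
proof -
  have "(\<Sum>j<Suc n. form_coeff w j * z $ j) = (\<Sum>j<n - 1. form_coeff w j * z $ j) + form_coeff w (n - 1) * z $ (n - 1) + form_coeff w n * z $ n"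
    by (simp add: sum_lessThan_n)
  moreover have "(\<Sum>j<n - 1. form_coeff w j * z $ j) = (\<Sum>j<n - 1. qcnj (w $ j) * z $ j)"
    by (intro sum.cong) (auto simp: form_coeff_def)
  moreover have "form_coeff w (n - 1) = - qcnj (w $ n)" "form_coeff w n = - qcnj (w $ (n - 1))"
    using n_pos by (auto simp: form_coeff_def)
  ultimately show ?thesis unfolding herm_def by (simp only:) (simp add: algebra_simps)
qed

lemma exists_orthogonal:
  assumes "k < Suc n"
  obtains x where "x \<in> V" "x \<noteq> 0\<^sub>v (Suc n)" "\<And>i. i < k \<Longrightarrow> H x (F i) = 0"
proof -
  obtain x where x: "\<exists>j\<in>{..<Suc n}. x j \<noteq> 0" "\<And>i. i \<in> {..<k} \<Longrightarrow> (\<Sum>j\<in>{..<Suc n}. form_coeff (F i) j * x j) = 0"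
    using underdetermined_system[of "{..<k}" "{..<Suc n}" "\<lambda>i j. form_coeff (F i) j"] assms by auto
  show ?thesis
  proof (rule that[of "vec (Suc n) x"])
    show "vec (Suc n) x \<noteq> 0\<^sub>v (Suc n)" using x(1) by (metis index_vec index_zero_vec(1) lessThan_iff)
    fix i assume "i < k"
    then show "H (vec (Suc n) x) (F i) = 0" using x(2)[of i] by (simp add: herm_sum)
  qed simp
qed

text \<open>The complement of \<open>u\<close>, \<open>v\<close> and the vectors found so far is
  invariant under \<open>g\<close> and nonzero by counting conditions, so it contains an
  eigenvector. Being orthogonal to the negative vector \<open>u + v\<close>, this eigenvector is
  positive and can be normalised; its eigenvalue is a unit because \<open>g\<close> preserves
  \<open>Q\<close>.\<close>

lemma eigenframe:
  assumes g: "g \<in> S" and V: "u \<in> V" "v \<in> V" and q: "Q u = 0" "Q v = 0" "H u v = -1"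
    and eu: "g *\<^sub>v u = u \<cdot>\<^sub>r a" and ev: "g *\<^sub>v v = v \<cdot>\<^sub>r b" and ab: "a \<noteq> 0" "b \<noteq> 0"
  shows "k \<le> n - 1 \<Longrightarrow> \<exists>E l. \<forall>i<k. E i \<in> V \<and> (\<forall>j<k. H (E i) (E j) = (if i = j then 1 else 0))
    \<and> H (E i) u = 0 \<and> H (E i) v = 0 \<and> g *\<^sub>v E i = E i \<cdot>\<^sub>r l i \<and> norm (l i :: quat) = 1"
proof (induction k)
  case (Suc k)
  then obtain E l where E: "\<And>i. i < k \<Longrightarrow> E i \<in> V" "\<And>i j. i < k \<Longrightarrow> j < k \<Longrightarrow> H (E i) (E j) = (if i = j then 1 else 0)"
    "\<And>i. i < k \<Longrightarrow> H (E i) u = 0" "\<And>i. i < k \<Longrightarrow> H (E i) v = 0"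
    "\<And>i. i < k \<Longrightarrow> g *\<^sub>v E i = E i \<cdot>\<^sub>r l i" "\<And>i. i < k \<Longrightarrow> norm (l i :: quat) = 1"
    by auto
  define W where "W = {w \<in> V. (\<forall>i<k. H w (E i) = 0) \<and> H w u = 0 \<and> H w v = 0}"
  \<comment> \<open>The complement of an eigenvector is invariant: \<open>H (g w) (g y) = 0\<close>,
    and \<open>g y\<close> differs from \<open>y\<close> by a nonzero scalar.\<close>
  have inv: "H (g *\<^sub>v w) y = 0" if "w \<in> V" "y \<in> V" "H w y = 0" "g *\<^sub>v y = y \<cdot>\<^sub>r c" "c \<noteq> 0" for w y c
  proof -
    have "qcnj c * H (g *\<^sub>v w) y = 0"
      using S_D(2)[OF g that(1,2)] that herm_rsmult_right[OF that(2), of "g *\<^sub>v w" c] by simp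
    then show ?thesis using that(5) by simp
  qed
  have "l i \<noteq> 0" if "i < k" for i using E(6)[OF that] by auto
  then have Wg: "g *\<^sub>v w \<in> W" if "w \<in> W" for w
    using that inv[OF _ V(1) _ eu ab(1)] inv[OF _ V(2) _ ev ab(2)] inv[OF _ E(1) _ E(5)] g
    unfolding W_def by blast
  \<comment> \<open>The conditions to be met: the \<open>k\<close> vectors already found, then
    \<open>u\<close> and \<open>v\<close>.\<close>
  define F where "F i = (if i < k then E i else if i = k then u else v)" for i
  have "k + 2 < Suc n" using Suc.prems n_pos by linarith
  then obtain x where x: "x \<in> V" "x \<noteq> 0\<^sub>v (Suc n)" "\<And>i. i < k + 2 \<Longrightarrow> H x (F i) = 0"
    by (rule exists_orthogonal[of "k + 2" F]) blast
  have "H x (E i) = 0" if "i < k" for i using x(3)[of i] that by (simp add: F_def)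
  moreover have "H x u = 0" "H x v = 0" using x(3)[of k] x(3)[of "k + 1"] by (simp_all add: F_def)
  ultimately have xW: "x \<in> W" using x(1) by (simp add: W_def)
  obtain w c where w: "w \<in> W" "w \<noteq> 0\<^sub>v (Suc n)" "g *\<^sub>v w = w \<cdot>\<^sub>r c"
  proof (rule invariant_eigenvector[OF g _ _ _ Wg xW x(2)])
    show "W \<subseteq> V" by (auto simp: W_def)
    show "x + y \<in> W" if "x \<in> W" "y \<in> W" for x y using that by (auto simp: W_def herm_lin)
    show "x \<cdot>\<^sub>r l \<in> W" if "x \<in> W" for x l using that by (auto simp: W_def herm_lin)
  qed
  have wV: "w \<in> V" using w(1) by (simp add: W_def)
  have "H w (u + v) = 0" using w(1) V by (simp add: W_def herm_lin)
  moreover have "Q (u + v) < 0" using V q by (simp add: Q_add)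
  ultimately have Qw: "Q w > 0" using orth_neg_imp_zero[OF wV, of "u + v"] w(2) by force
  \<comment> \<open>The normalising scalar is real, hence central, and so the eigenvalue stays
    \<open>c\<close>.\<close>
  define w' where "w' = w \<cdot>\<^sub>r of_real (1 / sqrt (Q w))"
  have w'V: "w' \<in> V" using wV by (simp add: w'_def)
  have Qw': "Q w' = 1" using wV Qw by (simp add: w'_def Q_rsmult power_divide del: of_real_divide)
  have "g *\<^sub>v w' = w \<cdot>\<^sub>r (c * of_real (1 / sqrt (Q w)))" unfolding w'_def using g wV w(3) S_rsmult by simp
  also have "\<dots> = w' \<cdot>\<^sub>r c" unfolding w'_def rsmult_rsmult of_real_quat_commute ..
  finally have ew': "g *\<^sub>v w' = w' \<cdot>\<^sub>r c" .
  have "Q (w' \<cdot>\<^sub>r c) = 1" using Q_S[OF g w'V] ew' Qw' by simp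
  then have c: "norm c = 1" using Q_rsmult[OF w'V] Qw' by (simp add: power2_eq_1_iff) (smt (verit) norm_ge_zero)
  have w'o: "H w' (E i) = 0" "H (E i) w' = 0" if "i < k" for i
    using w(1) that wV herm_eq_0_sym[of w' "E i"] by (simp_all add: W_def w'_def herm_lin)
  have w'uv: "H w' u = 0" "H w' v = 0"
    using w(1) wV by (simp_all add: W_def w'_def herm_lin)
  have w'w': "H w' w' = 1" using herm_self[of w'] Qw' by simp
  show ?case
    using E w'V w'o w'uv w'w' ew' c
    by (intro exI[of _ "E(k := w')"] exI[of _ "l(k := c)"]) (auto simp: less_Suc_eq)
qed simp

lemma herm_mult_mat_vec:
  assumes A: "A \<in> M" and z: "z \<in> V"
  shows "H (A *\<^sub>v z) y = (\<Sum>j<Suc n. H (A *\<^sub>v e j) y * z $ j)"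
proof -
  have "H (A *\<^sub>v z) y = (\<Sum>i<Suc n. \<Sum>j<Suc n. form_coeff y i * A $$ (i, j) * z $ j)"
    unfolding herm_sum using A z
    by (intro sum.cong) (auto simp: index_mult_mat_vec_sum sum_distrib_left mult.assoc simp del: index_mult_mat_vec sum.lessThan_Suc)
  also have "\<dots> = (\<Sum>j<Suc n. \<Sum>i<Suc n. form_coeff y i * A $$ (i, j) * z $ j)" by (rule sum.swap)
  also have "\<dots> = (\<Sum>j<Suc n. H (A *\<^sub>v e j) y * z $ j)"
  proof (intro sum.cong refl)
    fix j assume j: "j \<in> {..<Suc n}"
    have "H (A *\<^sub>v e j) y = (\<Sum>i<Suc n. form_coeff y i * A $$ (i, j))"
      unfolding herm_sum mult_mat_unit_vec[OF A, of j, unfolded lessThan_iff[symmetric], OF j]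
      using A j by (intro sum.cong) auto
    then show "(\<Sum>i<Suc n. form_coeff y i * A $$ (i, j) * z $ j) = H (A *\<^sub>v e j) y * z $ j"
      by (simp only: sum_distrib_right)
  qed
  finally show ?thesis .
qed

text \<open>A sesquilinear form is determined by its Gram matrix; the same expansion is applied to
  \<open>A\<close> and to the identity matrix.\<close>

lemma S_I_basis:
  assumes A: "A \<in> M" and b: "\<And>i j. i \<le> n \<Longrightarrow> j \<le> n \<Longrightarrow> H (A *\<^sub>v e i) (A *\<^sub>v e j) = H (e i) (e j)"
  shows "A \<in> S"
proof (rule S_I[OF A])
  fix z w assume V: "z \<in> V" "w \<in> V"
  have expand: "H (B *\<^sub>v z) (B *\<^sub>v w) = (\<Sum>j<Suc n. qcnj (\<Sum>i<Suc n. H (B *\<^sub>v e i) (B *\<^sub>v e j) * w $ i) * z $ j)"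
    if B: "B \<in> M" for B
    unfolding herm_mult_mat_vec[OF B V(1)] herm_mult_mat_vec[OF B V(2), symmetric] qcnj_herm ..
  have "H (A *\<^sub>v z) (A *\<^sub>v w) = H (1\<^sub>m (Suc n) *\<^sub>v z) (1\<^sub>m (Suc n) *\<^sub>v w)"
    unfolding expand[OF A] expand[OF one_carrier_mat]
    using b by (intro sum.cong arg_cong2[of _ _ _ _ "(*)"] arg_cong[of _ _ qcnj]) auto
  then show "H (A *\<^sub>v z) (A *\<^sub>v w) = H z w" using V by simp
qed

text \<open>The matrix with columns \<open>E i\<close>, \<open>u\<close>, \<open>v\<close> has the
  Gram matrix of the standard basis, so it lies in the group; the eigenvector equations say
  columnwise that it conjugates \<open>g\<close> to diagonal form.\<close>

lemma NF_exists:
  assumes g: "g \<in> S" and V: "u \<in> V" "v \<in> V" and q: "Q u = 0" "Q v = 0" "H u v = -1"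
    and eu: "g *\<^sub>v u = u \<cdot>\<^sub>r a" and ev: "g *\<^sub>v v = v \<cdot>\<^sub>r inverse (qcnj a)" and a: "norm a > 1"
  obtains P l where "NF g P l"
proof -
  have a0: "a \<noteq> 0" using a by auto
  then obtain E l where E: "\<And>i. i < n - 1 \<Longrightarrow> E i \<in> V"
    "\<And>i j. i < n - 1 \<Longrightarrow> j < n - 1 \<Longrightarrow> H (E i) (E j) = (if i = j then 1 else 0)"
    "\<And>i. i < n - 1 \<Longrightarrow> H (E i) u = 0" "\<And>i. i < n - 1 \<Longrightarrow> H (E i) v = 0"
    "\<And>i. i < n - 1 \<Longrightarrow> g *\<^sub>v E i = E i \<cdot>\<^sub>r l i" "\<And>i. i < n - 1 \<Longrightarrow> norm (l i :: quat) = 1"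
    using eigenframe[OF g V q eu ev, of "n - 1"] by auto
  define F where "F i = (if i < n - 1 then E i else if i = n - 1 then u else v)" for i
  define m where "m i = (if i < n - 1 then l i else a)" for i
  define P where "P = mat (Suc n) (Suc n) (\<lambda>(i, j). F j $ i)"
  have PM: "P \<in> M" by (simp add: P_def)
  have FV: "F i \<in> V" for i using E(1) V by (simp add: F_def)
  have Pe: "P *\<^sub>v e i = F i" if "i \<le> n" for i
  proof -
    have "P *\<^sub>v e i = col P i" using PM that by (simp add: mult_mat_unit_vec)
    also have "\<dots> = F i" using that carrier_vecD[OF FV[of i]] by (intro eq_vecI) (auto simp: P_def)
    finally show ?thesis .
  qed
  have cases: "i < n - 1 \<or> i = n - 1 \<or> i = n" if "i \<le> n" for i using that by linarith
  have nn: "n - 1 \<noteq> n" "\<not> n < n - 1" using n_pos by auto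
  have u_v: "H u u = 0" "H v v = 0" "H v u = -1"
    using herm_self q qcnj_herm[of u v] by auto
  have eo: "H u (E i) = 0" "H v (E i) = 0" if "i < n - 1" for i
    using E(3,4)[OF that] herm_eq_0_sym by auto
  have "H (F i) (F j) = H (e i) (e j)" if "i \<le> n" "j \<le> n" for i j
    using cases[OF that(1)] cases[OF that(2)] nn
    by (elim disjE) (simp_all add: F_def herm_unit E u_v q(3) eo del: One_nat_def)
  then have PS: "P \<in> S" using S_I_basis[OF PM] Pe by simp
  have ml: "\<forall>i<n - 1. norm (m i) = 1" and mn: "m (n - 1) = a" using E(6) by (auto simp: m_def)
  have DS: "D m \<in> S" using D_in_S[OF ml] mn a0 by simp
  have "g *\<^sub>v F i = F i \<cdot>\<^sub>r lox_diag m i" if "i \<le> n" for i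
    using cases[OF that] nn E(5)[of i] eu ev mn
    by (elim disjE) (simp_all add: F_def lox_diag_def m_def del: One_nat_def)
  then have "g * P = P * D m"
    using g PS DS Pe D_unit S_rsmult[OF PS e_in_V]
    by (intro S_eqI) (simp_all add: S_mult_vec less_Suc_eq_le)
  then have "g = P * D m * inv_Sp P"
    using g PS DS Sp.inv_solve_right[of g "P * D m" P] by simp
  with PS ml mn a have "NF g P m" by (simp add: NF_def)
  then show ?thesis by (rule that)
qed

section \<open>Fixed points and normal form of a loxodromic element\<close>

lemma fixed_proj: "g \<in> S \<Longrightarrow> z \<in> V \<Longrightarrow> act g (proj z) = proj z \<longleftrightarrow> (\<exists>l. l \<noteq> 0 \<and> g *\<^sub>v z = z \<cdot>\<^sub>r l)"
  using act_proj proj_eq_iff by metis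

lemma bdryE: assumes "p \<in> bdry n"
  obtains z where "z \<in> V" "z \<noteq> 0\<^sub>v (Suc n)" "Q z = 0" "p = proj z"
  using assms by (auto simp: bdry_def V_zero_def Q_def)

lemma bdryI: "z \<in> V \<Longrightarrow> z \<noteq> 0\<^sub>v (Suc n) \<Longrightarrow> Q z = 0 \<Longrightarrow> proj z \<in> bdry n"
  using herm_self[of z] by (auto simp: bdry_def V_zero_def)

lemma hyp_iff: "p \<in> hyp n \<longleftrightarrow> (\<exists>z\<in>V. Q z < 0 \<and> p = proj z)"
  by (auto simp: hyp_def V_minus_def Q_def)

lemma proj_eq_Q: assumes "proj z = proj w" "z \<in> V" shows "\<exists>t>0. Q w = Q z * t"
proof -
  obtain l where "l \<noteq> 0" "w = z \<cdot>\<^sub>r l" using assms(1) proj_eq_iff by blast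
  then show ?thesis using Q_rsmult[OF assms(2)] by (intro exI[of _ "(norm l)\<^sup>2"]) auto
qed

lemma null_herm_nonzero:
  assumes "z \<in> V" "w \<in> V" "Q z = 0" "Q w = 0" "z \<noteq> 0\<^sub>v (Suc n)" "w \<noteq> 0\<^sub>v (Suc n)" "proj z \<noteq> proj w"
  shows "H z w \<noteq> 0"
proof
  assume "H z w = 0"
  then obtain l where "w = z \<cdot>\<^sub>r l" using null_orth_proportional assms by metis
  moreover from this have "l \<noteq> 0" using assms rsmult_zero by metis
  ultimately show False using assms(7) proj_rsmult by metis
qed

text \<open>Loxodromy speaks only of fixed points, so the modulus of the eigenvalue has to be found.
  Invariance of \<open>H u v\<close> relates the two eigenvalues, and modulus one would make them
  equal and produce a fixed point inside. Modulus below one is cured by exchanging the ends.\<close>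

lemma loxodromic_NF:
  assumes lox: "loxodromic n g"
  obtains P l where "NF g P l"
proof -
  have g: "g \<in> S" and c2: "card (fixed_points n g) = 2" and sub: "fixed_points n g \<subseteq> bdry n"
    using lox by (auto simp: loxodromic_def)
  obtain p q where pq: "fixed_points n g = {p, q}" "p \<noteq> q" using c2 card_2_iff by metis
  obtain u where u: "u \<in> V" "u \<noteq> 0\<^sub>v (Suc n)" "Q u = 0" "p = proj u" using pq sub bdryE by (metis insertI1 subsetD)
  obtain v0 where v0: "v0 \<in> V" "v0 \<noteq> 0\<^sub>v (Suc n)" "Q v0 = 0" "q = proj v0" using pq sub bdryE by (metis insertI1 insert_commute subsetD)
  have s0: "H u v0 \<noteq> 0" using null_herm_nonzero u v0 pq by metis
  \<comment> \<open>Rescales the second lift so that the product with \<open>u\<close> becomes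
    \<open>-1\<close>.\<close>
  define t where "t = qcnj (- inverse (H u v0))"
  define v where "v = v0 \<cdot>\<^sub>r t"
  have t0: "t \<noteq> 0" using s0 by (simp add: t_def)
  have v: "v \<in> V" "Q v = 0" "q = proj v"
    using v0 t0 by (simp_all add: v_def Q_rsmult proj_rsmult)
  have uv: "H u v = -1" using v0 s0 by (simp add: v_def herm_lin t_def)
  have "act g (proj u) = proj u" "act g (proj v) = proj v" using pq u(4) v(3) by (auto simp: fixed_points_def)
  then obtain a b where a: "a \<noteq> 0" "g *\<^sub>v u = u \<cdot>\<^sub>r a" and b: "b \<noteq> 0" "g *\<^sub>v v = v \<cdot>\<^sub>r b"
    using fixed_proj[OF g] u v by metis
  have "qcnj b * a = 1"
    using S_D(2)[OF g u(1) v(1)] uv u v unfolding a(2) b(2) by (simp add: herm_lin)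
  then have ab: "b = inverse (qcnj a)" and ba: "a = inverse (qcnj b)"
    by (metis inverse_unique qcnj_inverse qcnj_simps(1) inverse_inverse_eq, metis inverse_unique)
  \<comment> \<open>Otherwise \<open>a = b\<close>, and the negative vector \<open>u + v\<close>
    spans a fixed point in the interior.\<close>
  have "norm a \<noteq> 1"
  proof
    assume "norm a = 1"
    then have "qcnj a * a = 1" by (simp add: qcnj_mult_self)
    then have "b = a" using ab by (metis inverse_unique)
    then have "g *\<^sub>v (u + v) = (u + v) \<cdot>\<^sub>r a" using g u v a b by (simp add: S_add rsmult_add_vec[of _ "Suc n"])
    then have "act g (proj (u + v)) = proj (u + v)" using fixed_proj[OF g, of "u + v"] u v a by auto
    moreover have neg: "Q (u + v) < 0" using u v uv by (simp add: Q_add)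
    ultimately have "proj (u + v) \<in> fixed_points n g"
      using u v hyp_iff by (auto simp: fixed_points_def)
    then obtain z where "z \<in> V" "Q z = 0" "proj (u + v) = proj z" using sub bdryE by (metis subsetD)
    then show False using proj_eq_Q[of "u + v" z] u v neg by auto
  qed
  then consider "norm a > 1" | "norm a < 1" by linarith
  then show ?thesis
  proof cases
    case 1
    then show ?thesis using NF_exists[OF g u(1) v(1) u(3) v(2) uv a(2) b(2)[unfolded ab]] that by blast
  next
    case 2
    then have "norm b > 1" using a(1) unfolding ab by (simp add: norm_inverse one_less_inverse)
    moreover have "H v u = -1" using qcnj_herm[of u v] uv by simp
    ultimately show ?thesis
      using NF_exists[OF g v(1) u(1) v(2) u(3) _ b(2) a(2)[unfolded ba]] that by blast
  qed
qed

lemma loxodromic_NF_eigenvalues: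
  assumes "loxodromic n g" obtains P where "NF g P (lox_eigenvalues n g)"
proof -
  have "\<exists>l. lox_normal_form n g l" using loxodromic_NF[OF assms] lox_normal_form_iff by metis
  then have "lox_normal_form n g (lox_eigenvalues n g)" unfolding lox_eigenvalues_def by (rule someI_ex)
  then show ?thesis using that lox_normal_form_iff by blast
qed

lemma NF_fixed_points:
  assumes nf: "NF g P l" shows "fixed_points n g = {proj (att P), proj (rpl P)}"
proof -
  note AR = att_rpl[OF NF_D(1)[OF nf]] and g = NF_D(3)[OF nf]
  have nz: "att P \<noteq> 0\<^sub>v (Suc n)" "rpl P \<noteq> 0\<^sub>v (Suc n)" using AR(5,6) by auto
  have "fixed_points n g \<subseteq> {proj (att P), proj (rpl P)}"
  proof
    fix p assume "p \<in> fixed_points n g"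
    then have p: "p \<in> hyp n \<union> bdry n" "act g p = p" by (auto simp: fixed_points_def)
    from p(1) obtain z where z: "z \<in> V" "Q z \<le> 0" "z \<noteq> 0\<^sub>v (Suc n)" "p = proj z"
    proof
      assume "p \<in> hyp n"
      then obtain z where "z \<in> V" "Q z < 0" "p = proj z" using hyp_iff by blast
      moreover from this have "z \<noteq> 0\<^sub>v (Suc n)" by (auto simp: Q_def)
      ultimately show ?thesis using that[of z] by simp
    next
      assume "p \<in> bdry n"
      then obtain z where "z \<in> V" "z \<noteq> 0\<^sub>v (Suc n)" "Q z = 0" "p = proj z" by (rule bdryE)
      then show ?thesis using that[of z] by simp
    qed
    then obtain c where "g *\<^sub>v z = z \<cdot>\<^sub>r c" using p(2) fixed_proj[OF g z(1)] by blast
    then have one: "(g [^]\<^bsub>Sp n\<^esub> (1::nat)) *\<^sub>v z = z \<cdot>\<^sub>r c" 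
      unfolding One_nat_def mat_pow_vec(2)[OF g z(1)] mat_pow_vec(1)[OF g S_vec[OF g z(1)]] .
    have "proj z = proj (att P) \<or> proj z = proj (rpl P)"
      by (rule NF_fixed_power[OF nf _ z(1) z(3) z(2) one]) simp
    then show "p \<in> {proj (att P), proj (rpl P)}" unfolding z(4) by simp
  qed
  moreover have "proj (att P) \<in> fixed_points n g" "proj (rpl P) \<in> fixed_points n g"
  proof -
    have "act g (proj (att P)) = proj (att P)"
      unfolding fixed_proj[OF g AR(1)] using NF_att_rpl(1)[OF nf] NF_D(5)[OF nf] by blast
    then show "proj (att P) \<in> fixed_points n g"
      using bdryI[OF AR(1) nz(1) AR(3)] by (simp add: fixed_points_def)
    have "inverse (qcnj (l (n - 1))) \<noteq> 0" using NF_D(5)[OF nf] by simp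
    then have "act g (proj (rpl P)) = proj (rpl P)"
      unfolding fixed_proj[OF g AR(2)] using NF_att_rpl(2)[OF nf] by blast
    then show "proj (rpl P) \<in> fixed_points n g"
      using bdryI[OF AR(2) nz(2) AR(4)] by (simp add: fixed_points_def)
  qed
  ultimately show ?thesis by blast
qed

end

section \<open>The Bergman metric and geodesics\<close>

context herm_space
begin

lemma hyp_lift:
  assumes "p \<in> hyp n" obtains z where "z \<in> V" "Q z = -1" "p = proj z"
proof -
  obtain z where z: "z \<in> V" "Q z < 0" "p = proj z" using assms hyp_iff by blast
  define t where "t = 1 / sqrt (- Q z)"
  have t: "t > 0" "t\<^sup>2 = 1 / (- Q z)" using z(2) by (simp_all add: t_def power_divide)
  have "Q (z \<cdot>\<^sub>r of_real t) = -1" using z t by (simp add: Q_rsmult)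
  moreover have "p = proj (z \<cdot>\<^sub>r of_real t)" using z(3) proj_rsmult[of "of_real t" z] t(1) by simp
  ultimately show ?thesis using that[of "z \<cdot>\<^sub>r of_real t"] z(1) by blast
qed

text \<open>The reversed Cauchy-Schwarz inequality: \<open>w + z H w z\<close> is the component of
  \<open>w\<close> orthogonal to the negative vector \<open>z\<close>, so its \<open>Q\<close> is
  nonnegative.\<close>

lemma norm_herm_ge_1:
  assumes V: "z \<in> V" "w \<in> V" and q: "Q z = -1" "Q w = -1"
  shows "norm (H z w) \<ge> 1"
proof -
  have "H (w + z \<cdot>\<^sub>r H w z) z = 0" using V herm_self[of z] q by (simp add: herm_lin)
  then have "Q (w + z \<cdot>\<^sub>r H w z) \<ge> 0" using V q by (intro orth_neg_nonneg[of _ z]) auto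
  also have "Q (w + z \<cdot>\<^sub>r H w z) = (norm (H w z))\<^sup>2 - 1"
    using V q by (simp add: Q_add Q_rsmult herm_rsmult_right qcnj_mult_self flip: of_real_power)
  finally have "(norm (H w z))\<^sup>2 \<ge> 1\<^sup>2" by simp
  then show ?thesis unfolding norm_herm_sym[of z w] by (rule power2_le_imp_le) simp
qed

text \<open>The quotient in the definition is real and independent of the lifts, at least one by the
  reversed Cauchy-Schwarz inequality, and \<open>cosh\<close> is a bijection from the nonnegative
  reals onto the reals from one upwards; hence the description by \<open>THE\<close> is
  proper.\<close>

lemma rho_cosh:
  assumes V: "z \<in> V" "w \<in> V" and q: "Q z = -1" "Q w = -1"
  shows "rho n (proj z) (proj w) \<ge> 0" "cosh (rho n (proj z) (proj w) / 2) = norm (H z w)"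
proof -
  define N where "N = norm (H z w)"
  have N: "N \<ge> 1" using norm_herm_ge_1[OF assms] by (simp add: N_def)
  have quot: "(H x y * H y x) / (H x x * H y y) = of_real (N\<^sup>2)" if "x \<in> proj z" "y \<in> proj w" for x y
  proof -
    from that obtain l m where lm: "l \<noteq> 0" "x = z \<cdot>\<^sub>r l" "m \<noteq> 0" "y = w \<cdot>\<^sub>r m"
      unfolding proj_eq by blast
    have "H x y * H y x = of_real ((norm (H x y))\<^sup>2)"
      unfolding qcnj_herm[of x y, symmetric] by (rule qcnj_mult_self(2))
    also have "norm (H x y) = norm m * N * norm l"
      unfolding lm N_def using V by (simp add: herm_lin norm_mult)
    finally have 1: "H x y * H y x = of_real ((norm m * N * norm l)\<^sup>2)" .
    have "H x x * H y y = of_real ((norm l)\<^sup>2 * (norm m)\<^sup>2)"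
      unfolding herm_self using V q by (simp add: lm Q_rsmult)
    then have "(H x y * H y x) / (H x x * H y y) = of_real ((norm m * N * norm l)\<^sup>2 / ((norm l)\<^sup>2 * (norm m)\<^sup>2))"
      unfolding 1 by simp
    also have "(norm m * N * norm l)\<^sup>2 / ((norm l)\<^sup>2 * (norm m)\<^sup>2) = N\<^sup>2"
      using lm by (simp add: power_mult_distrib field_simps)
    finally show ?thesis .
  qed
  have iff: "d \<ge> 0 \<and> (\<forall>x\<in>proj z. \<forall>y\<in>proj w.
     of_real ((cosh (d / 2))\<^sup>2) = (H x y * H y x) / (H x x * H y y)) \<longleftrightarrow> d \<ge> 0 \<and> cosh (d / 2) = N"
    (is "?P d \<longleftrightarrow> _") for d
  proof -
    have "?P d \<longleftrightarrow> d \<ge> 0 \<and> (of_real ((cosh (d / 2))\<^sup>2) :: quat) = of_real (N\<^sup>2)"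
      using quot self_in_proj[of z] self_in_proj[of w] by auto
    also have "\<dots> \<longleftrightarrow> d \<ge> 0 \<and> (cosh (d / 2))\<^sup>2 = N\<^sup>2" by (simp only: of_real_eq_iff)
    also have "\<dots> \<longleftrightarrow> d \<ge> 0 \<and> cosh (d / 2) = N"
      using N cosh_real_nonneg[of "d / 2"] by (auto simp: power2_eq_iff_nonneg)
    finally show ?thesis .
  qed
  have "\<exists>!d. d \<ge> 0 \<and> cosh (d / 2) = N"
  proof (rule ex1I[of _ "2 * arcosh N"])
    show "2 * arcosh N \<ge> 0 \<and> cosh (2 * arcosh N / 2) = N"
      using N arcosh_nonneg_real[of N] cosh_arcosh_real[of N] by simp
  next
    fix d assume d: "d \<ge> 0 \<and> cosh (d / 2) = N"
    then have "arcosh (cosh (d / 2)) = d / 2" by (intro arcosh_cosh_real) simp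
    then show "d = 2 * arcosh N" using d by simp
  qed
  then have "(THE d. d \<ge> 0 \<and> cosh (d / 2) = N) \<ge> 0 \<and> cosh ((THE d. d \<ge> 0 \<and> cosh (d / 2) = N) / 2) = N"
    by (rule theI')
  then show "rho n (proj z) (proj w) \<ge> 0" "cosh (rho n (proj z) (proj w) / 2) = norm (H z w)"
    unfolding rho_def iff N_def by auto
qed

lemma rho_nonneg: "p \<in> hyp n \<Longrightarrow> q \<in> hyp n \<Longrightarrow> rho n p q \<ge> 0"
  by (metis hyp_lift rho_cosh(1))

lemma rho_eqI:
  assumes "z \<in> V" "w \<in> V" "Q z = -1" "Q w = -1" "d \<ge> 0" "norm (H z w) = cosh (d / 2)"
  shows "rho n (proj z) (proj w) = d"
proof -
  have "cosh (rho n (proj z) (proj w) / 2) = cosh (d / 2)" using rho_cosh(2)[of z w] assms by simp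
  then show ?thesis using rho_cosh(1)[of z w] assms
    by (metis arcosh_cosh_real divide_nonneg_nonneg mult.commute nonzero_mult_div_cancel_left
        times_divide_eq_right zero_le_numeral zero_neq_numeral)
qed

lemma rho_lift:
  assumes p: "p \<in> hyp n" "q \<in> hyp n" and x: "x \<in> p" "y \<in> q"
  shows "norm (H x y) = cosh (rho n p q / 2) * (sqrt (- Q x) * sqrt (- Q y))" "Q x < 0" "Q y < 0" "x \<in> V" "y \<in> V"
proof -
  obtain z w where z: "z \<in> V" "Q z = -1" "p = proj z" and w: "w \<in> V" "Q w = -1" "q = proj w"
    using p hyp_lift by metis
  obtain l m where lm: "l \<noteq> 0" "x = z \<cdot>\<^sub>r l" "m \<noteq> 0" "y = w \<cdot>\<^sub>r m"
    using x unfolding z(3) w(3) proj_eq by blast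
  have "norm (H x y) = norm m * norm (H z w) * norm l" using z w by (simp add: lm herm_lin norm_mult)
  moreover have qx: "Q x = - (norm l)\<^sup>2" "Q y = - (norm m)\<^sup>2" using z w by (simp_all add: lm Q_rsmult)
  ultimately show "norm (H x y) = cosh (rho n p q / 2) * (sqrt (- Q x) * sqrt (- Q y))"
    using rho_cosh(2)[OF z(1) w(1) z(2) w(2)] z w by simp
  show "Q x < 0" "Q y < 0" "x \<in> V" "y \<in> V" using qx lm z w by auto
qed

lemma rho_commute: "p \<in> hyp n \<Longrightarrow> q \<in> hyp n \<Longrightarrow> rho n p q = rho n q p"
  by (metis hyp_lift rho_cosh norm_herm_sym rho_eqI)

text \<open>Project the outer points to the complement of the middle one. With half distances
  \<open>a\<close>, \<open>b\<close> the projections have lengths \<open>sinh a\<close>,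
  \<open>sinh b\<close>, and Cauchy-Schwarz there yields the addition formula for
  \<open>cosh (a + b)\<close>.\<close>

lemma rho_triangle:
  assumes p: "p \<in> hyp n" and q: "q \<in> hyp n" and r: "r \<in> hyp n"
  shows "rho n p r \<le> rho n p q + rho n q r"
proof -
  obtain x where x: "x \<in> V" "Q x = -1" "p = proj x" using p hyp_lift by metis
  obtain z where z: "z \<in> V" "Q z = -1" "q = proj z" using q hyp_lift by metis
  obtain y where y: "y \<in> V" "Q y = -1" "r = proj y" using r hyp_lift by metis
  define a b where "a = rho n p q / 2" and "b = rho n q r / 2"
  have ab: "a \<ge> 0" "b \<ge> 0" using p q r rho_nonneg by (simp_all add: a_def b_def)
  have ca: "cosh a = norm (H x z)" and cb: "cosh b = norm (H y z)"
    using rho_cosh(2) x y z norm_herm_sym[of y z] by (simp_all add: a_def b_def)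
  define x' y' where "x' = x + z \<cdot>\<^sub>r H x z" and "y' = y + z \<cdot>\<^sub>r H y z"
  have V: "x' \<in> V" "y' \<in> V" using x y z by (simp_all add: x'_def y'_def)
  have Hz: "H z z = -1" using herm_self[of z] z by simp
  have o: "H x' z = 0" "H y' z = 0" using x y z Hz by (simp_all add: x'_def y'_def herm_lin)
  have "Q x' = (norm (H x z))\<^sup>2 - 1" "Q y' = (norm (H y z))\<^sup>2 - 1"
    using x y z by (simp_all add: x'_def y'_def Q_add Q_rsmult herm_rsmult_right qcnj_mult_self flip: of_real_power)
  then have Q': "Q x' = (sinh a)\<^sup>2" "Q y' = (sinh b)\<^sup>2"
    by (simp_all add: flip: ca cb) (simp_all add: cosh_square_eq)
  have "(norm (H x' y'))\<^sup>2 \<le> (sinh a * sinh b)\<^sup>2"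
    using cauchy_schwarz_orth_neg[OF V _ o] z Q' by (simp add: power_mult_distrib)
  then have le: "norm (H x' y') \<le> sinh a * sinh b" by (rule power2_le_imp_le) (use ab in simp)
  have "H x' y' = H x y + qcnj (H y z) * H x z"
    using x y z Hz qcnj_herm[of z y] qcnj_herm[of y z] by (simp add: x'_def y'_def herm_lin distrib_right)
  then have "H x y = H x' y' - qcnj (H y z) * H x z" by simp
  then have "norm (H x y) \<le> norm (H x' y') + norm (qcnj (H y z) * H x z)" by (metis norm_triangle_ineq4)
  also have "\<dots> \<le> sinh a * sinh b + cosh b * cosh a" using le by (simp add: norm_mult ca cb)
  also have "\<dots> = cosh (a + b)" by (simp add: cosh_add)
  finally have "cosh (rho n p r / 2) \<le> cosh (a + b)" using rho_cosh(2) x y by simp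
  then have "rho n p r / 2 \<le> a + b" using cosh_real_nonneg_le_iff[of "rho n p r / 2" "a + b"] ab rho_nonneg[OF p r] by simp
  then show ?thesis by (simp add: a_def b_def)
qed

lemma act_hyp: "f \<in> S \<Longrightarrow> p \<in> hyp n \<Longrightarrow> act f p \<in> hyp n"
  using hyp_iff act_proj Q_S S_vec by metis

lemma rho_act: assumes "f \<in> S" "p \<in> hyp n" "q \<in> hyp n" shows "rho n (act f p) (act f q) = rho n p q"
proof -
  obtain z w where z: "z \<in> V" "Q z = -1" "p = proj z" and w: "w \<in> V" "Q w = -1" "q = proj w"
    using assms hyp_lift by metis
  have "rho n (proj (f *\<^sub>v z)) (proj (f *\<^sub>v w)) = rho n (proj z) (proj w)"
    using assms(1) z w rho_cosh[of z w] by (intro rho_eqI) (simp_all add: Q_S S_D(2))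
  then show ?thesis using z w assms(1) act_proj by simp
qed

text \<open>The geodesic with endpoints \<open>proj v\<close> and \<open>proj u\<close>, for null lifts with \<open>H u v = -1\<close>.\<close>

definition axis_of :: "quat vec \<Rightarrow> quat vec \<Rightarrow> point set" where
  "axis_of u v = {proj (u \<cdot>\<^sub>r of_real r + v) | r. r > 0}"

text \<open>Normalised lifts of two distinct boundary points. With the value \<open>-1\<close>,
  positive real combinations are negative vectors, that is, points of hyperbolic space.\<close>

definition null_pair :: "quat vec \<Rightarrow> quat vec \<Rightarrow> bool" where
  "null_pair u v \<longleftrightarrow> u \<in> V \<and> v \<in> V \<and> Q u = 0 \<and> Q v = 0 \<and> H u v = -1"

lemma null_pairD:
  assumes "null_pair u v"
  shows "u \<in> V" "v \<in> V" "Q u = 0" "Q v = 0" "H u v = -1" "H v u = -1" "H u u = 0" "H v v = 0"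
    "u \<noteq> 0\<^sub>v (Suc n)" "v \<noteq> 0\<^sub>v (Suc n)"
  using assms qcnj_herm[of u v] herm_self[of u] herm_self[of v] by (auto simp: null_pair_def)

lemma null_pair_sym: "null_pair u v \<Longrightarrow> null_pair v u"
  by (frule null_pairD(6)) (simp add: null_pair_def)

lemma null_pair_S: "f \<in> S \<Longrightarrow> null_pair u v \<Longrightarrow> null_pair (f *\<^sub>v u) (f *\<^sub>v v)"
  by (auto simp: null_pair_def Q_S S_D(2))

lemma null_pair_att_rpl: "P \<in> S \<Longrightarrow> null_pair (att P) (rpl P)"
  using att_rpl[of P] by (simp add: null_pair_def)

lemma Q_axis_of: "null_pair u v \<Longrightarrow> Q (u \<cdot>\<^sub>r of_real r + v) = - 2 * r"
  by (frule null_pairD(1), frule null_pairD(2), frule null_pairD(3), frule null_pairD(4), drule null_pairD(5))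
    (simp add: Q_add Q_rsmult herm_lin)

lemma axis_of_hyp: "null_pair u v \<Longrightarrow> axis_of u v \<subseteq> hyp n"
proof
  fix p assume nv: "null_pair u v" and "p \<in> axis_of u v"
  then obtain r where "r > 0" "p = proj (u \<cdot>\<^sub>r of_real r + v)" by (auto simp: axis_of_def)
  then show "p \<in> hyp n" unfolding hyp_iff using null_pairD(1,2)[OF nv] Q_axis_of[OF nv, of r]
    by (intro bexI[of _ "u \<cdot>\<^sub>r of_real r + v"]) auto
qed

lemma axis_of_act: "f \<in> S \<Longrightarrow> null_pair u v \<Longrightarrow> act f ` axis_of u v = axis_of (f *\<^sub>v u) (f *\<^sub>v v)"
proof -
  assume f: "f \<in> S" and nv: "null_pair u v"
  have "act f (proj (u \<cdot>\<^sub>r of_real r + v)) = proj ((f *\<^sub>v u) \<cdot>\<^sub>r of_real r + f *\<^sub>v v)" for r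
    using f null_pairD(1,2)[OF nv] by (simp add: act_proj S_add S_rsmult)
  then show ?thesis unfolding axis_of_def by (force simp: image_iff)
qed

lemma axis_of_swap: assumes "null_pair u v" shows "axis_of u v = axis_of v u"
proof -
  have sub: "axis_of u v \<subseteq> axis_of v u" if nv: "null_pair u v" for u v
  proof
    fix p assume "p \<in> axis_of u v"
    then obtain r where r: "r > 0" "p = proj (u \<cdot>\<^sub>r of_real r + v)" by (auto simp: axis_of_def)
    have "(v \<cdot>\<^sub>r of_real (1 / r) + u) \<cdot>\<^sub>r of_real r = u \<cdot>\<^sub>r of_real r + v"
      using null_pairD(1,2)[OF nv] r(1) by (simp add: rsmult_add_vec[of _ "Suc n"] comm_add_vec[of _ "Suc n"] del: of_real_divide flip: of_real_mult)
    then have "p = proj (v \<cdot>\<^sub>r of_real (1 / r) + u)" using r proj_rsmult by (metis of_real_eq_0_iff less_irrefl)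
    then show "p \<in> axis_of v u" using r(1) unfolding axis_of_def by (intro CollectI exI[of _ "1 / r"]) simp
  qed
  show ?thesis using sub[OF assms] sub[OF null_pair_sym[OF assms]] by blast
qed

text \<open>Rescaling to \<open>p = u a\<close>, \<open>q = v b\<close> forces
  \<open>qcnj b * a = 1\<close>, so \<open>a\<close> is a positive real multiple of
  \<open>b\<close>; the common quaternionic factor disappears projectively and only the real
  parameter is rescaled.\<close>

lemma axis_of_proj_cong:
  assumes uv: "null_pair u v" and pq: "null_pair p q" and eq: "proj u = proj p" "proj v = proj q"
  shows "axis_of u v = axis_of p q"
proof -
  have sub: "axis_of p q \<subseteq> axis_of u v" if uv: "null_pair u v" and pq: "null_pair p q" and eq: "proj u = proj p" "proj v = proj q" for u v p q
  proof
    fix x assume "x \<in> axis_of p q"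
    then obtain r where r: "r > 0" "x = proj (p \<cdot>\<^sub>r of_real r + q)" by (auto simp: axis_of_def)
    obtain a b where ab: "a \<noteq> 0" "p = u \<cdot>\<^sub>r a" "b \<noteq> 0" "q = v \<cdot>\<^sub>r b" using eq proj_eq_iff by metis
    have "qcnj b * a = 1" using null_pairD[OF uv] null_pairD[OF pq] unfolding ab by (simp add: herm_lin)
    then have "b * (qcnj b * a) = b" by simp
    then have b: "of_real ((norm b)\<^sup>2) * a = b" by (simp only: qcnj_mult_self(2) flip: mult.assoc)
    have "(u \<cdot>\<^sub>r of_real (r / (norm b)\<^sup>2) + v) \<cdot>\<^sub>r b = p \<cdot>\<^sub>r of_real r + q"
    proof -
      have "of_real (r / (norm b)\<^sup>2) * b = of_real (r / (norm b)\<^sup>2) * (of_real ((norm b)\<^sup>2) * a)" unfolding b ..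
      also have "\<dots> = of_real r * a" using ab(3) by (simp del: of_real_divide of_real_power of_real_mult flip: mult.assoc of_real_mult)
      finally show ?thesis using null_pairD(1,2)[OF uv]
        by (simp add: rsmult_add_vec[of _ "Suc n"] ab of_real_quat_commute del: of_real_divide of_real_power)
    qed
    then have "x = proj (u \<cdot>\<^sub>r of_real (r / (norm b)\<^sup>2) + v)" using r(2) ab(3) proj_rsmult by metis
    then show "x \<in> axis_of u v" using r(1) ab(3) unfolding axis_of_def by (intro CollectI exI[of _ "r / (norm b)\<^sup>2"]) simp
  qed
  show ?thesis using sub[OF uv pq eq] sub[OF pq uv eq[symmetric]] by blast
qed

text \<open>The equality case of \<open>2 |H z u| |H z v| \<ge> - Q z\<close>.\<close>

lemma axis_of_I:
  assumes uv: "null_pair u v" and z: "z \<in> V" "Q z < 0" and eq: "2 * (norm (H z u) * norm (H z v)) = - Q z"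
  shows "proj z \<in> axis_of u v"
proof -
  note N = null_pairD[OF uv]
  define a b where "a = - H z v" and "b = - H z u"
  \<comment> \<open>Minus the projection of \<open>z\<close> to the plane of \<open>u\<close> and
    \<open>v\<close>, so that \<open>z + x\<close> is orthogonal to both; the hypothesis makes it
    null, hence zero.\<close>
  define x where "x = u \<cdot>\<^sub>r (- a) + v \<cdot>\<^sub>r (- b)"
  have xV: "x \<in> V" using N by (simp add: x_def)
  have ho: "H (z + x) u = 0" "H (z + x) v = 0" using z N by (simp_all add: x_def herm_lin a_def b_def)
  have Re: "qRe (qcnj a * b) = qRe (qcnj b * a)" by (simp add: quat_times_sel)
  have "qRe (H z x) = 2 * qRe (qcnj b * a)"
    using z N Re by (simp add: x_def herm_lin) (simp add: a_def b_def quat_times_sel)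
  moreover have "Q x = - 2 * qRe (qcnj b * a)"
    using N by (simp add: x_def Q_add Q_rsmult herm_lin)
  ultimately have Qw: "Q (z + x) = Q z + 2 * qRe (qcnj b * a)" using z xV by (simp add: Q_add)
  have nrm: "norm (qcnj b * a) = - Q z / 2" using eq by (simp add: norm_mult a_def b_def)
  have orth: "H (z + x) (u + v) = 0" using ho N by (simp add: herm_add_right)
  have neg: "Q (u + v) < 0" using N by (simp add: Q_add)
  have "Q (z + x) \<ge> 0" using orth_neg_nonneg[OF _ neg orth] z xV by simp
  then have R: "norm (qcnj b * a) = qRe (qcnj b * a)" using Qw nrm qRe_le_norm[of "qcnj b * a"] by simp
  then have "Q (z + x) = 0" using Qw nrm by simp
  then have "z + x = 0\<^sub>v (Suc n)" using orth_neg_imp_zero[OF _ neg orth] z xV by simp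
  then have zx: "z = u \<cdot>\<^sub>r a + v \<cdot>\<^sub>r b"
    using z(1) N(1,2) unfolding x_def by (auto simp: vec_eq_iff algebra_simps eq_neg_iff_add_eq_0)
  \<comment> \<open>\<open>qcnj b * a\<close> is now a positive real, so \<open>a\<close> is a
    positive multiple of \<open>b\<close> and \<open>z\<close> is a point of the axis times
    \<open>b\<close>.\<close>
  define m where "m = norm (qcnj b * a)"
  have m: "m > 0" "qcnj b * a = of_real m" using nrm z(2) qRe_eq_normD[OF R] by (simp_all add: m_def)
  then have b0: "b \<noteq> 0" by auto
  have "of_real ((norm b)\<^sup>2) * a = b * of_real m"
    unfolding qcnj_mult_self(2)[symmetric] mult.assoc m(2) ..
  then have "of_real (1 / (norm b)\<^sup>2) * (of_real ((norm b)\<^sup>2) * a) = of_real (1 / (norm b)\<^sup>2) * (of_real m * b)"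
    by (simp only: of_real_quat_commute)
  then have a: "a = of_real (m / (norm b)\<^sup>2) * b" using b0
    by (simp del: of_real_divide of_real_power of_real_mult flip: mult.assoc of_real_mult)
  have "z = (u \<cdot>\<^sub>r of_real (m / (norm b)\<^sup>2) + v) \<cdot>\<^sub>r b"
    using N(1,2) unfolding zx a by (simp add: rsmult_add_vec[of _ "Suc n"] del: of_real_divide)
  then have "proj z = proj (u \<cdot>\<^sub>r of_real (m / (norm b)\<^sup>2) + v)" using proj_rsmult b0 by metis
  then show ?thesis unfolding axis_of_def using m(1) b0 by (intro CollectI exI[of _ "m / (norm b)\<^sup>2"]) simp
qed

section \<open>A geodesic line between two ends is their explicit axis\<close>

lemma tendsto_qcnj: "(f \<longlongrightarrow> l) F \<Longrightarrow> ((\<lambda>x. qcnj (f x)) \<longlongrightarrow> qcnj l) F"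
  unfolding tendsto_iff dist_norm qcnj_simps(3)[symmetric] norm_qcnj .

lemma tendsto_herm:
  assumes "\<And>i. i < n + 1 \<Longrightarrow> ((\<lambda>t. f t $ i) \<longlongrightarrow> a $ i) F" "\<And>i. i < n + 1 \<Longrightarrow> ((\<lambda>t. g t $ i) \<longlongrightarrow> b $ i) F"
  shows "((\<lambda>t. H (f t) (g t)) \<longlongrightarrow> H a b) F"
  unfolding herm_def using n_pos
  by (intro tendsto_intros tendsto_qcnj assms) auto

lemma cosh_quotient_tendsto: "((\<lambda>s::real. (cosh s + cosh t) / (2 * cosh s)) \<longlongrightarrow> 1 / 2) at_top"
proof -
  have "((\<lambda>s::real. 1 / 2 + (cosh t / 2) * inverse (cosh s)) \<longlongrightarrow> 1 / 2 + (cosh t / 2) * 0) at_top"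
    by (intro tendsto_intros tendsto_inverse_0_at_top cosh_real_at_top)
  moreover have "(\<lambda>s::real. 1 / 2 + (cosh t / 2) * inverse (cosh s)) = (\<lambda>s. (cosh s + cosh t) / (2 * cosh s))"
    by (simp add: fun_eq_iff field_simps)
  ultimately show ?thesis by simp
qed

lemma cosh_mult_cosh: "cosh ((t + s) / 2) * cosh ((s - t) / 2) = (cosh s + cosh t) / 2" for s t :: real
proof -
  have "cosh s = cosh ((t + s) / 2 + (s - t) / 2)" "cosh t = cosh ((t + s) / 2 - (s - t) / 2)"
    by (simp_all add: field_simps)
  then show ?thesis by (simp add: cosh_add cosh_diff)
qed

text \<open>Compare \<open>z\<close> at time \<open>t\<close> with the points at times
  \<open>- s\<close> and \<open>s\<close>. The scales of their lifts cancel, and as \<open>s\<close>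
  grows the ratio of hyperbolic cosines tends to \<open>1 / 2\<close>. In the limit this is the
  equality case that characterises the axis.\<close>

lemma geodesic_subset_axis_of:
  assumes uv: "null_pair u v" and c: "\<And>t. c t \<in> hyp n" "\<And>s t. rho n (c s) (c t) = \<bar>s - t\<bar>"
    "proj_tendsto n c (proj u) at_bot" "proj_tendsto n c (proj v) at_top"
  shows "c t \<in> axis_of u v"
proof -
  obtain z where z: "z \<in> V" "Q z = -1" "c t = proj z" using c(1) hyp_lift by metis
  have zc: "z \<in> c t" using z self_in_proj by simp
  obtain u' \<zeta> where u': "u' \<in> proj u" "\<And>t. \<zeta> t \<in> c t" "\<And>i. i < n + 1 \<Longrightarrow> ((\<lambda>t. \<zeta> t $ i) \<longlongrightarrow> u' $ i) at_bot"
    using c(3) unfolding proj_tendsto_def by blast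
  obtain v' \<xi> where v': "v' \<in> proj v" "\<And>t. \<xi> t \<in> c t" "\<And>i. i < n + 1 \<Longrightarrow> ((\<lambda>t. \<xi> t $ i) \<longlongrightarrow> v' $ i) at_top"
    using c(4) unfolding proj_tendsto_def by blast
  have lim: "((\<lambda>s. \<zeta> (- s) $ i) \<longlongrightarrow> u' $ i) at_top" if "i < n + 1" for i
    using filterlim_compose[OF u'(3)[OF that] filterlim_uminus_at_bot_at_top] .
  \<comment> \<open>The unknown factors \<open>sqrt (- Q _)\<close> are eliminated through the
    product of the two far points with each other, at distance \<open>2 |s|\<close>.\<close>
  have id: "norm (H z (\<zeta> (- s))) * norm (H z (\<xi> s)) = (cosh s + cosh t) / (2 * cosh s) * norm (H (\<zeta> (- s)) (\<xi> s))" for s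
  proof -
    have "norm (H z (\<zeta> (- s))) * norm (H z (\<xi> s))
        = (cosh (\<bar>t + s\<bar> / 2) * cosh (\<bar>t - s\<bar> / 2)) * (sqrt (- Q (\<zeta> (- s))) * sqrt (- Q (\<xi> s)))"
      using rho_lift(1)[OF c(1) c(1) zc u'(2)[of "- s"]] rho_lift(1)[OF c(1) c(1) zc v'(2)[of s]] z(2) c(2) by simp
    also have "cosh (\<bar>t + s\<bar> / 2) * cosh (\<bar>t - s\<bar> / 2) = cosh ((t + s) / 2) * cosh ((s - t) / 2)"
      by (metis abs_divide abs_minus_commute abs_numeral cosh_real_abs)
    also have "\<dots> = (cosh s + cosh t) / 2" by (rule cosh_mult_cosh)
    also have "sqrt (- Q (\<zeta> (- s))) * sqrt (- Q (\<xi> s)) = norm (H (\<zeta> (- s)) (\<xi> s)) / cosh s"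
      using rho_lift(1)[OF c(1) c(1) u'(2)[of "- s"] v'(2)[of s]] c(2)[of "- s" s]
      by (simp add: abs_mult)
    finally show ?thesis by simp
  qed
  have "((\<lambda>s. norm (H z (\<zeta> (- s))) * norm (H z (\<xi> s))) \<longlongrightarrow> norm (H z u') * norm (H z v')) at_top"
    by (intro tendsto_mult tendsto_norm tendsto_herm tendsto_const lim v'(3))
  moreover have "((\<lambda>s. (cosh s + cosh t) / (2 * cosh s) * norm (H (\<zeta> (- s)) (\<xi> s))) \<longlongrightarrow> 1 / 2 * norm (H u' v')) at_top"
    by (intro tendsto_mult tendsto_norm tendsto_herm cosh_quotient_tendsto lim v'(3))
  ultimately have lim_eq: "norm (H z u') * norm (H z v') = 1 / 2 * norm (H u' v')"
    unfolding id using tendsto_unique trivial_limit_at_top_linorder by blast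
  obtain a b where ab: "a \<noteq> 0" "u' = u \<cdot>\<^sub>r a" "b \<noteq> 0" "v' = v \<cdot>\<^sub>r b" using u'(1) v'(1) unfolding proj_eq by blast
  have "(norm a * norm b) * (2 * (norm (H z u) * norm (H z v))) = (norm a * norm b) * 1"
    using lim_eq null_pairD[OF uv] unfolding ab by (simp add: herm_lin norm_mult algebra_simps)
  then have "2 * (norm (H z u) * norm (H z v)) = - Q z" using ab(1,3) z(2) by simp
  then show ?thesis using axis_of_I[OF uv z(1)] z by simp
qed

lemma real_isometry_surj:
  fixes f :: "real \<Rightarrow> real"
  assumes "\<And>s t. \<bar>f s - f t\<bar> = \<bar>s - t\<bar>"
  shows "\<exists>t. f t = y"
proof -
  define d where "d = y - f 0"
  have "f d = y \<or> f (- d) = y"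
    using assms[of d 0] assms[of "- d" 0] assms[of d "- d"] unfolding d_def by linarith
  then show ?thesis by blast
qed

text \<open>The logarithm of the parameter is arc length along the axis.\<close>

lemma rho_axis_of:
  assumes uv: "null_pair u v" and "r > 0" "s > 0"
  shows "rho n (proj (u \<cdot>\<^sub>r of_real r + v)) (proj (u \<cdot>\<^sub>r of_real s + v)) = \<bar>ln r - ln s\<bar>"
proof -
  note N = null_pairD[OF uv]
  define z where "z r = (u \<cdot>\<^sub>r of_real r + v) \<cdot>\<^sub>r of_real (1 / sqrt (2 * r))" for r
  have zV: "z r \<in> V" and Qz: "Q (z r) = -1" and pz: "proj (z r) = proj (u \<cdot>\<^sub>r of_real r + v)" if "r > 0" for r
    using N that Q_axis_of[OF uv] by (simp_all add: z_def Q_rsmult proj_rsmult power_divide del: of_real_divide)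
  have "H (u \<cdot>\<^sub>r of_real r + v) (u \<cdot>\<^sub>r of_real s + v) = of_real (- (r + s))"
    using N by (simp add: herm_lin)
  then have "norm (H (u \<cdot>\<^sub>r of_real r + v) (u \<cdot>\<^sub>r of_real s + v)) = \<bar>- (r + s)\<bar>"
    by (simp only: norm_of_real)
  then have nH: "norm (H (u \<cdot>\<^sub>r of_real r + v) (u \<cdot>\<^sub>r of_real s + v)) = r + s"
    using assms(2,3) by simp
  have "H (z r) (z s) = qcnj (of_real (1 / sqrt (2 * s))) * (H (u \<cdot>\<^sub>r of_real r + v) (u \<cdot>\<^sub>r of_real s + v) * of_real (1 / sqrt (2 * r)))"
    unfolding z_def using N by (simp only: herm_rsmult_left herm_rsmult_right rsmult_carrier add_carrier_vec mult.assoc)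
  then have "norm (H (z r) (z s)) = (r + s) / (sqrt (2 * r) * sqrt (2 * s))"
    using assms(2,3) nH by (simp add: norm_mult del: of_real_divide)
  also have "\<dots> = cosh (\<bar>ln r - ln s\<bar> / 2)"
  proof -
    have "\<bar>ln r - ln s\<bar> / 2 = \<bar>ln (sqrt (r / s))\<bar>"
      using assms(2,3) by (simp add: ln_sqrt ln_div)
    then have "cosh (\<bar>ln r - ln s\<bar> / 2) = cosh (ln (sqrt (r / s)))"
      by (simp only: cosh_real_abs)
    also have "\<dots> = (sqrt (r / s) + inverse (sqrt (r / s))) / 2"
      using assms(2,3) by (intro cosh_ln_real) simp
    also have "\<dots> = (r + s) / (2 * (sqrt r * sqrt s))"
      using assms(2,3) by (simp add: real_sqrt_divide field_simps)
    also have "\<dots> = (r + s) / (sqrt (2 * r) * sqrt (2 * s))"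
      by (simp add: real_sqrt_mult)
    finally show ?thesis ..
  qed
  finally show ?thesis using rho_eqI[OF zV zV Qz Qz] assms(2,3) pz by (metis abs_ge_zero)
qed

text \<open>In the logarithmic parameter the line becomes an isometric map from the reals to the
  reals, which is onto; so the whole axis is covered.\<close>

lemma geodesic_eq_axis_of:
  assumes uv: "null_pair u v" and g: "geodesic_joining n (proj u) (proj v) \<gamma>"
  shows "\<gamma> = axis_of u v"
proof -
  obtain c where c: "\<And>t. c t \<in> hyp n" "\<And>s t. rho n (c s) (c t) = \<bar>s - t\<bar>"
    "proj_tendsto n c (proj u) at_bot" "proj_tendsto n c (proj v) at_top" and \<gamma>: "\<gamma> = range c"
    using g unfolding geodesic_joining_def by blast
  have "\<forall>t. \<exists>r. r > 0 \<and> c t = proj (u \<cdot>\<^sub>r of_real r + v)"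
    using geodesic_subset_axis_of[OF uv c] unfolding axis_of_def by blast
  then obtain r where r: "\<And>t. r t > 0" "\<And>t. c t = proj (u \<cdot>\<^sub>r of_real (r t) + v)" by metis
  have iso: "\<bar>ln (r s) - ln (r t)\<bar> = \<bar>s - t\<bar>" for s t
    using c(2)[of s t] rho_axis_of[OF uv r(1) r(1)] r(2) by simp
  have "proj (u \<cdot>\<^sub>r of_real x + v) \<in> range c" if "x > 0" for x
  proof -
    obtain t where "ln (r t) = ln x" using real_isometry_surj[of "\<lambda>t. ln (r t)", OF iso] by blast
    then have "r t = x" using r(1) that by simp
    then show ?thesis using r(2) by (metis rangeI)
  qed
  then show ?thesis using geodesic_subset_axis_of[OF uv c] unfolding \<gamma> axis_of_def by blast
qed

section \<open>Cross ratios of two geodesics\<close>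

text \<open>The parallelogram law, applied twice.\<close>

lemma norm_sum_signs:
  "(norm ((a + b) + (c + d)))\<^sup>2 + (norm ((a + b) - (c + d)))\<^sup>2 + (norm ((a - b) - (c - d)))\<^sup>2 + (norm ((a - b) + (c - d)))\<^sup>2
    = 4 * ((norm a)\<^sup>2 + (norm b)\<^sup>2 + (norm c)\<^sup>2 + (norm (d :: quat))\<^sup>2)"
  unfolding norm_quat_sq by (simp add: power2_eq_square algebra_simps)

text \<open>\<open>Z\<close>, \<open>W\<close> lift one point on each axis and \<open>X\<close>,
  \<open>Y\<close> are the tangent directions there. Their four mutual products are the signed sums
  of the four \<open>H\<close> values. Cauchy-Schwarz bounds the squares by \<open>K\<close>,
  \<open>K\<close>, \<open>K - 4\<close>, \<open>K - 4\<close>, and the inequality of arithmetic and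
  geometric means turns the sum of squares into the two cross ratios.\<close>

lemma cross_ratio_dist_aux:
  assumes uv: "null_pair u v" and pq: "null_pair p q"
  shows "norm (H p v) * norm (H q u) + norm (H p u) * norm (H q v) \<le> (norm (H (u + v) (p + q)))\<^sup>2 / 2 - 1"
proof -
  note N = null_pairD[OF uv] null_pairD[OF pq]
  define Z X W Y where "Z = u + v" and "X = u + v \<cdot>\<^sub>r (-1)" and "W = p + q" and "Y = p + q \<cdot>\<^sub>r (-1)"
  have V: "Z \<in> V" "X \<in> V" "W \<in> V" "Y \<in> V" using N by (simp_all add: Z_def X_def W_def Y_def)
  have QZ: "Q Z = -2" "Q W = -2" "Q X = 2" "Q Y = 2"
    using N by (simp_all add: Z_def X_def W_def Y_def Q_add Q_rsmult herm_lin)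
  have XZ: "H X Z = 0" "H Y W = 0" using N by (simp_all add: Z_def X_def W_def Y_def herm_lin)
  have proj: "H (x + z \<cdot>\<^sub>r ((1/2) *\<^sub>R H x z)) z = 0" "Q (x + z \<cdot>\<^sub>r ((1/2) *\<^sub>R H x z)) = Q x + (norm (H x z))\<^sup>2 / 2"
    if "x \<in> V" "z \<in> V" "Q z = -2" for x z
  proof -
    have "H z z = of_real (-2)" using herm_self[of z] that by simp
    then have "H z z * ((1/2) *\<^sub>R H x z) = - H x z" by (simp add: quat_eq_iff quat_times_sel)
    then show "H (x + z \<cdot>\<^sub>r ((1/2) *\<^sub>R H x z)) z = 0" using that by (simp add: herm_lin)
    have "qcnj ((1/2) *\<^sub>R H x z) * H x z = of_real ((norm (H x z))\<^sup>2 / 2)"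
    proof -
      have "qcnj ((1/2) *\<^sub>R H x z) = (1/2) *\<^sub>R qcnj (H x z)" by (simp add: quat_eq_iff)
      then have "qcnj ((1/2) *\<^sub>R H x z) * H x z = (1/2) *\<^sub>R of_real ((norm (H x z))\<^sup>2)"
        by (simp only: mult_scaleR_left qcnj_mult_self)
      also have "\<dots> = of_real ((norm (H x z))\<^sup>2 / 2)" 
        by (simp add: quat_eq_iff del: of_real_divide flip: of_real_power)
      finally show ?thesis .
    qed
    then have "qRe (H x (z \<cdot>\<^sub>r ((1/2) *\<^sub>R H x z))) = (norm (H x z))\<^sup>2 / 2"
      using that by (simp only: herm_lin of_real_quat_sel)
    then show "Q (x + z \<cdot>\<^sub>r ((1/2) *\<^sub>R H x z)) = Q x + (norm (H x z))\<^sup>2 / 2"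
      using that by (simp add: Q_add Q_rsmult power_mult_distrib power2_eq_square)
  qed
  \<comment> \<open>Only \<open>y\<close> is orthogonal to \<open>z\<close>; projecting
    \<open>x\<close> does not change its product with \<open>y\<close>, at the cost of the extra
    term in \<open>Q\<close>.\<close>
  have cs: "(norm (H x y))\<^sup>2 \<le> (Q x + (norm (H x z))\<^sup>2 / 2) * Q y" if "x \<in> V" "y \<in> V" "z \<in> V" "Q z = -2" "H y z = 0" for x y z
  proof -
    have "H z y = 0" using that(5) herm_eq_0_sym by simp
    then have "H (x + z \<cdot>\<^sub>r ((1/2) *\<^sub>R H x z)) y = H x y" using that by (simp add: herm_lin)
    then show ?thesis
      using cauchy_schwarz_orth_neg[of "x + z \<cdot>\<^sub>r ((1/2) *\<^sub>R H x z)" y z] that proj[OF that(1,3,4)] by simp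
  qed
  define K where "K = (norm (H Z W))\<^sup>2"
  have K': "(norm (H W Z))\<^sup>2 = K" by (simp add: K_def norm_herm_sym[of W Z])
  have 1: "(norm (H W X))\<^sup>2 \<le> K - 4" using cs[OF V(3) V(2) V(1) QZ(1) XZ(1)] QZ K' by simp
  have 2: "(norm (H Z Y))\<^sup>2 \<le> K - 4" using cs[OF V(1) V(4) V(3) QZ(2) XZ(2)] QZ K_def by simp
  have 3: "(norm (H Y X))\<^sup>2 \<le> K"
    using cs[OF V(4) V(2) V(1) QZ(1) XZ(1)] QZ 2 norm_herm_sym[of Y Z] by simp
  have bilin: "H W Z = (H p u + H q v) + (H p v + H q u)" "H Y X = (H p u + H q v) - (H p v + H q u)"
    "H W X = (H p u - H q v) - (H p v - H q u)" "H Y Z = (H p u - H q v) + (H p v - H q u)"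
    using N by (simp_all add: Z_def X_def W_def Y_def herm_lin algebra_simps)
  have "(norm (H W Z))\<^sup>2 + (norm (H Y X))\<^sup>2 + (norm (H W X))\<^sup>2 + (norm (H Y Z))\<^sup>2
      = 4 * ((norm (H p u))\<^sup>2 + (norm (H q v))\<^sup>2 + (norm (H p v))\<^sup>2 + (norm (H q u))\<^sup>2)"
    unfolding bilin by (rule norm_sum_signs)
  moreover have "2 * (norm (H p u) * norm (H q v)) \<le> (norm (H p u))\<^sup>2 + (norm (H q v))\<^sup>2"
    "2 * (norm (H p v) * norm (H q u)) \<le> (norm (H p v))\<^sup>2 + (norm (H q u))\<^sup>2"
    using sum_squares_bound[of "norm (H p u)"] sum_squares_bound[of "norm (H p v)"] by (simp_all add: mult.assoc)
  moreover have "(norm (H Y Z))\<^sup>2 \<le> K - 4" using 2 norm_herm_sym[of Y Z] by simp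
  ultimately have "norm (H p v) * norm (H q u) + norm (H p u) * norm (H q v) \<le> K / 2 - 1"
    using 1 3 K' by argo
  then show ?thesis by (simp only: K_def Z_def W_def)
qed

text \<open>Scaling the lifts by \<open>sqrt r\<close> and \<open>1 / sqrt r\<close> moves the
  chosen point to parameter one and keeps the cross ratios. Then
  \<open>K = 4 (cosh (rho / 2))^2\<close>, and the double angle formula finishes.\<close>

lemma cross_ratio_le_cosh_rho:
  assumes uv: "null_pair u v" and pq: "null_pair p q" and x: "x \<in> axis_of u v" and y: "y \<in> axis_of p q"
  shows "norm (H p v) * norm (H q u) + norm (H p u) * norm (H q v) \<le> cosh (rho n x y)"
proof -
  obtain r where r: "r > 0" "x = proj (u \<cdot>\<^sub>r of_real r + v)" using x by (auto simp: axis_of_def)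
  obtain s where s: "s > 0" "y = proj (p \<cdot>\<^sub>r of_real s + q)" using y by (auto simp: axis_of_def)
  have scale: "null_pair (u \<cdot>\<^sub>r of_real (sqrt r)) (v \<cdot>\<^sub>r of_real (1 / sqrt r))"
    "proj (u \<cdot>\<^sub>r of_real r + v) = proj (u \<cdot>\<^sub>r of_real (sqrt r) + v \<cdot>\<^sub>r of_real (1 / sqrt r))" if "null_pair u v" "r > 0" for u v r
  proof -
    note N = null_pairD[OF that(1)]
    show "null_pair (u \<cdot>\<^sub>r of_real (sqrt r)) (v \<cdot>\<^sub>r of_real (1 / sqrt r))"
      using N that(2) by (simp add: null_pair_def Q_rsmult herm_lin del: of_real_divide of_real_mult flip: of_real_mult)
    have "(u \<cdot>\<^sub>r of_real r + v) \<cdot>\<^sub>r of_real (1 / sqrt r) = u \<cdot>\<^sub>r of_real (sqrt r) + v \<cdot>\<^sub>r of_real (1 / sqrt r)"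
      using N(1,2) that(2) by (simp add: rsmult_add_vec[of _ "Suc n"] real_div_sqrt del: of_real_divide of_real_mult flip: of_real_mult)
    then show "proj (u \<cdot>\<^sub>r of_real r + v) = proj (u \<cdot>\<^sub>r of_real (sqrt r) + v \<cdot>\<^sub>r of_real (1 / sqrt r))"
      using proj_rsmult[of "of_real (1 / sqrt r)" "u \<cdot>\<^sub>r of_real r + v"] that(2)
      by (simp del: of_real_divide)
  qed
  define u1 v1 where "u1 = u \<cdot>\<^sub>r of_real (sqrt r)" and "v1 = v \<cdot>\<^sub>r of_real (1 / sqrt r)"
  define p1 q1 where "p1 = p \<cdot>\<^sub>r of_real (sqrt s)" and "q1 = q \<cdot>\<^sub>r of_real (1 / sqrt s)"
  have n1: "null_pair u1 v1" "null_pair p1 q1" and xy: "x = proj (u1 + v1)" "y = proj (p1 + q1)"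
    using scale[OF uv r(1)] scale[OF pq s(1)] r(2) s(2) by (simp_all add: u1_def v1_def p1_def q1_def)
  have QZ: "Q (u1 + v1) = -2" "Q (p1 + q1) = -2"
    using null_pairD[OF n1(1)] null_pairD[OF n1(2)] by (simp_all add: Q_add)
  have V: "u1 + v1 \<in> V" "p1 + q1 \<in> V" using null_pairD[OF n1(1)] null_pairD[OF n1(2)] by auto
  have "x \<in> hyp n" "y \<in> hyp n" using V QZ unfolding xy hyp_iff by force+
  then have nz: "norm (H (u1 + v1) (p1 + q1)) = cosh (rho n x y / 2) * 2"
    using rho_lift(1)[of x y "u1 + v1" "p1 + q1"] self_in_proj QZ unfolding xy by simp
  have "norm (H p v) * norm (H q u) + norm (H p u) * norm (H q v)
      = norm (H p1 v1) * norm (H q1 u1) + norm (H p1 u1) * norm (H q1 v1)"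
    using null_pairD[OF uv] null_pairD[OF pq] r(1) s(1) unfolding u1_def v1_def p1_def q1_def
    by (simp add: herm_lin norm_mult del: of_real_divide)
  also have "\<dots> \<le> 2 * (cosh (rho n x y / 2))\<^sup>2 - 1"
    using cross_ratio_dist_aux[OF n1] unfolding nz by (simp add: power_mult_distrib)
  also have "\<dots> = cosh (rho n x y)"
    using cosh_double_cosh[of "rho n x y / 2"] by simp
  finally show ?thesis .
qed

text \<open>The Ptolemaic inequality for four null vectors; the third term bounds the Hermitian product of the
  components orthogonal to \<open>u\<close> and \<open>v\<close>.\<close>

lemma ptolemy_aux:
  assumes uv: "null_pair u v" and p: "p \<in> V" "Q p = 0" and q: "q \<in> V" "Q q = 0"
  shows "norm (H p q) \<le> (sqrt (norm (H p v) * norm (H q u)) + sqrt (norm (H p u) * norm (H q v)))\<^sup>2"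
proof -
  note N = null_pairD[OF uv]
  define A B where "A = sqrt (norm (H p v) * norm (H q u))" and "B = sqrt (norm (H p u) * norm (H q v))"
  \<comment> \<open>The component of \<open>x\<close> orthogonal to \<open>u\<close> and
    \<open>v\<close>.\<close>
  define w where "w x = x + (u \<cdot>\<^sub>r H x v + v \<cdot>\<^sub>r H x u)" for x
  have wV: "w x \<in> V" if "x \<in> V" for x using that N by (simp add: w_def)
  have wo: "H (w x) u = 0" "H (w x) v = 0" if "x \<in> V" for x using that N by (simp_all add: w_def herm_lin)
  then have wZ: "H (w x) (u + v) = 0" if "x \<in> V" for x using that N wV by (simp add: herm_lin)
  have Z: "Q (u + v) < 0" using N by (simp add: Q_add)
  have hw: "H (w x) (w y) = H x y + (qcnj (H y u) * H x v + qcnj (H y v) * H x u)" if "x \<in> V" "y \<in> V" for x y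
  proof -
    have "H (w x) (w y) = H (w x) y + H (w x) (u \<cdot>\<^sub>r H y v + v \<cdot>\<^sub>r H y u)"
      unfolding w_def[of y] using that N wV by (simp add: herm_add_right)
    also have "H (w x) (u \<cdot>\<^sub>r H y v + v \<cdot>\<^sub>r H y u) = 0" using that N wV wo by (simp add: herm_lin)
    finally show ?thesis using that N by (simp add: w_def herm_lin qcnj_herm)
  qed
  have Qw: "Q (w x) \<le> 2 * (norm (H x u) * norm (H x v))" if "x \<in> V" "Q x = 0" for x
  proof -
    have "H x x = 0" using herm_self[of x] that(2) by simp
    then have "Q (w x) = qRe (qcnj (H x u) * H x v + qcnj (H x v) * H x u)"
      unfolding Q_def hw[OF that(1,1)] by simp
    also have "\<dots> \<le> norm (qcnj (H x u) * H x v) + norm (qcnj (H x v) * H x u)"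
      using qRe_le_norm[of "qcnj (H x u) * H x v"] qRe_le_norm[of "qcnj (H x v) * H x u"] by simp
    finally show ?thesis by (simp add: norm_mult mult.commute)
  qed
  have Q0: "Q (w x) \<ge> 0" if "x \<in> V" for x using orth_neg_nonneg[OF wV[OF that] Z wZ[OF that]] .
  have "(norm (H (w p) (w q)))\<^sup>2 \<le> Q (w p) * Q (w q)"
    using cauchy_schwarz_orth_neg[OF wV wV Z wZ wZ] p q by blast
  also have "\<dots> \<le> (2 * (norm (H p u) * norm (H p v))) * (2 * (norm (H q u) * norm (H q v)))"
    using Qw Q0 p q by (intro mult_mono) auto
  also have "\<dots> = (2 * (A * B))\<^sup>2"
    by (simp add: A_def B_def power_mult_distrib algebra_simps)
  finally have le: "norm (H (w p) (w q)) \<le> 2 * (A * B)" by (rule power2_le_imp_le) (simp add: A_def B_def)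
  have "H p q = H (w p) (w q) - (qcnj (H q u) * H p v + qcnj (H q v) * H p u)"
    using hw[of p q] p q by simp
  then have "norm (H p q) \<le> norm (H (w p) (w q)) + (norm (qcnj (H q u) * H p v) + norm (qcnj (H q v) * H p u))"
    by (metis norm_triangle_ineq4 norm_triangle_ineq add_left_mono order_trans)
  also have "\<dots> \<le> 2 * (A * B) + (A\<^sup>2 + B\<^sup>2)"
    using le by (simp add: norm_mult A_def B_def mult.commute)
  also have "\<dots> = (A + B)\<^sup>2" by (simp add: power2_eq_square algebra_simps)
  finally show ?thesis by (simp add: A_def B_def)
qed

text \<open>The auxiliary inequality with reference pair \<open>u\<close> and rescaled
  \<open>q\<close>, applied to the points \<open>p\<close> and \<open>v\<close>: then
  \<open>H p q\<close> and \<open>H v u\<close> have modulus one, and these account for the summand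
  \<open>1\<close>.\<close>

lemma ptolemy:
  assumes uv: "null_pair u v" and pq: "null_pair p q"
  shows "sqrt (norm (H p v) * norm (H q u)) \<le> 1 + sqrt (norm (H p u) * norm (H q v))"
proof (cases "H u q = 0")
  case True
  then show ?thesis using herm_eq_0_sym[of q u] by simp
next
  case False
  note N = null_pairD[OF uv] null_pairD[OF pq]
  define s where "s = norm (H u q)"
  have s: "s > 0" "norm (H q u) = s" using False norm_herm_sym[of q u] by (simp_all add: s_def)
  define t where "t = qcnj (- inverse (H u q))"
  have t: "t \<noteq> 0" "norm t = 1 / s" using False by (simp_all add: t_def s_def norm_inverse divide_inverse)
  have np: "null_pair u (q \<cdot>\<^sub>r t)" using N False by (simp add: null_pair_def Q_rsmult herm_lin t_def)
  have nt: "norm (H x (q \<cdot>\<^sub>r t)) = norm (H x q) / s" for x using N t by (simp add: herm_lin norm_mult)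
  have "norm (H p v) \<le> (sqrt (norm (H p (q \<cdot>\<^sub>r t)) * norm (H v u)) + sqrt (norm (H p u) * norm (H v (q \<cdot>\<^sub>r t))))\<^sup>2"
    using ptolemy_aux[OF np] N by blast
  also have "\<dots> = ((1 + sqrt (norm (H p u) * norm (H q v))) / sqrt s)\<^sup>2"
    unfolding nt using N norm_herm_sym[of v q] by (simp add: real_sqrt_divide add_divide_distrib)
  also have "\<dots> = (1 + sqrt (norm (H p u) * norm (H q v)))\<^sup>2 / s"
    using s(1) by (simp add: power_divide)
  finally have "norm (H p v) * norm (H q u) \<le> (1 + sqrt (norm (H p u) * norm (H q v)))\<^sup>2"
    using s by (simp add: field_simps)
  then show ?thesis by (intro real_le_lsqrt) auto
qed

end

section \<open>Discreteness\<close>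

text \<open>Pigeonhole principle on a grid of mesh \<open>\<epsilon> / 4\<close> in the space of matrix entries.\<close>

lemma bounded_matrices_close:
  fixes f :: "nat \<Rightarrow> quat mat"
  assumes bnd: "\<And>k i j. i \<le> n \<Longrightarrow> j \<le> n \<Longrightarrow> norm (f k $$ (i, j)) \<le> K" and "\<epsilon> > 0"
  obtains a b where "a < b" "\<And>i j. i \<le> n \<Longrightarrow> j \<le> n \<Longrightarrow> norm (f a $$ (i, j) - f b $$ (i, j)) < \<epsilon>"
proof -
  define comp :: "nat \<Rightarrow> quat \<Rightarrow> real" where
    "comp c = (if c = 0 then qRe else if c = 1 then qI else if c = 2 then qJ else qK)" for c
  have comp: "\<bar>comp c q\<bar> \<le> norm q" for c q
    unfolding comp_def norm_quat_def by (auto intro!: real_le_rsqrt)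
  define \<eta> where "\<eta> = \<epsilon> / 4"
  have \<eta>: "\<eta> > 0" using assms(2) by (simp add: \<eta>_def)
  define I where "I = {..n} \<times> {..n} \<times> {..<4::nat}"
  define B where "B = {\<lfloor>- K / \<eta>\<rfloor>..\<lfloor>K / \<eta>\<rfloor>}"
  define code where "code k = restrict (\<lambda>(i, j, c). \<lfloor>comp c (f k $$ (i, j)) / \<eta>\<rfloor>) I" for k
  have "code k \<in> I \<rightarrow>\<^sub>E B" for k
  proof (rule PiE_I)
    fix x assume x: "x \<in> I"
    obtain i j c where ijc: "x = (i, j, c)" by (cases x)
    have "\<bar>comp c (f k $$ (i, j))\<bar> \<le> K" using x comp[of c "f k $$ (i, j)"] bnd[of i j k] ijc by (force simp: I_def)
    then have "- K / \<eta> \<le> comp c (f k $$ (i, j)) / \<eta>" "comp c (f k $$ (i, j)) / \<eta> \<le> K / \<eta>"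
      using \<eta> by (intro divide_right_mono; simp)+
    then show "code k x \<in> B" using x unfolding code_def B_def ijc
      by (simp add: floor_mono)
  qed (simp add: code_def)
  then have "range code \<subseteq> I \<rightarrow>\<^sub>E B" by blast
  moreover have "finite (I \<rightarrow>\<^sub>E B)" by (intro finite_PiE) (auto simp: I_def B_def)
  ultimately have "finite (range code)" by (rule finite_subset)
  then have "\<not> inj code" using finite_imageD infinite_UNIV_nat by blast
  then obtain a' b' where "a' \<noteq> b'" "code a' = code b'" unfolding inj_def by blast
  then obtain a b where ab: "a < b" "code a = code b" by (metis linorder_neqE_nat)
  have "norm (f a $$ (i, j) - f b $$ (i, j)) < \<epsilon>" if ij: "i \<le> n" "j \<le> n" for i j
  proof -
    have cl: "\<bar>comp c (f a $$ (i, j)) - comp c (f b $$ (i, j))\<bar> < \<eta>" if c: "c < 4" for c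
    proof -
      have "(i, j, c) \<in> I" using ij c by (simp add: I_def)
      then have "\<lfloor>comp c (f a $$ (i, j)) / \<eta>\<rfloor> = \<lfloor>comp c (f b $$ (i, j)) / \<eta>\<rfloor>"
        using fun_cong[OF ab(2), of "(i, j, c)"] by (simp add: code_def)
      then have "\<bar>comp c (f a $$ (i, j)) / \<eta> - comp c (f b $$ (i, j)) / \<eta>\<bar> < 1" by linarith
      then show ?thesis using \<eta> by (simp add: abs_less_iff field_simps)
    qed
    define q where "q = f a $$ (i, j) - f b $$ (i, j)"
    have "\<bar>qRe q\<bar> < \<eta>" "\<bar>qI q\<bar> < \<eta>" "\<bar>qJ q\<bar> < \<eta>" "\<bar>qK q\<bar> < \<eta>"
      using cl[of 0] cl[of 1] cl[of 2] cl[of 3] by (simp_all add: comp_def q_def)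
    moreover have "(norm q)\<^sup>2 \<le> (\<bar>qRe q\<bar> + \<bar>qI q\<bar> + \<bar>qJ q\<bar> + \<bar>qK q\<bar>)\<^sup>2"
      unfolding norm_quat_sq by (simp add: power2_eq_square algebra_simps)
    then have "norm q \<le> \<bar>qRe q\<bar> + \<bar>qI q\<bar> + \<bar>qJ q\<bar> + \<bar>qK q\<bar>" by (rule power2_le_imp_le) simp
    ultimately show ?thesis unfolding q_def[symmetric] \<eta>_def by linarith
  qed
  then show ?thesis using that ab(1) by blast
qed

text \<open>Used with \<open>p\<close>, \<open>p'\<close> powers of \<open>g\<close>: two coinciding
  conjugates of \<open>f\<close> make \<open>f\<close> commute with the quotient of the two
  powers.\<close>

lemma (in group) conj_eq_imp_commute:
  assumes [simp]: "p \<in> carrier G" "p' \<in> carrier G" "f \<in> carrier G"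
    and eq: "inv p' \<otimes> f \<otimes> p' = inv (p \<otimes> p') \<otimes> f \<otimes> (p \<otimes> p')"
  shows "p \<otimes> f = f \<otimes> p"
proof -
  have "inv p' \<otimes> (f \<otimes> p') = inv p' \<otimes> ((inv p \<otimes> (f \<otimes> p)) \<otimes> p')"
    using eq by (simp add: inv_mult_group m_assoc del: Units_l_cancel)
  then have "f \<otimes> p' = (inv p \<otimes> (f \<otimes> p)) \<otimes> p'" by simp
  then have "f = inv p \<otimes> (f \<otimes> p)" by (subst (asm) right_cancel) simp_all
  then show ?thesis using inv_solve_left[of f p "f \<otimes> p"] by simp
qed

lemma (in group) commute_if_inv_commute:
  assumes [simp]: "q \<in> carrier G" "f \<in> carrier G" and eq: "inv q \<otimes> f = f \<otimes> inv q"
  shows "q \<otimes> f = f \<otimes> q"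
proof -
  have "f = q \<otimes> (f \<otimes> inv q)" using inv_solve_left'[of "f \<otimes> inv q" q f] eq by simp
  then have "f = (q \<otimes> f) \<otimes> inv q" by (simp add: m_assoc)
  then show ?thesis using inv_solve_right[of f "q \<otimes> f" q] by simp
qed

lemma (in group) conj_conj_inv:
  assumes [simp]: "p \<in> carrier G" "f \<in> carrier G"
  shows "p \<otimes> (inv p \<otimes> f \<otimes> p) \<otimes> inv p = f"
proof -
  have "p \<otimes> (inv p \<otimes> f \<otimes> p) = f \<otimes> p"
    using inv_solve_left[of "inv p \<otimes> (f \<otimes> p)" p "f \<otimes> p"] by (simp add: m_assoc)
  then show ?thesis by (simp add: m_assoc)
qed

context herm_space
begin

section \<open>Bounded sequences in a discrete group repeat\<close>

definition entries_le :: "real \<Rightarrow> quat mat \<Rightarrow> bool" where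
  "entries_le K A \<longleftrightarrow> (\<forall>i\<le>n. \<forall>j\<le>n. norm (A $$ (i, j)) \<le> K)"

lemma mat_mult_index_sum:
  assumes "A \<in> M" "B \<in> M" "i \<le> n" "j \<le> n"
  shows "(A * B) $$ (i, j) = (\<Sum>k<Suc n. A $$ (i, k) * B $$ (k, j))"
  using assms by (auto simp: scalar_prod_def lessThan_atLeast0 simp del: sum.lessThan_Suc sum.op_ivl_Suc intro!: sum.cong)

lemma entries_le_mult:
  assumes "A \<in> M" "B \<in> M" "entries_le K A" "entries_le L B" "K \<ge> 0" "L \<ge> 0"
  shows "entries_le (real (Suc n) * (K * L)) (A * B)"
  unfolding entries_le_def
proof (intro allI impI)
  fix i j assume ij: "i \<le> n" "j \<le> n"
  have "norm ((A * B) $$ (i, j)) \<le> (\<Sum>k<Suc n. norm (A $$ (i, k) * B $$ (k, j)))"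
    unfolding mat_mult_index_sum[OF assms(1,2) ij] by (rule norm_sum)
  also have "\<dots> \<le> (\<Sum>k<Suc n. K * L)"
    using assms(3-6) ij unfolding norm_mult entries_le_def by (intro sum_mono mult_mono) auto
  finally show "norm ((A * B) $$ (i, j)) \<le> real (Suc n) * (K * L)" by simp
qed

lemma entries_le_exists: obtains K where "K \<ge> 0" "entries_le K A"
proof -
  have fin: "finite ((\<lambda>ij. norm (A $$ ij)) ` ({..n} \<times> {..n}))" by simp
  have "norm (A $$ (i, j)) \<le> Max (insert 0 ((\<lambda>ij. norm (A $$ ij)) ` ({..n} \<times> {..n})))" if "i \<le> n" "j \<le> n" for i j
    using fin that by (intro Max_ge) auto
  moreover have "Max (insert 0 ((\<lambda>ij. norm (A $$ ij)) ` ({..n} \<times> {..n}))) \<ge> 0" using fin by (intro Max_ge) auto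
  ultimately show ?thesis using that unfolding entries_le_def by blast
qed

text \<open>Isolation of the identity suffices: two close elements have a quotient near the
  identity, where the bound on the inverses controls the error, so the quotient is the
  identity.\<close>

lemma bounded_discrete_repeats:
  assumes G: "subgroup G (Sp n)" "discrete_mats n G" and f: "\<And>k. f k \<in> G"
    and bf: "\<And>k. entries_le K (f k)" "\<And>k. entries_le K (inv_Sp (f k))" and K: "K \<ge> 0"
  obtains a b :: nat where "a < b" "f a = f b"
proof -
  have one: "1\<^sub>m (Suc n) \<in> G" using subgroup.one_closed[OF G(1)] by simp
  then obtain \<epsilon> where \<epsilon>: "\<epsilon> > 0"
    "\<And>h. h \<in> G \<Longrightarrow> (\<And>i j. i \<le> n \<Longrightarrow> j \<le> n \<Longrightarrow> norm (h $$ (i, j) - 1\<^sub>m (Suc n) $$ (i, j)) < \<epsilon>) \<Longrightarrow> h = 1\<^sub>m (Suc n)"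
    using G(2) unfolding discrete_mats_def by (metis Suc_eq_plus1 less_Suc_eq_le)
  \<comment> \<open>An entry of the quotient minus the identity is a sum of \<open>n + 1\<close>
    terms of size at most \<open>K * \<delta>\<close>; \<open>K + 1\<close> makes the bound strict
    and avoids division by zero.\<close>
  define \<delta> where "\<delta> = \<epsilon> / (real (Suc n) * (K + 1))"
  have \<delta>: "\<delta> > 0" using \<epsilon>(1) K by (simp add: \<delta>_def)
  obtain a b where ab: "a < b" "\<And>i j. i \<le> n \<Longrightarrow> j \<le> n \<Longrightarrow> norm (f a $$ (i, j) - f b $$ (i, j)) < \<delta>"
    using bounded_matrices_close[of n f K \<delta>] bf(1) \<delta> unfolding entries_le_def by blast
  have fS: "f k \<in> S" for k using f subgroup.subset[OF G(1)] by blast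
  note fM = S_D(1)[OF fS]
  have iM: "inv_Sp (f k) \<in> M" for k using S_D(1) Sp.inv_closed[OF fS] by blast
  have "inv_Sp (f a) * f b = 1\<^sub>m (Suc n)"
  proof (rule \<epsilon>(2))
    show "inv_Sp (f a) * f b \<in> G"
      using subgroup.m_closed[OF G(1) subgroup.m_inv_closed[OF G(1) f] f] by simp
    fix i j assume ij: "i \<le> n" "j \<le> n"
    have "1\<^sub>m (Suc n) = inv_Sp (f a) * f a" using Sp.l_inv[OF fS] by simp
    then have "(inv_Sp (f a) * f b) $$ (i, j) - 1\<^sub>m (Suc n) $$ (i, j)
        = (\<Sum>k<Suc n. inv_Sp (f a) $$ (i, k) * (f b $$ (k, j) - f a $$ (k, j)))"
      by (simp only: mat_mult_index_sum[OF iM fM ij] sum_subtractf right_diff_distrib)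
    also have "norm \<dots> \<le> (\<Sum>k<Suc n. norm (inv_Sp (f a) $$ (i, k) * (f b $$ (k, j) - f a $$ (k, j))))"
      by (rule norm_sum)
    also have "\<dots> \<le> (\<Sum>k<Suc n. K * \<delta>)"
    proof (rule sum_mono)
      fix k assume "k \<in> {..<Suc n}"
      then have k: "k \<le> n" by auto
      have "norm (f b $$ (k, j) - f a $$ (k, j)) \<le> \<delta>"
        using ab(2)[OF k ij(2)] by (simp add: norm_minus_commute)
      then show "norm (inv_Sp (f a) $$ (i, k) * (f b $$ (k, j) - f a $$ (k, j))) \<le> K * \<delta>"
        unfolding norm_mult using bf(2)[of a] ij k K unfolding entries_le_def by (intro mult_mono) auto
    qed
    also have "\<dots> = real (Suc n) * (K * \<delta>)" by simp
    also have "\<dots> < real (Suc n) * ((K + 1) * \<delta>)" using \<delta> by (intro mult_strict_left_mono) auto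
    also have "\<dots> = \<epsilon>"
    proof -
      have "real (Suc n) * (K + 1) \<noteq> 0" using K by simp
      then show ?thesis unfolding \<delta>_def mult.assoc[symmetric] times_divide_eq_right
        by (rule nonzero_mult_div_cancel_left)
    qed
    finally show "norm ((inv_Sp (f a) * f b) $$ (i, j) - 1\<^sub>m (Suc n) $$ (i, j)) < \<epsilon>" .
  qed
  then have "inv_Sp (f a) \<otimes>\<^bsub>Sp n\<^esub> f b = \<one>\<^bsub>Sp n\<^esub>" by simp
  then have "f a = f b"
    using fS Sp.inv_equality Sp.inv_inv Sp.inv_closed by metis
  with ab(1) show ?thesis by (rule that)
qed

text \<open>The columns at \<open>n - 1\<close> and \<open>n\<close> are null vectors, so their
  positive coordinates are controlled by their null coordinates, which are corner entries.\<close>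

lemma corner_bound_aux:
  assumes F: "F \<in> S" and K: "K \<ge> 1"
    and c: "\<And>a b. a \<in> {n - 1, n} \<Longrightarrow> b \<in> {n - 1, n} \<Longrightarrow> norm (H (F *\<^sub>v e a) (e b)) \<le> K"
    and i: "i \<le> n" and j: "j \<in> {n - 1, n}"
  shows "norm ((F *\<^sub>v e j) $ i) \<le> 2 * K"
proof -
  define y where "y = F *\<^sub>v e j"
  have jn: "Q (e j) = 0" 
    using j n_pos herm_unit(2)[of "e (n - 1)"] herm_unit(3)[of "e n"] unfolding Q_def by auto
  have yn: "norm (y $ n) \<le> K" "norm (y $ (n - 1)) \<le> K"
    using c[OF j, of "n - 1"] c[OF j, of n] unfolding herm_unit y_def by simp_all
  show ?thesis
  proof (cases "i < n - 1")
    case True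
    have "(norm (y $ i))\<^sup>2 \<le> (\<Sum>i<n - 1. (norm (y $ i))\<^sup>2)" using True by (intro member_le_sum) auto
    also have "\<dots> \<le> 2 * (norm (y $ (n - 1)) * norm (y $ n))"
      by (rule Q_coords_le) (simp add: y_def Q_S[OF F] jn)
    also have "\<dots> \<le> 2 * (K * K)" using yn K by (intro mult_left_mono mult_mono) auto
    also have "\<dots> \<le> (2 * K)\<^sup>2" by (simp add: power2_eq_square)
    finally show ?thesis unfolding y_def[symmetric] by (rule power2_le_imp_le) (use K in simp)
  next
    case False
    then consider "i = n - 1" | "i = n" using i by linarith
    then show ?thesis using yn K unfolding y_def[symmetric] by cases auto
  qed
qed

text \<open>Four corner entries bound the whole matrix and its inverse, as \<open>Q\<close> has a
  fixed value on each column; the condition on the corners is symmetric under inversion, which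
  settles both claims at once.\<close>

lemma corner_bound:
  assumes F: "F \<in> S" and K: "K \<ge> 1"
    and c: "\<And>a b. a \<in> {n - 1, n} \<Longrightarrow> b \<in> {n - 1, n} \<Longrightarrow> norm (H (F *\<^sub>v e a) (e b)) \<le> K"
  shows "entries_le (3 * K) F" "entries_le (3 * K) (inv_Sp F)"
proof -
  have inv_corner: "norm (H (inv_Sp F *\<^sub>v e a) (e b)) \<le> K"
    if F: "F \<in> S" and c: "\<And>a b. a \<in> {n - 1, n} \<Longrightarrow> b \<in> {n - 1, n} \<Longrightarrow> norm (H (F *\<^sub>v e a) (e b)) \<le> K"
      and ab: "a \<in> {n - 1, n}" "b \<in> {n - 1, n}" for F a b
    using c[OF ab(2,1)] herm_inv_right[OF F e_in_V e_in_V, of b a] norm_herm_sym[of "inv_Sp F *\<^sub>v e a" "e b"] by simp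
  have main: "entries_le (3 * K) F"
    if F: "F \<in> S" and c: "\<And>a b. a \<in> {n - 1, n} \<Longrightarrow> b \<in> {n - 1, n} \<Longrightarrow> norm (H (F *\<^sub>v e a) (e b)) \<le> K" for F
    unfolding entries_le_def
  proof (intro allI impI)
    fix i j assume ij: "i \<le> n" "j \<le> n"
    have FS: "inv_Sp F \<in> S" using F by simp
    have idx: "F $$ (i, j) = (F *\<^sub>v e j) $ i"
      using ij S_D(1)[OF F] by (simp add: mult_mat_unit_vec del: index_mult_mat_vec)
    have "norm ((F *\<^sub>v e j) $ i) \<le> 3 * K"
    proof (cases "j < n - 1")
      case False
      then have "j \<in> {n - 1, n}" using ij by auto
      then have "norm ((F *\<^sub>v e j) $ i) \<le> 2 * K" using corner_bound_aux[OF F K c ij(1)] by blast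
      then show ?thesis using K by simp
    next
      case True
      define y where "y = F *\<^sub>v e j"
      \<comment> \<open>By adjointness the null coordinates of this column have the moduli of
        entries in the null columns of the inverse, bounded by the auxiliary lemma.\<close>
      have row: "norm (H y (e a)) \<le> 2 * K" if a: "a \<in> {n - 1, n}" for a
      proof -
        have "norm (H y (e a)) = norm (H (inv_Sp F *\<^sub>v e a) (e j))"
          unfolding y_def herm_inv_right[OF F e_in_V e_in_V] by (rule norm_herm_sym)
        then show ?thesis
          using corner_bound_aux[OF FS K inv_corner[OF F c] ij(2) a] True by (simp add: herm_unit(1))
      qed
      have yn: "norm (y $ n) \<le> 2 * K" "norm (y $ (n - 1)) \<le> 2 * K"
        using row[of "n - 1"] row[of n] unfolding herm_unit by simp_all
      have "H (e j) (e j) = 1" using True by (simp add: herm_unit(1))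
      then have "Q y = 1" using Q_S[OF F e_in_V] by (simp add: y_def Q_def)
      then have sum: "(\<Sum>i<n - 1. (norm (y $ i))\<^sup>2) \<le> 1 + 2 * ((2 * K) * (2 * K))"
      proof -
        have "qRe (qcnj (y $ (n - 1)) * y $ n) \<le> norm (y $ (n - 1)) * norm (y $ n)"
          using qRe_le_norm[of "qcnj (y $ (n - 1)) * y $ n"] by (simp add: norm_mult)
        also have "\<dots> \<le> (2 * K) * (2 * K)" using yn K by (intro mult_mono) auto
        finally show ?thesis using \<open>Q y = 1\<close> unfolding Q_coords by simp
      qed
      show ?thesis
      proof (cases "i < n - 1")
        case True
        have "(norm (y $ i))\<^sup>2 \<le> (\<Sum>i<n - 1. (norm (y $ i))\<^sup>2)" using True by (intro member_le_sum) auto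
        also have "\<dots> \<le> 1 + 2 * ((2 * K) * (2 * K))" by (rule sum)
        \<comment> \<open>This is \<open>1 + 8 K^2 \<le> 9 K^2\<close>, the reason for the factor 3
          and for \<open>K \<ge> 1\<close>.\<close>
        also have "\<dots> \<le> (3 * K)\<^sup>2" using mult_mono[OF K K] K by (simp add: power2_eq_square)
        finally show ?thesis unfolding y_def[symmetric] by (rule power2_le_imp_le) (use K in simp)
      next
        case False
        then consider "i = n - 1" | "i = n" using ij by linarith
        then show ?thesis using yn K unfolding y_def[symmetric] by cases auto
      qed
    qed
    then show "norm (F $$ (i, j)) \<le> 3 * K" unfolding idx .
  qed
  show "entries_le (3 * K) F" using main[OF F c] .
  show "entries_le (3 * K) (inv_Sp F)" using main[OF Sp.inv_closed[OF F] inv_corner[OF F c]] .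
qed

text \<open>In the frame \<open>P\<close> the products with \<open>att P\<close> and
  \<open>rpl P\<close> are the corner entries; returning from the frame costs only a constant
  depending on \<open>P\<close>.\<close>

lemma corners_discrete_repeats:
  assumes G: "subgroup G (Sp n)" "discrete_mats n G" and f: "\<And>k. f k \<in> G" and P: "P \<in> S"
    and c: "\<And>k x y. x \<in> {att P, rpl P} \<Longrightarrow> y \<in> {att P, rpl P} \<Longrightarrow> norm (H (f k *\<^sub>v x) y) \<le> K"
  obtains a b :: nat where "a < b" "f a = f b"
proof -
  have fS: "f k \<in> S" for k using f subgroup.subset[OF G(1)] by blast
  define F where "F k = inv_Sp P * f k * P" for k
  have iP: "inv_Sp P \<in> S" using P by simp
  have FS: "F k \<in> S" for k unfolding F_def using P iP fS by blast
  define L where "L = max K 1"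
  have ev: "P *\<^sub>v e a \<in> {att P, rpl P}" if "a \<in> {n - 1, n}" for a
    using that by (auto simp: att_def rpl_def)
  have "norm (H (F k *\<^sub>v e a) (e b)) \<le> L" if ab: "a \<in> {n - 1, n}" "b \<in> {n - 1, n}" for k a b
  proof -
    have "F k *\<^sub>v e a = inv_Sp P *\<^sub>v (f k *\<^sub>v (P *\<^sub>v e a))"
      unfolding F_def using P iP fS by (simp add: S_mult_vec del: Sp.inv_closed)
    then have "H (F k *\<^sub>v e a) (e b) = H (f k *\<^sub>v (P *\<^sub>v e a)) (P *\<^sub>v e b)"
      using S_D(2)[OF P, of "F k *\<^sub>v e a" "e b"] S_inv_vec(2)[OF P] P fS FS by simp
    then show ?thesis using c[OF ev[OF ab(1)] ev[OF ab(2)], of k] by (simp add: L_def)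
  qed
  then have B: "entries_le (3 * L) (F k)" "entries_le (3 * L) (inv_Sp (F k))" for k
    using corner_bound[OF FS, of L k] by (auto simp: L_def)
  have conj: "\<And>A. A \<in> S \<Longrightarrow> P * (inv_Sp P * A * P) * inv_Sp P = A"
    using Sp.conj_conj_inv[OF P] by simp
  obtain K1 where K1: "K1 \<ge> 0" "entries_le K1 P" by (rule entries_le_exists)
  obtain K2 where K2: "K2 \<ge> 0" "entries_le K2 (inv_Sp P)" by (rule entries_le_exists)
  define N where "N = real (Suc n) * ((real (Suc n) * (K1 * (3 * L))) * K2)"
  have L0: "L \<ge> 0" by (simp add: L_def)
  have cb: "entries_le N (P * A * inv_Sp P)" if A: "A \<in> S" "entries_le (3 * L) A" for A
    unfolding N_def using K1 K2 L0 A(2) S_D(1)[OF P] S_D(1)[OF iP] S_D(1)[OF A(1)] S_D(1)[OF S_mult[OF P A(1)]]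
    by (intro entries_le_mult) auto
  have Fk: "f k = P * F k * inv_Sp P" for k unfolding F_def using conj[OF fS] by simp
  have "inv_Sp (F k) = inv_Sp P * inv_Sp (f k) * P" for k
    unfolding F_def using P iP fS Sp.inv_mult_group[of "inv_Sp P * f k" P] Sp.inv_mult_group[of "inv_Sp P" "f k"]
    by (simp add: S_assoc)
  then have Fk': "inv_Sp (f k) = P * inv_Sp (F k) * inv_Sp P" for k using conj[OF Sp.inv_closed[OF fS]] by simp
  have bN: "entries_le N (f k)" "entries_le N (inv_Sp (f k))" for k
    using cb[OF FS B(1)] cb[OF Sp.inv_closed[OF FS] B(2)] Fk Fk' by metis+
  have N0: "N \<ge> 0" unfolding N_def using K1 K2 L0 by simp
  show ?thesis by (rule bounded_discrete_repeats[OF G f bN N0]) (rule that)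
qed

section \<open>Powers of a loxodromic element\<close>

lemma NF_int_pow:
  assumes nf: "NF g P l"
  shows "\<exists>a. norm a = norm (l (n - 1)) powi s \<and> (g [^]\<^bsub>Sp n\<^esub> (s::int)) *\<^sub>v att P = att P \<cdot>\<^sub>r a"
    "\<exists>a. norm a = norm (l (n - 1)) powi (- s) \<and> (g [^]\<^bsub>Sp n\<^esub> s) *\<^sub>v rpl P = rpl P \<cdot>\<^sub>r a"
proof -
  note g = NF_D(3)[OF nf] and AR = att_rpl[OF NF_D(1)[OF nf]] and l0 = NF_D(5)[OF nf]
  have gen: "\<exists>a. norm a = norm c powi s \<and> (g [^]\<^bsub>Sp n\<^esub> s) *\<^sub>v x = x \<cdot>\<^sub>r a"
    if x: "x \<in> V" and ex: "g *\<^sub>v x = x \<cdot>\<^sub>r c" and c0: "c \<noteq> 0" for x c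
  proof -
    have nat: "(g [^]\<^bsub>Sp n\<^esub> k) *\<^sub>v x = x \<cdot>\<^sub>r (c ^ k)" for k :: nat
    proof (induction k)
      case 0
      then show ?case using mat_pow_vec(1)[OF g x] by simp
    next
      case (Suc k)
      then show ?case
        unfolding mat_pow_vec(2)[OF g x] ex using S_rsmult[OF Sp.nat_pow_closed[OF g] x] by (simp add: power_commutes)
    qed
    show ?thesis
    proof (cases "s \<ge> 0")
      case True
      then obtain k where s: "s = int k" by (metis nonneg_int_cases)
      show ?thesis unfolding s int_pow_int nat by (intro exI[of _ "c ^ k"]) (simp add: norm_power)
    next
      case False
      then obtain k where s: "s = - int k" by (metis int_cases2 of_nat_0_le_iff)
      define p where "p = g [^]\<^bsub>Sp n\<^esub> k"
      have p: "p \<in> S" using g by (simp add: p_def)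
      have "x = inv_Sp p *\<^sub>v (x \<cdot>\<^sub>r (c ^ k))" using S_inv_vec(1)[OF p x] nat[of k] by (simp add: p_def)
      also have "\<dots> = (inv_Sp p *\<^sub>v x) \<cdot>\<^sub>r (c ^ k)" using p x S_rsmult by simp
      finally have "x \<cdot>\<^sub>r inverse (c ^ k) = (inv_Sp p *\<^sub>v x) \<cdot>\<^sub>r (c ^ k) \<cdot>\<^sub>r inverse (c ^ k)" by simp
      also have "\<dots> = inv_Sp p *\<^sub>v x" using c0 by (simp del: power_inverse)
      finally have "(g [^]\<^bsub>Sp n\<^esub> s) *\<^sub>v x = x \<cdot>\<^sub>r inverse (c ^ k)"
        unfolding s Sp.int_pow_neg_int[OF g] p_def ..
      then show ?thesis unfolding s
        by (intro exI[of _ "inverse (c ^ k)"]) (simp add: norm_inverse norm_power power_int_minus)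
    qed
  qed
  show "\<exists>a. norm a = norm (l (n - 1)) powi s \<and> (g [^]\<^bsub>Sp n\<^esub> s) *\<^sub>v att P = att P \<cdot>\<^sub>r a"
    using gen[OF AR(1) NF_att_rpl(1)[OF nf] l0] .
  have "inverse (qcnj (l (n - 1))) \<noteq> 0" using l0 by simp
  from gen[OF AR(2) NF_att_rpl(2)[OF nf] this]
  show "\<exists>a. norm a = norm (l (n - 1)) powi (- s) \<and> (g [^]\<^bsub>Sp n\<^esub> s) *\<^sub>v rpl P = rpl P \<cdot>\<^sub>r a"
    by (simp add: norm_inverse power_int_inverse power_int_minus)
qed

text \<open>Multiplying by powers of \<open>g\<close> on both sides rescales the four corners, with
  exponents that cancel in each of the two cross ratio products. The two free exponents can thus
  balance both products.\<close>

lemma herm_pow_scale: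
  fixes a b :: int
  assumes nf: "NF g P l" and f: "f \<in> S"
  defines "L \<equiv> norm (l (n - 1))" and "f' \<equiv> g [^]\<^bsub>Sp n\<^esub> (a::int) * f * g [^]\<^bsub>Sp n\<^esub> (b::int)"
  shows "norm (H (f' *\<^sub>v att P) (att P)) = L powi (b - a) * norm (H (f *\<^sub>v att P) (att P))"
    "norm (H (f' *\<^sub>v att P) (rpl P)) = L powi (b + a) * norm (H (f *\<^sub>v att P) (rpl P))"
    "norm (H (f' *\<^sub>v rpl P) (att P)) = L powi (- b - a) * norm (H (f *\<^sub>v rpl P) (att P))"
    "norm (H (f' *\<^sub>v rpl P) (rpl P)) = L powi (- b + a) * norm (H (f *\<^sub>v rpl P) (rpl P))"
proof -
  note g = NF_D(3)[OF nf] and AR = att_rpl[OF NF_D(1)[OF nf]]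
  have L0: "L \<noteq> 0" using NF_D(5)[OF nf] by (simp add: L_def)
  \<comment> \<open>The integers \<open>i\<close>, \<open>j\<close> record the end: 1 for the
    attracting and -1 for the repelling one.\<close>
  have gen: "norm (H (f' *\<^sub>v x) y) = L powi (i * b - j * a) * norm (H (f *\<^sub>v x) y)"
    if x: "x \<in> V" "\<And>s. \<exists>c. norm c = L powi (i * s) \<and> (g [^]\<^bsub>Sp n\<^esub> (s::int)) *\<^sub>v x = x \<cdot>\<^sub>r c"
      and y: "y \<in> V" "\<And>s. \<exists>c. norm c = L powi (j * s) \<and> (g [^]\<^bsub>Sp n\<^esub> (s::int)) *\<^sub>v y = y \<cdot>\<^sub>r c" for x y i j
  proof -
    have pS: "g [^]\<^bsub>Sp n\<^esub> (s::int) \<in> S" for s using g by simp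
    obtain c where c: "norm c = L powi (i * b)" "(g [^]\<^bsub>Sp n\<^esub> b) *\<^sub>v x = x \<cdot>\<^sub>r c" using x(2) by blast
    obtain d where d: "norm d = L powi (j * (- a))" "(g [^]\<^bsub>Sp n\<^esub> (- a)) *\<^sub>v y = y \<cdot>\<^sub>r d" using y(2) by blast
    have "f' *\<^sub>v x = (g [^]\<^bsub>Sp n\<^esub> a) *\<^sub>v ((f *\<^sub>v x) \<cdot>\<^sub>r c)"
      unfolding f'_def using pS f x(1) c(2) by (simp add: S_mult_vec S_rsmult)
    then have "H (f' *\<^sub>v x) y = H ((f *\<^sub>v x) \<cdot>\<^sub>r c) (inv_Sp (g [^]\<^bsub>Sp n\<^esub> a) *\<^sub>v y)"
      using herm_inv_right[OF pS] f x(1) y(1) by simp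
    also have "inv_Sp (g [^]\<^bsub>Sp n\<^esub> a) *\<^sub>v y = y \<cdot>\<^sub>r d" using d(2) Sp.int_pow_neg[OF g] by simp
    finally have "norm (H (f' *\<^sub>v x) y) = (L powi (i * b) * L powi (j * (- a))) * norm (H (f *\<^sub>v x) y)"
      using f x(1) y(1) c(1) d(1) by (simp add: herm_lin norm_mult)
    also have "L powi (i * b) * L powi (j * (- a)) = L powi (i * b - j * a)"
      using L0 by (simp flip: power_int_add)
    finally show ?thesis .
  qed
  have A: "\<exists>c. norm c = L powi (1 * s) \<and> (g [^]\<^bsub>Sp n\<^esub> s) *\<^sub>v att P = att P \<cdot>\<^sub>r c"
    and R: "\<exists>c. norm c = L powi ((-1) * s) \<and> (g [^]\<^bsub>Sp n\<^esub> s) *\<^sub>v rpl P = rpl P \<cdot>\<^sub>r c" for s :: int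
    using NF_int_pow[OF nf, of s] by (simp_all add: L_def)
  show "norm (H (f' *\<^sub>v att P) (att P)) = L powi (b - a) * norm (H (f *\<^sub>v att P) (att P))"
    "norm (H (f' *\<^sub>v att P) (rpl P)) = L powi (b + a) * norm (H (f *\<^sub>v att P) (rpl P))"
    "norm (H (f' *\<^sub>v rpl P) (att P)) = L powi (- b - a) * norm (H (f *\<^sub>v rpl P) (att P))"
    "norm (H (f' *\<^sub>v rpl P) (rpl P)) = L powi (- b + a) * norm (H (f *\<^sub>v rpl P) (rpl P))"
    using gen[OF AR(1) A AR(1) A] gen[OF AR(1) A AR(2) R] gen[OF AR(2) R AR(1) A] gen[OF AR(2) R AR(2) R]
    by simp_all
qed

text \<open>Powers of \<open>L\<close> bring \<open>x\<close> within a factor \<open>L\<close> of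
  any positive target, and the bounded product then controls \<open>y\<close>. For
  \<open>x = 0\<close> a large exponent shrinks \<open>y\<close> alone.\<close>

lemma balance_powi:
  fixes x y L K :: real
  assumes "x \<ge> 0" "y \<ge> 0" "x * y \<le> K\<^sup>2" "K > 0" "L > 1"
  obtains s :: int where "L powi s * x \<le> L * K" "L powi (- s) * y \<le> L * K"
proof (cases "x = 0")
  case True
  obtain k :: nat where k: "y / (L * K) < L ^ k" using real_arch_pow[OF assms(5)] by blast
  then have "y < L ^ k * (L * K)" using assms by (simp add: pos_divide_less_eq)
  then have "L powi (- int k) * y \<le> L * K"
    using assms by (simp add: power_int_minus field_simps)
  then show ?thesis using that[of "int k"] True assms by simp
next
  case False
  then have x: "x > 0" using assms by simp
  \<comment> \<open>The largest \<open>s\<close> with \<open>L powi s \<le> z\<close> places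
    \<open>L powi s * x\<close> between \<open>K\<close> and \<open>L * K\<close>.\<close>
  define z where "z = L * K / x"
  have z: "z > 0" using x assms by (simp add: z_def)
  define s where "s = \<lfloor>log L z\<rfloor>"
  have powi: "L powr real_of_int t = L powi t" for t using assms by (intro powr_real_of_int') auto
  have "L powr real_of_int s \<le> L powr log L z" using assms by (intro powr_mono) (auto simp: s_def)
  then have 1: "L powi s \<le> z" using powi z assms by simp
  have "L powr log L z < L powr real_of_int (s + 1)" using assms by (intro powr_less_mono) (auto simp: s_def)
  then have "z < L powi (s + 1)" unfolding powi using z assms by simp
  then have 2: "z < L powi s * L" using assms by (simp add: power_int_add_1)
  have Ls: "L powi s > 0" using assms by (intro zero_less_power_int) simp
  have "K < L powi s * x" using 2 x assms unfolding z_def by (simp add: field_simps)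
  then have "K * y \<le> L powi s * (x * y)" using mult_right_mono[of K "L powi s * x" y] assms(2) by (simp add: mult_ac)
  also have "\<dots> \<le> L powi s * K\<^sup>2" using Ls assms(3) by (intro mult_left_mono) auto
  finally have "y \<le> L powi s * K" using assms(4) by (simp add: power2_eq_square)
  then have "L powi (- s) * y \<le> K" using Ls by (simp add: power_int_minus field_simps)
  also have "\<dots> \<le> L * K" using assms by simp
  finally have "L powi (- s) * y \<le> L * K" .
  moreover have "L powi s * x \<le> L * K" using 1 x unfolding z_def by (simp add: field_simps)
  ultimately show ?thesis using that by blast
qed

text \<open>In the notation of cross ratios, \<open>A2 P f\<close> and \<open>B2 P f\<close> are the moduli of
  $[f(u),u,v,f(v)]$ and $[f(u),v,u,f(v)]$.\<close>

definition A2 :: "quat mat \<Rightarrow> quat mat \<Rightarrow> real" where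
  "A2 P f = norm (H (f *\<^sub>v att P) (rpl P)) * norm (H (f *\<^sub>v rpl P) (att P))"

definition B2 :: "quat mat \<Rightarrow> quat mat \<Rightarrow> real" where
  "B2 P f = norm (H (f *\<^sub>v att P) (att P)) * norm (H (f *\<^sub>v rpl P) (rpl P))"

lemma A2_B2_nonneg: "A2 P f \<ge> 0" "B2 P f \<ge> 0"
  by (simp_all add: A2_def B2_def)

lemma subgroup_int_pow: "subgroup G (Sp n) \<Longrightarrow> g \<in> G \<Longrightarrow> g [^]\<^bsub>Sp n\<^esub> (s::int) \<in> G"
proof -
  assume G: "subgroup G (Sp n)" "g \<in> G"
  have nat: "g [^]\<^bsub>Sp n\<^esub> k \<in> G" for k :: nat
    using G by (induction k) (auto intro: subgroup.m_closed subgroup.one_closed simp del: Sp_simps)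
  show ?thesis
    using int_pow_def2[where G = "Sp n" and a = g and z = s] nat[of "nat (- s)"] nat[of "nat s"] subgroup.m_inv_closed[OF G(1)] by metis
qed

text \<open>Balancing by powers of \<open>g\<close> makes all four corners bounded without changing
  \<open>B2\<close>. The balanced elements repeat, hence so do the values of
  \<open>B2\<close>.\<close>

lemma cross_ratio_discrete_repeats:
  assumes G: "subgroup G (Sp n)" "discrete_mats n G" and nf: "NF g P l" and g: "g \<in> G"
    and f: "\<And>k. f k \<in> G" and AB: "\<And>k. A2 P (f k) \<le> K\<^sup>2" "\<And>k. B2 P (f k) \<le> K\<^sup>2" and K: "K > 0"
  obtains a b :: nat where "a < b" "B2 P (f a) = B2 P (f b)"
proof -
  define L where "L = norm (l (n - 1))"
  have L: "L > 1" using NF_D(6)[OF nf] by (simp add: L_def)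
  then have L0: "L \<noteq> 0" and LL: "L\<^sup>2 > 1" by (auto simp: one_less_power)
  have fS: "f k \<in> S" for k using f subgroup.subset[OF G(1)] by blast
  have "\<exists>f'\<in>G. (\<forall>x\<in>{att P, rpl P}. \<forall>y\<in>{att P, rpl P}. norm (H (f' *\<^sub>v x) y) \<le> L\<^sup>2 * K)
      \<and> B2 P f' = B2 P (f k)" for k
  proof -
    define aa where "aa = norm (H (f k *\<^sub>v att P) (rpl P))"
    define dd where "dd = norm (H (f k *\<^sub>v rpl P) (att P))"
    define cc where "cc = norm (H (f k *\<^sub>v att P) (att P))"
    define bb where "bb = norm (H (f k *\<^sub>v rpl P) (rpl P))"
    have nn: "aa \<ge> 0" "bb \<ge> 0" "cc \<ge> 0" "dd \<ge> 0" by (simp_all add: aa_def bb_def cc_def dd_def)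
    have ad: "aa * dd \<le> K\<^sup>2" and bc: "cc * bb \<le> K\<^sup>2" using AB[of k] by (simp_all add: A2_def B2_def aa_def bb_def cc_def dd_def)
    obtain s :: int where s: "L powi s * aa \<le> L * K" "L powi (- s) * dd \<le> L * K"
      using balance_powi[OF nn(1,4) ad K L] .
    have pm: "L powi (- s) * L powi s = 1" using L0 by (simp flip: power_int_add)
    have "(L powi (- s) * cc) * (L powi s * bb) = (L powi (- s) * L powi s) * (cc * bb)"
      by (simp only: mult_ac)
    then have "(L powi (- s) * cc) * (L powi s * bb) \<le> K\<^sup>2" using bc by (simp only: pm mult_1)
    moreover have "L powi (- s) * cc \<ge> 0" "L powi s * bb \<ge> 0" using nn L by simp_all
    \<comment> \<open>With exponents \<open>s - t\<close> and \<open>t\<close> the first pair of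
      corners sees only their sum \<open>s\<close>, while the second pair is scaled by
      \<open>2 t - s\<close>; hence the base \<open>L\<^sup>2\<close> for the second
      balancing.\<close>
    ultimately obtain t :: int where t: "L\<^sup>2 powi t * (L powi (- s) * cc) \<le> L\<^sup>2 * K" "L\<^sup>2 powi (- t) * (L powi s * bb) \<le> L\<^sup>2 * K"
      using balance_powi[OF _ _ _ K LL] by metis
    have sq: "L\<^sup>2 powi r = L powi (2 * r)" for r by (simp add: power_int_mult)
    define f' where "f' = g [^]\<^bsub>Sp n\<^esub> (s - t) * f k * g [^]\<^bsub>Sp n\<^esub> t"
    note sc = herm_pow_scale[OF nf fS[of k], of "s - t" t, folded f'_def L_def aa_def bb_def cc_def dd_def]
    have Lle: "L * K \<le> L\<^sup>2 * K" using L K by (simp add: power2_eq_square)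
    have "norm (H (f' *\<^sub>v att P) (att P)) \<le> L\<^sup>2 * K" "norm (H (f' *\<^sub>v rpl P) (rpl P)) \<le> L\<^sup>2 * K"
      using t L0 unfolding sc sq by (simp_all add: algebra_simps flip: power_int_add)
    moreover have "norm (H (f' *\<^sub>v att P) (rpl P)) \<le> L\<^sup>2 * K" "norm (H (f' *\<^sub>v rpl P) (att P)) \<le> L\<^sup>2 * K"
      using s Lle unfolding sc by simp_all
    moreover have "B2 P f' = B2 P (f k)"
    proof -
      have "L powi (t - (s - t)) * L powi (- t + (s - t)) = 1" using L0 by (simp flip: power_int_add)
      then show ?thesis unfolding B2_def sc cc_def[symmetric] bb_def[symmetric]
        by (metis mult.assoc mult.left_commute mult_1)
    qed
    moreover have "f' \<in> G"
      unfolding f'_def using subgroup.m_closed[OF G(1)] subgroup_int_pow[OF G(1) g] f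
      by (metis Sp_simps(1))
    ultimately show ?thesis by blast
  qed
  then obtain f' where f': "\<And>k. f' k \<in> G" "\<And>k x y. x \<in> {att P, rpl P} \<Longrightarrow> y \<in> {att P, rpl P} \<Longrightarrow> norm (H (f' k *\<^sub>v x) y) \<le> L\<^sup>2 * K"
    "\<And>k. B2 P (f' k) = B2 P (f k)" by metis
  obtain a b :: nat where "a < b" "f' a = f' b"
    by (rule corners_discrete_repeats[OF G f'(1) NF_D(1)[OF nf] f'(2)])
  then show ?thesis using that f'(3) by metis
qed

definition fixes_ends :: "quat mat \<Rightarrow> quat mat \<Rightarrow> bool" where
  "fixes_ends P f \<longleftrightarrow> proj (f *\<^sub>v att P) = proj (att P) \<and> proj (f *\<^sub>v rpl P) = proj (rpl P)"

lemma null_herm_eq_0_iff: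
  assumes "x \<in> V" "y \<in> V" "Q x = 0" "Q y = 0" "x \<noteq> 0\<^sub>v (Suc n)" "y \<noteq> 0\<^sub>v (Suc n)"
  shows "H x y = 0 \<longleftrightarrow> proj x = proj y"
proof
  assume "proj x = proj y"
  then obtain l where "y = x \<cdot>\<^sub>r l" using proj_eq_iff by blast
  moreover have "H x x = 0" using herm_self[of x] assms by simp
  ultimately show "H x y = 0" using assms by (simp add: herm_lin)
qed (use null_herm_nonzero assms in blast)

text \<open>If \<open>f\<close> shares one fixed point with \<open>g\<close>, then the conjugates of \<open>f\<close> by powers of \<open>g\<close> (with the
  appropriate sign) stay bounded; by discreteness \<open>f\<close> commutes with a power of \<open>g\<close>.\<close>

lemma shared_end:
  assumes G: "subgroup G (Sp n)" "discrete_mats n G" and nf: "NF g P l" and g: "g \<in> G"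
    and f: "f \<in> G" and B: "B2 P f = 0"
  shows "fixes_ends P f"
proof -
  define L where "L = norm (l (n - 1))"
  have L: "L > 1" using NF_D(6)[OF nf] by (simp add: L_def)
  have fS: "f \<in> S" and gS: "g \<in> S" using f g subgroup.subset[OF G(1)] by blast+
  note np = null_pair_att_rpl[OF NF_D(1)[OF nf]]
  note N = null_pairD[OF np] and N' = null_pairD[OF null_pair_S[OF fS np]]
  have B': "H (f *\<^sub>v att P) (att P) = 0 \<or> H (f *\<^sub>v rpl P) (rpl P) = 0" using B by (simp add: B2_def)
  \<comment> \<open>The sign is chosen so that conjugation expands only a corner that vanishes and
    contracts the opposite one.\<close>
  define \<sigma> :: int where "\<sigma> = (if H (f *\<^sub>v att P) (att P) = 0 then 1 else - 1)"
  define K where "K = norm (H (f *\<^sub>v att P) (att P)) + norm (H (f *\<^sub>v rpl P) (rpl P)) + norm (H (f *\<^sub>v att P) (rpl P)) + norm (H (f *\<^sub>v rpl P) (att P))"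
  define fk where "fk k = g [^]\<^bsub>Sp n\<^esub> (- (\<sigma> * int k)) * f * g [^]\<^bsub>Sp n\<^esub> (\<sigma> * int k)" for k
  have fkG: "fk k \<in> G" for k
    unfolding fk_def using subgroup.m_closed[OF G(1)] subgroup_int_pow[OF G(1) g] f by (metis Sp_simps(1))
  have le1: "L powi (- (2 * int k)) \<le> 1" for k
  proof -
    have "L powi (2 * int k) \<ge> 1" using L one_le_power[of L "2 * k"] by (simp add: power_int_def)
    then show ?thesis by (simp add: power_int_minus inverse_le_1_iff)
  qed
  have le: "L powi (- (2 * int k)) * x \<le> x" if "x \<ge> 0" for x k
    using mult_right_mono[OF le1 that, of k] by simp
  have sc: "norm (H (fk k *\<^sub>v att P) (att P)) = L powi (2 * (\<sigma> * int k)) * norm (H (f *\<^sub>v att P) (att P))"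
    "norm (H (fk k *\<^sub>v att P) (rpl P)) = norm (H (f *\<^sub>v att P) (rpl P))"
    "norm (H (fk k *\<^sub>v rpl P) (att P)) = norm (H (f *\<^sub>v rpl P) (att P))"
    "norm (H (fk k *\<^sub>v rpl P) (rpl P)) = L powi (- (2 * (\<sigma> * int k))) * norm (H (f *\<^sub>v rpl P) (rpl P))" for k
    using herm_pow_scale[OF nf fS, of "- (\<sigma> * int k)" "\<sigma> * int k", folded fk_def L_def] by simp_all
  have "norm (H (fk k *\<^sub>v att P) (att P)) \<le> norm (H (f *\<^sub>v att P) (att P))" for k
    unfolding sc using le[of "norm (H (f *\<^sub>v att P) (att P))" k] by (auto simp: \<sigma>_def)
  moreover have "norm (H (fk k *\<^sub>v rpl P) (rpl P)) \<le> norm (H (f *\<^sub>v rpl P) (rpl P))" for k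
    unfolding sc using le[of "norm (H (f *\<^sub>v rpl P) (rpl P))" k] B' by (auto simp: \<sigma>_def)
  ultimately have bd: "norm (H (fk k *\<^sub>v x) y) \<le> K" if "x \<in> {att P, rpl P}" "y \<in> {att P, rpl P}" for k x y
    using that sc(2,3)[of k] norm_ge_zero[of "H (f *\<^sub>v att P) (att P)"] norm_ge_zero[of "H (f *\<^sub>v rpl P) (rpl P)"]
      norm_ge_zero[of "H (f *\<^sub>v att P) (rpl P)"] norm_ge_zero[of "H (f *\<^sub>v rpl P) (att P)"]
    unfolding K_def by (smt (verit) insertE singletonD)
  obtain a b where ab: "a < b" "fk a = fk b"
    by (rule corners_discrete_repeats[OF G fkG NF_D(1)[OF nf] bd])
  define m where "m = b - a"
  have m: "m \<noteq> 0" "int b = int a + int m" using ab(1) by (simp_all add: m_def)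
  define p where "p = g [^]\<^bsub>Sp n\<^esub> (\<sigma> * int m)"
  define p' where "p' = g [^]\<^bsub>Sp n\<^esub> (\<sigma> * int a)"
  have pS: "p \<in> S" "p' \<in> S" using gS by (simp_all add: p_def p'_def)
  have gb: "g [^]\<^bsub>Sp n\<^esub> (\<sigma> * int b) = p * p'"
    using Sp.int_pow_mult[OF gS, of "\<sigma> * int m" "\<sigma> * int a"] unfolding m(2) p_def p'_def
    by (simp add: distrib_left add.commute)
  have "inv_Sp p' * f * p' = inv_Sp (p * p') * f * (p * p')"
    using ab(2) unfolding fk_def Sp.int_pow_neg[OF gS] gb p'_def[symmetric] .
  then have comm: "p * f = f * p" using Sp.conj_eq_imp_commute[OF pS fS] by simp
  define pm where "pm = g [^]\<^bsub>Sp n\<^esub> m"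
  have pmS: "pm \<in> S" using gS by (simp add: pm_def)
  have "p = pm \<or> p = inv_Sp pm"
    unfolding p_def pm_def \<sigma>_def using Sp.int_pow_neg_int[OF gS, of m] int_pow_int[of "Sp n" g m] by auto
  then have comm': "pm * f = f * pm"
    using comm Sp.commute_if_inv_commute[OF pmS fS] by auto
  \<comment> \<open>An element commuting with \<open>pm\<close> maps its eigenvectors to
    eigenvectors, and the null ones represent only the two ends.\<close>
  have ends: "proj (f *\<^sub>v x) = proj (att P) \<or> proj (f *\<^sub>v x) = proj (rpl P)"
    if x: "x \<in> V" "f *\<^sub>v x \<noteq> 0\<^sub>v (Suc n)" "Q (f *\<^sub>v x) = 0" and ex: "\<exists>c. pm *\<^sub>v x = x \<cdot>\<^sub>r c" for x
  proof -
    obtain c where c: "pm *\<^sub>v x = x \<cdot>\<^sub>r c" using ex by blast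
    have "pm *\<^sub>v (f *\<^sub>v x) = f *\<^sub>v (pm *\<^sub>v x)"
      using S_mult_vec[OF pmS fS x(1)] S_mult_vec[OF fS pmS x(1)] comm' by simp
    also have "\<dots> = (f *\<^sub>v x) \<cdot>\<^sub>r c" unfolding c using S_rsmult[OF fS x(1)] by simp
    finally show ?thesis unfolding pm_def using NF_fixed_power[OF nf m(1), of "f *\<^sub>v x"] x fS by auto
  qed
  have "\<exists>c. pm *\<^sub>v att P = att P \<cdot>\<^sub>r c" "\<exists>c. pm *\<^sub>v rpl P = rpl P \<cdot>\<^sub>r c"
    unfolding pm_def using NF_int_pow[OF nf, of "int m"] by (auto simp: int_pow_int)
  then have E: "proj (f *\<^sub>v att P) = proj (att P) \<or> proj (f *\<^sub>v att P) = proj (rpl P)"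
    "proj (f *\<^sub>v rpl P) = proj (att P) \<or> proj (f *\<^sub>v rpl P) = proj (rpl P)"
    using ends N N' by blast+
  have ne: "proj (f *\<^sub>v att P) \<noteq> proj (f *\<^sub>v rpl P)"
    using null_herm_eq_0_iff[of "f *\<^sub>v att P" "f *\<^sub>v rpl P"] N' by auto
  have ne': "proj (att P) \<noteq> proj (rpl P)" using null_herm_eq_0_iff[of "att P" "rpl P"] N by auto
  from B' show ?thesis
  proof
    assume "H (f *\<^sub>v att P) (att P) = 0"
    then have "proj (f *\<^sub>v att P) = proj (att P)" using null_herm_eq_0_iff[of "f *\<^sub>v att P" "att P"] N N' by auto
    then show ?thesis using E ne by (auto simp: fixes_ends_def)
  next
    assume "H (f *\<^sub>v rpl P) (rpl P) = 0"
    then have "proj (f *\<^sub>v rpl P) = proj (rpl P)" using null_herm_eq_0_iff[of "f *\<^sub>v rpl P" "rpl P"] N N' by auto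
    then show ?thesis using E ne by (auto simp: fixes_ends_def)
  qed
qed



end

text \<open>The product is the mean of \<open>cosh (2 (a + b))\<close> and
  \<open>cosh (2 (a - b))\<close>; the second is at least one, and half angles give the
  square.\<close>

lemma cosh_add_square_le: "(cosh (a + b))\<^sup>2 \<le> cosh (2 * a) * cosh (2 * b)" for a b :: real
proof -
  have "cosh (2 * a) * cosh (2 * b) = (cosh (2 * (a + b)) + cosh (2 * (a - b))) / 2"
    by (simp add: distrib_left right_diff_distrib cosh_add cosh_diff)
  moreover have "cosh (2 * (a - b)) \<ge> 1" by (rule cosh_real_ge_1)
  moreover have "cosh (2 * (a + b)) = 2 * (cosh (a + b))\<^sup>2 - 1" by (rule cosh_double_cosh)
  ultimately show ?thesis by simp
qed

context herm_space
begin

section \<open>Jorgensen's inequality\<close>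

lemma NF_fixed_points_conj:
  assumes nf: "NF g P l" and f: "f \<in> S"
  shows "fixed_points n (f * g * inv_Sp f) = {proj (f *\<^sub>v att P), proj (f *\<^sub>v rpl P)}"
  using NF_fixed_points[OF NF_conj(1)[OF f nf]] NF_conj(2,3)[OF f nf] by simp

lemma proj_att_ne_rpl: "P \<in> S \<Longrightarrow> proj (att P) \<noteq> proj (rpl P)"
  using null_herm_eq_0_iff[of "att P" "rpl P"] null_pairD[OF null_pair_att_rpl[of P]] by auto

text \<open>A loxodromic element cannot interchange the ends: its square would have too many fixed points.\<close>

lemma lox_preserving_ends:
  assumes P: "P \<in> S" and nf: "NF h R m"
    and pres: "{proj (h *\<^sub>v att P), proj (h *\<^sub>v rpl P)} = {proj (att P), proj (rpl P)}"
  shows "fixes_ends P h"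
proof (rule ccontr)
  note N = null_pairD[OF null_pair_att_rpl[OF P]] and h = NF_D(3)[OF nf]
  assume "\<not> fixes_ends P h"
  then have sw: "proj (h *\<^sub>v att P) = proj (rpl P)" "proj (h *\<^sub>v rpl P) = proj (att P)"
    using pres by (auto simp: fixes_ends_def doubleton_eq_iff)
  have "act h (act h (proj (att P))) = proj (att P)"
    using act_proj[OF h N(1)] act_proj[OF h N(2)] sw by simp
  then have "proj (h *\<^sub>v (h *\<^sub>v att P)) = proj (att P)"
    using act_proj[OF h N(1)] act_proj[OF h S_vec[OF h N(1)]] by simp
  then obtain c where "h *\<^sub>v (h *\<^sub>v att P) = att P \<cdot>\<^sub>r c" using proj_eq_iff by metis
  then have sq: "(h [^]\<^bsub>Sp n\<^esub> Suc (Suc 0)) *\<^sub>v att P = att P \<cdot>\<^sub>r c"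
    unfolding mat_pow_vec(2)[OF h N(1)] mat_pow_vec(2)[OF h S_vec[OF h N(1)]]
      mat_pow_vec(1)[OF h S_vec[OF h S_vec[OF h N(1)]]] .
  have "proj (att P) = proj (att R) \<or> proj (att P) = proj (rpl R)"
    by (rule NF_fixed_power[OF nf _ N(1,9) _ sq]) (simp_all add: N(3))
  then have "proj (att P) \<in> fixed_points n h" unfolding NF_fixed_points[OF nf] by blast
  then have "act h (proj (att P)) = proj (att P)" by (simp add: fixed_points_def)
  then have "proj (rpl P) = proj (att P)" using act_proj[OF h N(1)] sw by simp
  then show False using proj_att_ne_rpl[OF P] by simp
qed

text \<open>The displacement bound at both ends of \<open>P\<close>; the four products regroup into
  the two cross ratios.\<close>

lemma B2_displacement:
  assumes nf: "NF h R m" and P: "P \<in> S"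
  shows "B2 P h \<le> (lox_value n m)\<^sup>2 * ((norm (H (att R) (rpl P)) * norm (H (rpl R) (att P)))
    * (norm (H (att R) (att P)) * norm (H (rpl R) (rpl P))))"
proof -
  note N = null_pairD[OF null_pair_att_rpl[OF P]]
  have "B2 P h \<le> (lox_value n m * (norm (H (att P) (att R)) * norm (H (att P) (rpl R))))
      * (lox_value n m * (norm (H (rpl P) (att R)) * norm (H (rpl P) (rpl R))))"
    unfolding B2_def using lox_value_pos[OF nf] N
    by (intro mult_mono NF_displacement[OF nf]) auto
  also have "\<dots> = (lox_value n m)\<^sup>2 * ((norm (H (att R) (rpl P)) * norm (H (rpl R) (att P)))
    * (norm (H (att R) (att P)) * norm (H (rpl R) (rpl P))))"
    unfolding norm_herm_sym[of "att P"] norm_herm_sym[of "rpl P"] power2_eq_square by (simp only: mult_ac)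
  finally show ?thesis .
qed

lemma A2_ptolemy: "f \<in> S \<Longrightarrow> P \<in> S \<Longrightarrow> sqrt (A2 P f) \<le> 1 + sqrt (B2 P f)"
  unfolding A2_def B2_def using ptolemy[OF null_pair_att_rpl null_pair_S[OF _ null_pair_att_rpl]] by blast

text \<open>Jorgensen's inequality, in contrapositive form for loxodromic \<open>h\<close>. Along the sequence
  $h_{k+1} = h_k g h_k^{-1}$ the square root $\beta_k$ of \<open>B2 P (h k)\<close> satisfies
  $\beta_{k+1} \le M_g\, \beta_k (1 + \beta_k)$, hence decreases strictly as long as it is positive.\<close>

lemma jorgensen:
  assumes G: "subgroup G (Sp n)" "discrete_mats n G" and nf: "NF g P l" and g: "g \<in> G"
    and nfh: "NF h R m" and h: "h \<in> G" and small: "lox_value n l * (1 + sqrt (B2 P h)) < 1"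
  shows "fixes_ends P h"
proof -
  define M where "M = lox_value n l"
  have M: "M > 0" using lox_value_pos[OF nf] by (simp add: M_def)
  note P = NF_D(1)[OF nf]
  define hs where "hs = rec_nat h (\<lambda>_ f. f * g * inv_Sp f)"
  have hs: "hs 0 = h" "hs (Suc k) = hs k * g * inv_Sp (hs k)" for k by (simp_all add: hs_def)
  have hG: "hs k \<in> G" for k
  proof (induction k)
    case (Suc k)
    then show ?case using subgroup.m_closed[OF G(1)] subgroup.m_inv_closed[OF G(1)] g
      unfolding hs by (metis Sp_simps(1))
  qed (simp add: hs h)
  have hS: "hs k \<in> S" for k using hG subgroup.subset[OF G(1)] by blast
  define \<beta> where "\<beta> k = sqrt (B2 P (hs k))" for k
  have \<beta>0: "\<beta> k \<ge> 0" for k by (simp add: \<beta>_def A2_B2_nonneg)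
  have \<beta>2: "B2 P (hs k) = (\<beta> k)\<^sup>2" for k by (simp add: \<beta>_def A2_B2_nonneg)
  have step: "\<beta> (Suc k) \<le> M * ((1 + \<beta> k) * \<beta> k)" for k
  proof -
    \<comment> \<open>The new element is a conjugate of \<open>g\<close> with ends
      \<open>hs k u\<close>, \<open>hs k v\<close>, so the two cross ratios in the displacement
      bound are those of \<open>hs k\<close>.\<close>
    have "B2 P (hs (Suc k)) \<le> M\<^sup>2 * (A2 P (hs k) * B2 P (hs k))"
      using B2_displacement[OF NF_conj(1)[OF hS[of k] nf] P] NF_conj(2,3)[OF hS[of k] nf]
      unfolding hs(2) M_def A2_def B2_def[of P "hs k"] by simp
    then have "\<beta> (Suc k) \<le> sqrt (M\<^sup>2 * (A2 P (hs k) * B2 P (hs k)))" unfolding \<beta>_def by simp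
    also have "\<dots> = M * (sqrt (A2 P (hs k)) * \<beta> k)" using M by (simp add: real_sqrt_mult \<beta>_def)
    also have "\<dots> \<le> M * ((1 + \<beta> k) * \<beta> k)"
      using A2_ptolemy[OF hS P] M \<beta>0 unfolding \<beta>_def by (intro mult_left_mono mult_right_mono) auto
    finally show ?thesis .
  qed
  have small': "M * (1 + \<beta> 0) < 1" using small by (simp add: M_def \<beta>_def hs)
  have decr: "\<beta> (Suc k) \<le> M * (1 + \<beta> 0) * \<beta> k" if "\<beta> k \<le> \<beta> 0" for k
  proof -
    have "M * ((1 + \<beta> k) * \<beta> k) \<le> M * ((1 + \<beta> 0) * \<beta> k)"
      using M \<beta>0 that by (intro mult_left_mono mult_right_mono) auto
    with step[of k] show ?thesis by (simp add: mult.assoc)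
  qed
  have le0: "\<beta> k \<le> \<beta> 0" for k
  proof (induction k)
    case (Suc k)
    have "M * (1 + \<beta> 0) * \<beta> k \<le> 1 * \<beta> k" using small' \<beta>0 by (intro mult_right_mono) auto
    with decr[OF Suc] Suc show ?case by simp
  qed simp
  have "\<exists>k. \<beta> k = 0"
  proof (rule ccontr)
    assume "\<nexists>k. \<beta> k = 0"
    then have pos: "\<beta> k > 0" for k using \<beta>0[of k] by (metis less_eq_real_def)
    have "- \<beta> k < - \<beta> (Suc k)" for k
    proof -
      have "M * (1 + \<beta> 0) * \<beta> k < 1 * \<beta> k" using small' pos by (intro mult_strict_right_mono) auto
      with decr[OF le0, of k] show ?thesis by simp
    qed
    then have mono: "- \<beta> a < - \<beta> b" if "a < b" for a b
      using lift_Suc_mono_less[of "\<lambda>k. - \<beta> k" a b] that by blast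
    have Bk: "B2 P (hs k) \<le> (1 + \<beta> 0)\<^sup>2" for k
      unfolding \<beta>2 using le0[of k] \<beta>0[of k] by (intro power_mono) auto
    have Ak: "A2 P (hs k) \<le> (1 + \<beta> 0)\<^sup>2" for k
    proof -
      have "sqrt (A2 P (hs k)) \<le> 1 + \<beta> 0" using A2_ptolemy[OF hS P, of k] le0[of k] unfolding \<beta>_def by linarith
      then have "(sqrt (A2 P (hs k)))\<^sup>2 \<le> (1 + \<beta> 0)\<^sup>2" by (intro power_mono) (simp_all add: A2_B2_nonneg)
      then show ?thesis by (simp add: A2_B2_nonneg)
    qed
    have "1 + \<beta> 0 > 0" using \<beta>0[of 0] by simp
    then obtain a b :: nat where "a < b" "B2 P (hs a) = B2 P (hs b)"
      by (rule cross_ratio_discrete_repeats[OF G nf g hG Ak Bk])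
    then show False using mono[of a b] by (simp add: \<beta>_def)
  qed
  then obtain k where "\<beta> k = 0" ..
  then have "B2 P (hs k) = 0" unfolding \<beta>2 by simp
  then have "fixes_ends P (hs k)" using shared_end[OF G nf g hG] by blast
  \<comment> \<open>Descent to \<open>h\<close>: if \<open>hs (Suc k)\<close> fixes \<open>u\<close>
    and \<open>v\<close>, these are its only fixed points, so \<open>hs k\<close> preserves the pair
    of ends.\<close>
  then show ?thesis
  proof (induction k)
    case 0
    then show ?case by (simp add: hs)
  next
    case (Suc k)
    note N = null_pairD[OF null_pair_att_rpl[OF P]]
    have "proj (att P) \<in> fixed_points n (hs (Suc k))" "proj (rpl P) \<in> fixed_points n (hs (Suc k))"
      using Suc.prems act_proj[OF hS N(1)] act_proj[OF hS N(2)] bdryI[OF N(1,9,3)] bdryI[OF N(2,10,4)]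
      by (simp_all add: fixes_ends_def fixed_points_def)
    then have "{proj (att P), proj (rpl P)} \<subseteq> {proj (hs k *\<^sub>v att P), proj (hs k *\<^sub>v rpl P)}"
      unfolding hs(2) NF_fixed_points_conj[OF nf hS] by blast
    then have eq: "{proj (hs k *\<^sub>v att P), proj (hs k *\<^sub>v rpl P)} = {proj (att P), proj (rpl P)}"
      using proj_att_ne_rpl[OF P] by auto
    \<comment> \<open>\<open>hs k\<close> has a normal form: as \<open>h\<close> itself for
      \<open>k = 0\<close>, as a conjugate of \<open>g\<close> otherwise. It therefore cannot swap
      the ends.\<close>
    obtain R' m' where "NF (hs k) R' m'"
    proof (cases k)
      case 0
      then show ?thesis using that nfh hs by simp
    next
      case (Suc j)
      then show ?thesis using that NF_conj(1)[OF hS nf, of j] unfolding Suc hs by blast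
    qed
    then have "fixes_ends P (hs k)" using lox_preserving_ends[OF P _ eq] by blast
    then show ?case by (rule Suc.IH)
  qed
qed

section \<open>Disjointness of collars\<close>

lemma close_axes_eq:
  assumes G: "subgroup G (Sp n)" "discrete_mats n G"
    and g: "g \<in> G" "NF g P l" and h: "h \<in> G" "NF h R m"
    and x: "x \<in> axis_of (att P) (rpl P)" and y: "y \<in> axis_of (att R) (rpl R)"
    and rho: "rho n x y < r\<^sub>1 + r\<^sub>2"
    and r1: "cosh (2 * r\<^sub>1) = 2 * (1 - lox_value n l) / (lox_value n l)\<^sup>2"
    and r2: "cosh (2 * r\<^sub>2) = 2 * (1 - lox_value n m) / (lox_value n m)\<^sup>2"
    and le: "lox_value n l \<le> lox_value n m"
  shows "fixed_points n g = fixed_points n h"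
proof -
  define M M' where "M = lox_value n l" and "M' = lox_value n m"
  have pos: "M > 0" "M' > 0" using lox_value_pos g(2) h(2) by (auto simp: M_def M'_def)
  note P = NF_D(1)[OF g(2)] and R = NF_D(1)[OF h(2)] and hS = NF_D(3)[OF h(2)]
  note nP = null_pair_att_rpl[OF P] and nR = null_pair_att_rpl[OF R]
  have xy: "x \<in> hyp n" "y \<in> hyp n" using x y axis_of_hyp[OF nP] axis_of_hyp[OF nR] by auto
  define s t where "s = norm (H (att R) (rpl P)) * norm (H (rpl R) (att P))"
    and "t = norm (H (att R) (att P)) * norm (H (rpl R) (rpl P))"
  have st: "s \<ge> 0" "t \<ge> 0" by (simp_all add: s_def t_def)
  have "s + t \<le> cosh (rho n x y)"
    using cross_ratio_le_cosh_rho[OF nP nR x y] by (simp add: s_def t_def)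
  also have "\<dots> < cosh (r\<^sub>1 + r\<^sub>2)"
    using rho rho_nonneg[OF xy] by (simp add: cosh_real_nonneg_less_iff)
  finally have "(s + t)\<^sup>2 < (cosh (r\<^sub>1 + r\<^sub>2))\<^sup>2" using st by (intro power_strict_mono) auto
  also have "\<dots> \<le> cosh (2 * r\<^sub>1) * cosh (2 * r\<^sub>2)" by (rule cosh_add_square_le)
  also have "\<dots> = 4 * ((1 - M) * (1 - M')) / (M\<^sup>2 * M'\<^sup>2)"
    unfolding r1 r2 M_def M'_def times_divide_times_eq by (simp only: mult_ac)
  finally have lt: "(s + t)\<^sup>2 < 4 * ((1 - M) * (1 - M')) / (M\<^sup>2 * M'\<^sup>2)" .
  \<comment> \<open>The formula for the width has the sign of \<open>1 - M\<close>.\<close>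
  have "cosh (2 * r\<^sub>1) > 0" by (rule cosh_real_pos)
  then have M1: "M < 1" using pos(1) unfolding r1 M_def[symmetric] by (simp add: zero_less_divide_iff)
  have "4 * (s * t) \<le> (s + t)\<^sup>2" using sum_squares_bound[of s t] by (simp add: power2_eq_square algebra_simps)
  then have "M'\<^sup>2 * (s * t) \<le> M'\<^sup>2 * ((s + t)\<^sup>2 / 4)" by (intro mult_left_mono) auto
  also have "\<dots> < M'\<^sup>2 * (((1 - M) * (1 - M')) / (M\<^sup>2 * M'\<^sup>2))"
  proof -
    have "(s + t)\<^sup>2 / 4 < (1 - M) * (1 - M') / (M\<^sup>2 * M'\<^sup>2)" using lt by argo
    then show ?thesis using pos by (intro mult_strict_left_mono) auto
  qed
  also have "\<dots> = (1 - M) * (1 - M') / M\<^sup>2" using pos by (simp add: field_simps)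
  \<comment> \<open>Here the ordering of the invariants enters: the element iterated against is the
    one with the smaller value.\<close>
  also have "\<dots> \<le> (1 - M) * (1 - M) / M\<^sup>2"
    using M1 le by (intro divide_right_mono mult_left_mono) (auto simp: M_def M'_def)
  finally have "M'\<^sup>2 * (s * t) < ((1 - M) / M)\<^sup>2" by (simp add: power2_eq_square)
  moreover have "B2 P h \<le> M'\<^sup>2 * (s * t)" using B2_displacement[OF h(2) P] by (simp add: M'_def s_def t_def)
  ultimately have "B2 P h < ((1 - M) / M)\<^sup>2" by simp
  then have "sqrt (B2 P h) < (1 - M) / M" using M1 pos by (intro real_less_lsqrt) auto
  then have "M * (1 + sqrt (B2 P h)) < 1" using pos by (simp add: field_simps)
  then have "fixes_ends P h" using jorgensen[OF G g(2,1) h(2,1)] by (simp add: M_def)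
  then have "act h (proj (att P)) = proj (att P)" "act h (proj (rpl P)) = proj (rpl P)"
    using act_proj[OF hS] null_pairD(1,2)[OF nP] by (simp_all add: fixes_ends_def)
  then have "{proj (att P), proj (rpl P)} \<subseteq> fixed_points n h"
    using null_pairD[OF nP] bdryI by (simp add: fixed_points_def)
  then show ?thesis
    unfolding NF_fixed_points[OF g(2)] NF_fixed_points[OF h(2)] using proj_att_ne_rpl[OF P] by auto
qed

text \<open>An axis comes with its ends in either order, whence the swap.\<close>

lemma axis_eq_axis_of:
  assumes nf: "NF g P l" and ax: "is_axis n g \<gamma>"
  shows "\<gamma> = axis_of (att P) (rpl P)"
proof -
  note nP = null_pair_att_rpl[OF NF_D(1)[OF nf]]
  obtain p q where pq: "p \<noteq> q" "fixed_points n g = {p, q}" "geodesic_joining n p q \<gamma>"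
    using ax unfolding is_axis_def by blast
  then have "(p = proj (att P) \<and> q = proj (rpl P)) \<or> (p = proj (rpl P) \<and> q = proj (att P))"
    unfolding NF_fixed_points[OF nf] by (auto simp: doubleton_eq_iff)
  then show ?thesis
    using geodesic_eq_axis_of[OF nP] geodesic_eq_axis_of[OF null_pair_sym[OF nP]] axis_of_swap[OF nP] pq(3) by blast
qed

lemma axis_of_eq_if_fixed_points_eq:
  assumes "NF g P l" "NF h R m" "fixed_points n g = fixed_points n h"
  shows "axis_of (att P) (rpl P) = axis_of (att R) (rpl R)"
proof -
  note nP = null_pair_att_rpl[OF NF_D(1)[OF assms(1)]] and nR = null_pair_att_rpl[OF NF_D(1)[OF assms(2)]]
  have "{proj (att P), proj (rpl P)} = {proj (att R), proj (rpl R)}"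
    using assms NF_fixed_points by metis
  then consider "proj (att P) = proj (att R)" "proj (rpl P) = proj (rpl R)"
    | "proj (att P) = proj (rpl R)" "proj (rpl P) = proj (att R)"
    by (auto simp: doubleton_eq_iff)
  then show ?thesis
  proof cases
    case 1
    then show ?thesis by (rule axis_of_proj_cong[OF nP nR])
  next
    case 2
    then show ?thesis using axis_of_proj_cong[OF nP null_pair_sym[OF nR]] axis_of_swap[OF nR] by simp
  qed
qed

section \<open>Orbits, tubes and the passage to the quotient\<close>

lemma hyp_V: "p \<in> hyp n \<Longrightarrow> p \<subseteq> V"
  unfolding hyp_iff proj_eq by auto

lemma act_mult: "f \<in> S \<Longrightarrow> g \<in> S \<Longrightarrow> p \<subseteq> V \<Longrightarrow> act (f * g) p = act f (act g p)"
  unfolding act_def image_image using S_mult_vec by (intro image_cong) auto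

lemma act_one: "p \<subseteq> V \<Longrightarrow> act (1\<^sub>m (Suc n)) p = p"
  unfolding act_def using S_one_vec by (force simp: image_iff)

lemma G_orbit_act:
  assumes G: "subgroup G (Sp n)" and f: "f \<in> G" and p: "p \<subseteq> V"
  shows "G_orbit G (act f p) = G_orbit G p"
proof -
  have S: "k \<in> S" if "k \<in> G" for k using that subgroup.subset[OF G] by blast
  have "act k (act f p) \<in> G_orbit G p" if k: "k \<in> G" for k
  proof -
    have "k * f \<in> G" using subgroup.m_closed[OF G k f] by simp
    then show ?thesis unfolding G_orbit_def act_mult[OF S[OF k] S[OF f] p, symmetric] by blast
  qed
  moreover have "act k p \<in> G_orbit G (act f p)" if k: "k \<in> G" for k
  proof -
    have i: "inv_Sp f \<in> G" using subgroup.m_inv_closed[OF G f] .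
    have kG: "k * inv_Sp f \<in> G" using subgroup.m_closed[OF G k i] by simp
    have "k * inv_Sp f * f = k"
      using Sp.inv_solve_right[of "k * inv_Sp f" k f] S[OF k] S[OF f] by simp
    then have "act k p = act (k * inv_Sp f) (act f p)"
      using act_mult[OF S[OF kG] S[OF f] p] by simp
    then show ?thesis unfolding G_orbit_def using kG by blast
  qed
  ultimately show ?thesis unfolding G_orbit_def by blast
qed

text \<open>An infimum below \<open>r\<close> is undercut by an actual distance, provided the
  geodesic is nonempty.\<close>

lemma tubeE:
  assumes "z \<in> tube n r \<gamma>" "\<gamma> \<noteq> {}"
  obtains p where "z \<in> hyp n" "p \<in> \<gamma>" "rho n z p < r"
proof -
  have "(INF p\<in>\<gamma>. rho n z p) < r" using assms by (simp add: tube_def)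
  then obtain d where "d \<in> rho n z ` \<gamma>" "d < r" using cInf_lessD[of "rho n z ` \<gamma>" r] assms(2) by auto
  then show ?thesis using that assms(1) by (auto simp: tube_def)
qed

text \<open>A common point of the collars lifts to points of the two tubes that differ by some
  \<open>f\<close> in \<open>G\<close>. Conjugating \<open>h\<close> by \<open>f\<close> keeps its
  invariant and brings its axis close to that of \<open>g\<close>; the axes then coincide, so both
  geodesics have the same image in the quotient.\<close>

lemma collars_disjoint:
  assumes G: "subgroup G (Sp n)" "discrete_mats n G"
    and g: "g \<in> G" "loxodromic n g" "is_axis n g \<gamma>\<^sub>1" and h: "h \<in> G" "loxodromic n h" "is_axis n h \<gamma>\<^sub>2"
    and ne: "closed_geodesic G \<gamma>\<^sub>1 \<noteq> closed_geodesic G \<gamma>\<^sub>2"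
    and r1: "cosh (2 * r\<^sub>1) = 2 * (1 - lox_M n g) / (lox_M n g)\<^sup>2"
    and r2: "cosh (2 * r\<^sub>2) = 2 * (1 - lox_M n h) / (lox_M n h)\<^sup>2"
  shows "collar n G r\<^sub>1 \<gamma>\<^sub>1 \<inter> collar n G r\<^sub>2 \<gamma>\<^sub>2 = {}"
proof (rule ccontr)
  assume "collar n G r\<^sub>1 \<gamma>\<^sub>1 \<inter> collar n G r\<^sub>2 \<gamma>\<^sub>2 \<noteq> {}"
  then obtain z1 z2 where z1: "z1 \<in> tube n r\<^sub>1 \<gamma>\<^sub>1" and z2: "z2 \<in> tube n r\<^sub>2 \<gamma>\<^sub>2"
    and orb: "G_orbit G z1 = G_orbit G z2" unfolding collar_def by auto
  define l m where "l = lox_eigenvalues n g" and "m = lox_eigenvalues n h"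
  obtain P where P: "NF g P l" using loxodromic_NF_eigenvalues[OF g(2)] unfolding l_def .
  obtain R where R: "NF h R m" using loxodromic_NF_eigenvalues[OF h(2)] unfolding m_def .
  note nP = null_pair_att_rpl[OF NF_D(1)[OF P]] and nR = null_pair_att_rpl[OF NF_D(1)[OF R]]
  have ax: "\<gamma>\<^sub>1 = axis_of (att P) (rpl P)" "\<gamma>\<^sub>2 = axis_of (att R) (rpl R)"
    using axis_eq_axis_of P R g(3) h(3) by blast+
  have sub: "\<gamma>\<^sub>1 \<subseteq> hyp n" "\<gamma>\<^sub>2 \<subseteq> hyp n" using ax axis_of_hyp nP nR by auto
  have "proj (att P \<cdot>\<^sub>r of_real 1 + rpl P) \<in> \<gamma>\<^sub>1" "proj (att R \<cdot>\<^sub>r of_real 1 + rpl R) \<in> \<gamma>\<^sub>2"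
    unfolding ax axis_of_def by (rule CollectI, rule exI[of _ 1], simp)+
  then have nonempty: "\<gamma>\<^sub>1 \<noteq> {}" "\<gamma>\<^sub>2 \<noteq> {}" by blast+
  obtain w1 where w1: "z1 \<in> hyp n" "w1 \<in> \<gamma>\<^sub>1" "rho n z1 w1 < r\<^sub>1" using tubeE[OF z1 nonempty(1)] .
  obtain w2 where w2: "z2 \<in> hyp n" "w2 \<in> \<gamma>\<^sub>2" "rho n z2 w2 < r\<^sub>2" using tubeE[OF z2 nonempty(2)] .
  have "act (1\<^sub>m (Suc n)) z1 \<in> G_orbit G z1"
    unfolding G_orbit_def using subgroup.one_closed[OF G(1)] by simp
  then have "z1 \<in> G_orbit G z2" using act_one[OF hyp_V[OF w1(1)]] orb by simp
  then obtain f where f: "f \<in> G" "z1 = act f z2" by (auto simp: G_orbit_def)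
  have fS: "f \<in> S" using f(1) subgroup.subset[OF G(1)] by blast
  define h' where "h' = f * h * inv_Sp f"
  have h': "h' \<in> G" using subgroup.m_closed[OF G(1)] subgroup.m_inv_closed[OF G(1) f(1)] f(1) h(1)
    unfolding h'_def by (metis Sp_simps(1))
  note R' = NF_conj[OF fS R, folded h'_def]
  have img: "act f ` \<gamma>\<^sub>2 = axis_of (att (f * R)) (rpl (f * R))" unfolding ax(2) R'(2,3) by (rule axis_of_act[OF fS nR])
  have hyps: "w1 \<in> hyp n" "w2 \<in> hyp n" using w1(2) w2(2) sub by auto
  have fw: "act f w2 \<in> hyp n" using act_hyp[OF fS hyps(2)] .
  have "rho n w1 (act f w2) \<le> rho n w1 z1 + rho n z1 (act f w2)" by (rule rho_triangle[OF hyps(1) w1(1) fw])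
  also have "rho n w1 z1 = rho n z1 w1" by (rule rho_commute[OF hyps(1) w1(1)])
  also have "rho n z1 (act f w2) = rho n z2 w2" unfolding f(2) by (rule rho_act[OF fS w2(1) hyps(2)])
  finally have d: "rho n w1 (act f w2) < r\<^sub>1 + r\<^sub>2" using w1(3) w2(3) by simp
  have x: "w1 \<in> axis_of (att P) (rpl P)" using w1(2) ax by simp
  have y: "act f w2 \<in> axis_of (att (f * R)) (rpl (f * R))" using w2(2) img by blast
  have M: "lox_M n g = lox_value n l" "lox_M n h = lox_value n m" by (simp_all add: lox_M_eq l_def m_def)
  have "fixed_points n g = fixed_points n h'"
  proof (cases "lox_value n l \<le> lox_value n m")
    case True
    show ?thesis by (rule close_axes_eq[OF G g(1) P h' R'(1) x y d r1[unfolded M] r2[unfolded M] True])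
  next
    \<comment> \<open>The roles of the two elements are exchanged, so that the smaller invariant
      comes first.\<close>
    case False
    have d': "rho n (act f w2) w1 < r\<^sub>2 + r\<^sub>1" using d rho_commute[OF hyps(1) fw] by simp
    show ?thesis
      by (rule close_axes_eq[OF G h' R'(1) g(1) P y x d' r2[unfolded M] r1[unfolded M], symmetric]) (use False in simp)
  qed
  then have "act f ` \<gamma>\<^sub>2 = \<gamma>\<^sub>1" unfolding img ax(1) using axis_of_eq_if_fixed_points_eq[OF P R'(1)] by simp
  then have "closed_geodesic G \<gamma>\<^sub>1 = (\<lambda>p. G_orbit G (act f p)) ` \<gamma>\<^sub>2"
    unfolding closed_geodesic_def by (metis image_image)
  also have "\<dots> = closed_geodesic G \<gamma>\<^sub>2"
    unfolding closed_geodesic_def using G_orbit_act[OF G(1) f(1)] hyp_V sub(2) by (intro image_cong) auto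
  finally show False using ne by simp
qed

end

theorem theorem1p4:
  fixes n :: nat and G :: "quat mat set" and g h :: "quat mat"
    and \<gamma>\<^sub>1 \<gamma>\<^sub>2 :: "point set" and r\<^sub>1 r\<^sub>2 :: real
  assumes "n \<ge> 1"
    and "manifold_group n G"
    and "g \<in> G" and "loxodromic n g" and "is_axis n g \<gamma>\<^sub>1" and "lox_M n g < sqrt 3 - 1"
    and "h \<in> G" and "loxodromic n h" and "is_axis n h \<gamma>\<^sub>2" and "lox_M n h < sqrt 3 - 1"
    and "simple_below G \<gamma>\<^sub>1" and "simple_below G \<gamma>\<^sub>2"
    and "closed_geodesic G \<gamma>\<^sub>1 \<noteq> closed_geodesic G \<gamma>\<^sub>2"
    and "r\<^sub>1 > 0" and "cosh (2 * r\<^sub>1) = 2 * (1 - lox_M n g) / (lox_M n g)\<^sup>2"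
    and "r\<^sub>2 > 0" and "cosh (2 * r\<^sub>2) = 2 * (1 - lox_M n h) / (lox_M n h)\<^sup>2"
  shows "collar n G r\<^sub>1 \<gamma>\<^sub>1 \<inter> collar n G r\<^sub>2 \<gamma>\<^sub>2 = {}"
proof -
  interpret herm_space n by unfold_locales (rule assms(1))
  have "subgroup G (Sp n)" "discrete_mats n G"
    using assms(2) by (simp_all add: manifold_group_def)
  then show ?thesis
    by (rule collars_disjoint[OF _ _ assms(3-5,7-9,13,15,17)])
qed

end
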